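(* Let $\Gamma$ be a finite simplicial graph and let $\mathrm{Aut}(A_\Gamma)$ be the automorphism group of the right-angled Artin group $A_\Gamma$. Let $\Delta$ be the induced subgraph of $\Gamma$ on the vertices $v$ with $st(v)=V(\Gamma)$; write $V(\Delta)=\{v_1,\ldots,v_n\}$ and $V(\Gamma)-V(\Delta)=\{w_1,\ldots,w_m\}$, where $n,m\geq 0$. Let $N\trianglelefteq\mathrm{Aut}(A_\Gamma)$ be a non-trivial normal subgroup which is non full-sized and which is maximal (with respect to inclusion) among the non full-sized normal subgroups of $\mathrm{Aut}(A_\Gamma)$. Then either (i) $V(\Gamma)-V(\Delta)=\emptyset$ and $N=\{id,\iota\}$, where $\iota(v_i)=v_i^{-1}$ for all $v_i\in V(\Delta)$; or (ii) $n,m\geq 1$ and $N= T_\Delta\rtimes\{id,\iota\}\cong \mathbb{Z}^{n\cdot m}\rtimes\mathbb{Z}/2\mathbb{Z}$, where $\iota(v_j)=v_j^{-1}$ and $\iota(w_i)=w_i$ for all $i,j$, and $$T_\Delta:=\{f\in\mathrm{Aut}(A_\Gamma)\mid w_i^{-1}f(w_i)\in A_\Delta \text{ and } f(v_j)=v_j \text{ for all } i=1,\ldots,m \text{ and } j=1,\ldots,n\}.$$ Furthermore, let $N\trianglelefteq\mathrm{Aut}(A_\Gamma)$ be a minimal (with respect to inclusion) element among the non-trivial non full-sized normal subgroups of $\mathrm{Aut}(A_\Gamma)$. If $n,m\geq 1$, then $N\cong\mathbb{Z}^l$ for some $n\leq l\leq n\cdot m$.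
   Context: For a finite simplicial graph $\Gamma$ with vertex set $V(\Gamma)$ and edge set $E(\Gamma)$, the right-angled Artin group is $A_\Gamma=\langle V(\Gamma)\mid vw=wv \text{ whenever } \{v,w\}\in E(\Gamma)\rangle$. For $v\in V(\Gamma)$, $st(v)=\{v\}\cup\{w\in V(\Gamma)\mid\{v,w\}\in E(\Gamma)\}$. $A_\Delta$ is the subgroup of $A_\Gamma$ generated by $V(\Delta)$; it is the center of $A_\Gamma$. A group is called full-sized if it contains a non-abelian free group $F_2$ as a subgroup. *)

theory Defs
  imports "HOL-Algebra.Bij" "HOL-Algebra.Generated_Groups" "HOL-Algebra.Elementary_Groups"
    "HOL-Algebra.Product_Groups"
begin

section \<open>Groups given by generators and relations\<close>

text \<open>
  A word is a list of letters; the letter \<open>(a, True)\<close> stands for the generator \<open>a\<close> and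
  \<open>(a, False)\<close> for its formal inverse. A relation \<open>r = s\<close> is a pair \<open>(r, s)\<close> of words.
\<close>

type_synonym 'a gword = "('a \<times> bool) list"

abbreviation gwords :: "'a set \<Rightarrow> 'a gword set" where
  "gwords S \<equiv> lists (S \<times> UNIV)"

inductive_set gword_eq :: "'a set \<Rightarrow> ('a gword \<times> 'a gword) set \<Rightarrow> ('a gword \<times> 'a gword) set"
  for S R where
  refl: "u \<in> gwords S \<Longrightarrow> (u, u) \<in> gword_eq S R"
| sym: "(u, v) \<in> gword_eq S R \<Longrightarrow> (v, u) \<in> gword_eq S R"
| trans: "(u, v) \<in> gword_eq S R \<Longrightarrow> (v, w) \<in> gword_eq S R \<Longrightarrow> (u, w) \<in> gword_eq S R"
| cancel: "u \<in> gwords S \<Longrightarrow> v \<in> gwords S \<Longrightarrow> a \<in> S \<Longrightarrow>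
    (u @ [(a, b), (a, \<not> b)] @ v, u @ v) \<in> gword_eq S R"
| relation: "u \<in> gwords S \<Longrightarrow> v \<in> gwords S \<Longrightarrow> (r, s) \<in> R \<Longrightarrow> r \<in> gwords S \<Longrightarrow> s \<in> gwords S \<Longrightarrow>
    (u @ r @ v, u @ s @ v) \<in> gword_eq S R"

definition presented_group :: "'a set \<Rightarrow> ('a gword \<times> 'a gword) set \<Rightarrow> 'a gword set monoid" where
  "presented_group S R =
    \<lparr>carrier = gwords S // gword_eq S R,
     mult = (\<lambda>X Y. \<Union>x\<in>X. \<Union>y\<in>Y. gword_eq S R `` {x @ y}),
     one = gword_eq S R `` {[]}\<rparr>"

definition presented_gen :: "'a set \<Rightarrow> ('a gword \<times> 'a gword) set \<Rightarrow> 'a \<Rightarrow> 'a gword set" where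
  "presented_gen S R a = gword_eq S R `` {[(a, True)]}"

lemma gword_eq_in: "(u, v) \<in> gword_eq S R \<Longrightarrow> u \<in> gwords S \<and> v \<in> gwords S"
  by (induction rule: gword_eq.induct) auto

lemma equiv_gword_eq: "equiv (gwords S) (gword_eq S R)"
proof (rule equivI)
  show "gword_eq S R \<subseteq> gwords S \<times> gwords S"
    using gword_eq_in by fast
  show "refl_on (gwords S) (gword_eq S R)"
    by (rule refl_onI) (rule gword_eq.refl)
  show "Relation.sym (gword_eq S R)"
    by (rule symI) (rule gword_eq.sym)
  show "Relation.trans (gword_eq S R)"
    by (rule transI) (rule gword_eq.trans)
qed

lemma gword_eq_context:
  assumes "(u, v) \<in> gword_eq S R" "p \<in> gwords S" "q \<in> gwords S"
  shows "(p @ u @ q, p @ v @ q) \<in> gword_eq S R"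
  using assms
proof (induction rule: gword_eq.induct)
  case (refl u)
  then show ?case by (intro gword_eq.refl) auto
next
  case (sym u v)
  then show ?case by (blast intro: gword_eq.sym)
next
  case (trans u v w)
  then show ?case by (blast intro: gword_eq.trans)
next
  case (cancel u v a b)
  then show ?case using gword_eq.cancel[of "p @ u" S "v @ q" a b R] by simp
next
  case (relation u v r s)
  then show ?case using gword_eq.relation[of "p @ u" S "v @ q" r s R] by simp
qed

lemma gword_eq_append:
  assumes "(u, u') \<in> gword_eq S R" "(v, v') \<in> gword_eq S R"
  shows "(u @ v, u' @ v') \<in> gword_eq S R"
proof -
  have "(u @ v, u' @ v) \<in> gword_eq S R"
    using gword_eq_context[of u u' S R "[]" v] assms gword_eq_in by fastforce
  moreover have "(u' @ v, u' @ v') \<in> gword_eq S R"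
    using gword_eq_context[of v v' S R u' "[]"] assms gword_eq_in by fastforce
  ultimately show ?thesis by (rule gword_eq.trans)
qed

lemma presented_group_mult_class:
  assumes "u \<in> gwords S" "v \<in> gwords S"
  shows "(gword_eq S R `` {u}) \<otimes>\<^bsub>presented_group S R\<^esub> (gword_eq S R `` {v}) = gword_eq S R `` {u @ v}"
proof -
  have "congruent2 (gword_eq S R) (gword_eq S R) (\<lambda>x y. gword_eq S R `` {x @ y})"
    by (rule congruent2I') (meson equiv_class_eq equiv_gword_eq gword_eq_append)
  from UN_equiv_class2[OF equiv_gword_eq equiv_gword_eq this assms]
  show ?thesis by (simp add: presented_group_def)
qed

lemma gword_eq_inverse:
  "u \<in> gwords S \<Longrightarrow> (rev (map (\<lambda>(a, b). (a, \<not> b)) u) @ u, []) \<in> gword_eq S R"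
proof (induction u)
  case Nil
  then show ?case by (simp add: gword_eq.refl)
next
  case (Cons l u)
  obtain a b where l: "l = (a, b)" by (cases l)
  let ?i = "rev (map (\<lambda>(a, b). (a, \<not> b)) u)"
  have "?i \<in> gwords S" "u \<in> gwords S" "a \<in> S"
    using Cons.prems l by auto
  then have "(?i @ [(a, \<not> b), (a, \<not> \<not> b)] @ u, ?i @ u) \<in> gword_eq S R"
    by (rule gword_eq.cancel)
  then have "(?i @ [(a, \<not> b), (a, \<not> \<not> b)] @ u, []) \<in> gword_eq S R"
    using Cons.IH[OF \<open>u \<in> gwords S\<close>] by (rule gword_eq.trans)
  then show ?case
    unfolding l by simp
qed

lemma group_presented_group: "group (presented_group S R)"
proof (rule groupI)
  let ?G = "presented_group S R" and ?c = "\<lambda>u. gword_eq S R `` {u}"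
  have carr: "carrier ?G = ?c ` gwords S"
    by (auto simp: presented_group_def quotient_def)
  have one: "\<one>\<^bsub>?G\<^esub> = ?c []"
    by (simp add: presented_group_def)
  show "x \<otimes>\<^bsub>?G\<^esub> y \<in> carrier ?G" if "x \<in> carrier ?G" "y \<in> carrier ?G" for x y
  proof -
    obtain u v where u: "u \<in> gwords S" "x = ?c u" and v: "v \<in> gwords S" "y = ?c v"
      using \<open>x \<in> carrier ?G\<close> \<open>y \<in> carrier ?G\<close> unfolding carr by blast
    have "u @ v \<in> gwords S"
      using u v by auto
    then show ?thesis
      unfolding carr u(2) v(2) presented_group_mult_class[OF u(1) v(1)] by (rule imageI)
  qed
  show "\<one>\<^bsub>?G\<^esub> \<in> carrier ?G"
    unfolding carr one by auto
  show "x \<otimes>\<^bsub>?G\<^esub> y \<otimes>\<^bsub>?G\<^esub> z = x \<otimes>\<^bsub>?G\<^esub> (y \<otimes>\<^bsub>?G\<^esub> z)"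
    if xyz: "x \<in> carrier ?G" "y \<in> carrier ?G" "z \<in> carrier ?G" for x y z
  proof -
    obtain u v w where u: "u \<in> gwords S" "x = ?c u" and v: "v \<in> gwords S" "y = ?c v"
      and w: "w \<in> gwords S" "z = ?c w"
      using xyz unfolding carr by blast
    have uv: "u @ v \<in> gwords S" and vw: "v @ w \<in> gwords S"
      using u v w by auto
    show ?thesis
      unfolding u(2) v(2) w(2) presented_group_mult_class[OF u(1) v(1)]
        presented_group_mult_class[OF v(1) w(1)] presented_group_mult_class[OF uv w(1)]
        presented_group_mult_class[OF u(1) vw] append_assoc ..
  qed
  show "\<one>\<^bsub>?G\<^esub> \<otimes>\<^bsub>?G\<^esub> x = x" if x: "x \<in> carrier ?G" for x
  proof -
    obtain u where u: "u \<in> gwords S" "x = ?c u"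
      using x unfolding carr by blast
    show ?thesis
      unfolding one u(2) presented_group_mult_class[OF lists.Nil u(1)] append_Nil ..
  qed
  show "\<exists>y\<in>carrier ?G. y \<otimes>\<^bsub>?G\<^esub> x = \<one>\<^bsub>?G\<^esub>" if x: "x \<in> carrier ?G" for x
  proof -
    obtain u where u: "u \<in> gwords S" "x = ?c u"
      using x unfolding carr by blast
    let ?i = "rev (map (\<lambda>(a, b). (a, \<not> b)) u)"
    have i: "?i \<in> gwords S" using u by auto
    then have "?c ?i \<otimes>\<^bsub>?G\<^esub> x = \<one>\<^bsub>?G\<^esub>"
      unfolding u(2) one presented_group_mult_class[OF i u(1)]
      using gword_eq_inverse[OF u(1)] equiv_class_eq[OF equiv_gword_eq] by fast
    with i show ?thesis unfolding carr by blast
  qed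
qed

definition free_group :: "'a set \<Rightarrow> 'a gword set monoid" where
  "free_group S = presented_group S {}"

text \<open>The two-element type \<open>bool\<close> serves as the basis of the free group of rank two.\<close>

definition full_sized :: "('a, 'b) monoid_scheme \<Rightarrow> bool" where
  "full_sized G \<longleftrightarrow> (\<exists>H. subgroup H G \<and> G\<lparr>carrier := H\<rparr> \<cong> free_group (UNIV :: bool set))"


section \<open>Right-angled Artin groups\<close>

definition simplicial_graph :: "'v set \<Rightarrow> 'v set set \<Rightarrow> bool" where
  "simplicial_graph V E \<longleftrightarrow> (\<forall>e\<in>E. e \<subseteq> V \<and> card e = 2)"

definition star :: "'v set \<Rightarrow> 'v set set \<Rightarrow> 'v \<Rightarrow> 'v set" where
  "star V E v = {v} \<union> {w \<in> V. {v, w} \<in> E}"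

definition cone_vertices :: "'v set \<Rightarrow> 'v set set \<Rightarrow> 'v set" where
  "cone_vertices V E = {v \<in> V. star V E v = V}"

definition raag_relations :: "'v set set \<Rightarrow> ('v gword \<times> 'v gword) set" where
  "raag_relations E =
    {([(v, True), (w, True)], [(w, True), (v, True)]) | v w. {v, w} \<in> E}"

definition raag :: "'v set \<Rightarrow> 'v set set \<Rightarrow> 'v gword set monoid" where
  "raag V E = presented_group V (raag_relations E)"

definition raag_gen :: "'v set \<Rightarrow> 'v set set \<Rightarrow> 'v \<Rightarrow> 'v gword set" where
  "raag_gen V E v = presented_gen V (raag_relations E) v"

definition cone_subgroup :: "'v set \<Rightarrow> 'v set set \<Rightarrow> 'v gword set set" where
  "cone_subgroup V E = generate (raag V E) (raag_gen V E ` cone_vertices V E)"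

definition T_cone :: "'v set \<Rightarrow> 'v set set \<Rightarrow> ('v gword set \<Rightarrow> 'v gword set) set" where
  "T_cone V E = {f \<in> carrier (AutoGroup (raag V E)).
     (\<forall>w \<in> V - cone_vertices V E.
        inv\<^bsub>raag V E\<^esub> (raag_gen V E w) \<otimes>\<^bsub>raag V E\<^esub> f (raag_gen V E w) \<in> cone_subgroup V E) \<and>
     (\<forall>v \<in> cone_vertices V E. f (raag_gen V E v) = raag_gen V E v)}"


section \<open>Normal subgroups that are not full-sized\<close>

definition nfs_normal :: "'a set \<Rightarrow> ('a, 'b) monoid_scheme \<Rightarrow> bool" where
  "nfs_normal N G \<longleftrightarrow> N \<lhd> G \<and> \<not> full_sized (G\<lparr>carrier := N\<rparr>)"

definition maximal_nfs_normal :: "'a set \<Rightarrow> ('a, 'b) monoid_scheme \<Rightarrow> bool" where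
  "maximal_nfs_normal N G \<longleftrightarrow>
    nfs_normal N G \<and> (\<forall>M. nfs_normal M G \<and> N \<subseteq> M \<longrightarrow> M = N)"

definition minimal_nontrivial_nfs_normal :: "'a set \<Rightarrow> ('a, 'b) monoid_scheme \<Rightarrow> bool" where
  "minimal_nontrivial_nfs_normal N G \<longleftrightarrow>
    nfs_normal N G \<and> N \<noteq> {\<one>\<^bsub>G\<^esub>} \<and>
    (\<forall>M. nfs_normal M G \<and> M \<noteq> {\<one>\<^bsub>G\<^esub>} \<and> M \<subseteq> N \<longrightarrow> M = N)"


section \<open>Semidirect products\<close>

definition int_power_group :: "nat \<Rightarrow> (nat \<Rightarrow> int) monoid" where
  "int_power_group k = product_group {..<k} (\<lambda>_. integer_group)"

definition semidirect_product ::
  "('a, 'c) monoid_scheme \<Rightarrow> ('b, 'd) monoid_scheme \<Rightarrow> ('b \<Rightarrow> 'a \<Rightarrow> 'a) \<Rightarrow> ('a \<times> 'b) monoid" where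
  "semidirect_product K H \<phi> =
    \<lparr>carrier = carrier K \<times> carrier H,
     mult = (\<lambda>(k, h) (k', h'). (k \<otimes>\<^bsub>K\<^esub> \<phi> h k', h \<otimes>\<^bsub>H\<^esub> h')),
     one = (\<one>\<^bsub>K\<^esub>, \<one>\<^bsub>H\<^esub>)\<rparr>"

lemma group_semidirect_product:
  assumes "group K" "group H" "\<phi> \<in> hom H (AutoGroup K)"
  shows "group (semidirect_product K H \<phi>)"
proof -
  interpret K: group K by fact
  interpret H: group H by fact
  interpret A: group "AutoGroup K" by (rule K.AutoGroup)
  interpret \<phi>: group_hom H "AutoGroup K" \<phi>
    using assms(3) by unfold_locales
  have auto: "\<phi> h \<in> hom K K" "\<phi> h \<in> Bij (carrier K)" if "h \<in> carrier H" for h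
    using \<phi>.hom_closed[OF that] by (auto simp: AutoGroup_def auto_def)
  have closed: "\<phi> h k \<in> carrier K" if "h \<in> carrier H" "k \<in> carrier K" for h k
    using hom_in_carrier[OF auto(1)[OF that(1)] that(2)] .
  have mult: "\<phi> h (k \<otimes>\<^bsub>K\<^esub> k') = \<phi> h k \<otimes>\<^bsub>K\<^esub> \<phi> h k'"
    if "h \<in> carrier H" "k \<in> carrier K" "k' \<in> carrier K" for h k k'
    using hom_mult[OF auto(1)[OF that(1)] that(2,3)] .
  have act: "\<phi> (h \<otimes>\<^bsub>H\<^esub> h') k = \<phi> h (\<phi> h' k)"
    if "h \<in> carrier H" "h' \<in> carrier H" "k \<in> carrier K" for h h' k
    using \<phi>.hom_mult[OF that(1,2)] auto(2)[OF that(1)] auto(2)[OF that(2)] that(3)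
    by (simp add: AutoGroup_def BijGroup_def compose_eq)
  have act1: "\<phi> \<one>\<^bsub>H\<^esub> k = k" if "k \<in> carrier K" for k
    using \<phi>.hom_one that by (simp add: AutoGroup_def BijGroup_def)
  let ?G = "semidirect_product K H \<phi>"
  show ?thesis
  proof (rule groupI)
    show "x \<otimes>\<^bsub>?G\<^esub> y \<in> carrier ?G" if "x \<in> carrier ?G" "y \<in> carrier ?G" for x y
      using that closed by (auto simp: semidirect_product_def)
    show "\<one>\<^bsub>?G\<^esub> \<in> carrier ?G"
      by (simp add: semidirect_product_def)
    show "x \<otimes>\<^bsub>?G\<^esub> y \<otimes>\<^bsub>?G\<^esub> z = x \<otimes>\<^bsub>?G\<^esub> (y \<otimes>\<^bsub>?G\<^esub> z)"
      if xyz: "x \<in> carrier ?G" "y \<in> carrier ?G" "z \<in> carrier ?G" for x y z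
    proof -
      obtain k1 h1 k2 h2 k3 h3 where
        "x = (k1, h1)" "y = (k2, h2)" "z = (k3, h3)"
        "k1 \<in> carrier K" "h1 \<in> carrier H" "k2 \<in> carrier K" "h2 \<in> carrier H"
        "k3 \<in> carrier K" "h3 \<in> carrier H"
        using xyz by (auto simp: semidirect_product_def)
      then show ?thesis
        by (simp add: semidirect_product_def closed mult act K.m_assoc H.m_assoc
            del: \<phi>.hom_mult)
    qed
    show "\<one>\<^bsub>?G\<^esub> \<otimes>\<^bsub>?G\<^esub> x = x" if "x \<in> carrier ?G" for x
      using that act1 by (auto simp: semidirect_product_def simp del: \<phi>.hom_one)
    show "\<exists>y\<in>carrier ?G. y \<otimes>\<^bsub>?G\<^esub> x = \<one>\<^bsub>?G\<^esub>" if x_in: "x \<in> carrier ?G" for x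
    proof -
      obtain k h where x: "x = (k, h)" "k \<in> carrier K" "h \<in> carrier H"
        using x_in by (auto simp: semidirect_product_def)
      let ?h = "inv\<^bsub>H\<^esub> h" and ?k = "inv\<^bsub>K\<^esub> k"
      have h: "?h \<in> carrier H" and k: "?k \<in> carrier K"
        using x by auto
      have "\<phi> ?h ?k \<otimes>\<^bsub>K\<^esub> \<phi> ?h k = \<phi> ?h \<one>\<^bsub>K\<^esub>"
        using mult[OF h k x(2)] x(2) by (simp only: K.l_inv)
      also have "\<dots> = \<one>\<^bsub>K\<^esub>"
        by (rule hom_one[OF auto(1)[OF h] \<open>group K\<close> \<open>group K\<close>])
      finally have "(\<phi> ?h ?k, ?h) \<otimes>\<^bsub>?G\<^esub> x = \<one>\<^bsub>?G\<^esub>"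
        using x H.l_inv[OF x(3)] by (simp only: semidirect_product_def) simp
      moreover have "(\<phi> ?h ?k, ?h) \<in> carrier ?G"
        using h closed[OF h k] by (simp only: semidirect_product_def) simp
      ultimately show ?thesis by blast
    qed
  qed
qed

definition internal_semidirect_product ::
  "('a, 'b) monoid_scheme \<Rightarrow> 'a set \<Rightarrow> 'a set \<Rightarrow> 'a set \<Rightarrow> bool" where
  "internal_semidirect_product G N K H \<longleftrightarrow>
    subgroup N G \<and> K \<lhd> G\<lparr>carrier := N\<rparr> \<and> subgroup H (G\<lparr>carrier := N\<rparr>) \<and>
    K \<inter> H = {\<one>\<^bsub>G\<^esub>} \<and> K <#>\<^bsub>G\<^esub> H = N"

end

theory Submission
  imports Defs "HOL-Algebra.Group_Action" "HOL-Algebra.FiniteProduct"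
begin

text \<open>
Write \<open>Z\<close> for the subgroup generated by the cone vertices, and \<open>T\<close> for \<open>T_cone V E\<close>. Everything
follows from one description (\<open>nfs_normal_iff\<close>): a normal subgroup \<open>N\<close> of the automorphism group
is not full-sized if and only if every \<open>f \<in> N\<close> satisfies \<open>f x \<in> x Z\<close> for all \<open>x\<close> and acts on \<open>Z\<close> as
the identity or as inversion. The automorphisms with this property form a normal subgroup \<open>M\<close>, so
\<open>M\<close> is the largest normal subgroup that is not full-sized. Those acting trivially on \<open>Z\<close> form \<open>T\<close>; an
element of \<open>T\<close> is given by a matrix of \<open>n * m\<close> arbitrary integers, and \<open>M\<close> is obtained from \<open>T\<close> by
adding the automorphism \<open>\<iota>\<close>, which conjugates every element of \<open>T\<close> to its inverse.

That \<open>M\<close> is not full-sized is easy: squares of elements of \<open>M\<close> lie in the abelian group \<open>T\<close>, but the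
squares of two free generators do not commute. Conversely, let \<open>N\<close> be normal and \<open>f \<in> N\<close>.

\<^item> Suppose \<open>x\<inverse> f(x) \<notin> Z\<close> for some \<open>x\<close>. The commutator of \<open>f\<close> with conjugation by \<open>x\<close> is conjugation by
  \<open>g = f(x) x\<inverse>\<close>, and \<open>g \<notin> Z\<close>. Hence there is a non-cone vertex \<open>v\<close> such that \<open>g\<close> is outside the
  subgroup \<open>H\<close> generated by the other vertices. The normal closure of \<open>v\<close> is free, with the
  \<open>H\<close>-conjugates of \<open>v\<close> as a basis of at least two elements; the freeness is witnessed by an explicit
  action of the whole group on reduced words over this basis. Some basis element \<open>b\<close> does not commute
  with \<open>g\<close>, so \<open>N\<close> contains conjugation by the nontrivial element \<open>[g, b]\<close> of a free group
  (\<open>inner_full_sized\<close>). The same action shows that \<open>Z\<close> is the center.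

\<^item> Suppose \<open>f\<close> does not act on \<open>Z\<close> by a sign. Then there are \<open>u \<in> Z\<close> and a homomorphism \<open>\<phi>\<close> to the
  integers with \<open>\<phi>(u) = 0\<close> but \<open>\<phi>(f(u)) \<noteq> 0\<close> and \<open>\<phi>(f\<inverse>(u)) \<noteq> 0\<close>. For large \<open>k\<close> the transvection
  \<open>\<tau>(x) = x \<otimes> u [^] (k * \<phi> x)\<close> and its conjugate by \<open>f\<close> act on the pair \<open>(\<phi>(x), \<phi>(f\<inverse>(x)))\<close> by elementary
  matrices, and therefore generate a free group; it contains \<open>[\<tau>, f] \<in> N\<close>
  (\<open>transvection_full_sized\<close>).

Both cases end with the same principle (\<open>ping_pong.normal_subgroup_full_sized\<close>): a normal subgroup
that contains a nontrivial element of a free group with at least two ping-pong generators contains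
two conjugates of this element that freely generate a free group.

If \<open>n, m \<ge> 1\<close>, there is no minimal nontrivial normal subgroup \<open>N\<close> that is not full-sized. Such an \<open>N\<close>
meets \<open>T\<close> nontrivially, so it lies in \<open>T\<close>. As \<open>T\<close> is free abelian of finite rank, the squares of
the elements of \<open>N\<close> form a strictly smaller nontrivial normal subgroup (\<open>no_minimal_nfs_normal\<close>).
\<close>

section \<open>Words and the universal property of a presentation\<close>

definition letter_value :: "('b, 'c) monoid_scheme \<Rightarrow> ('a \<Rightarrow> 'b) \<Rightarrow> 'a \<times> bool \<Rightarrow> 'b" where
  "letter_value K g l = (if snd l then g (fst l) else inv\<^bsub>K\<^esub> (g (fst l)))"

definition word_value :: "('b, 'c) monoid_scheme \<Rightarrow> ('a \<Rightarrow> 'b) \<Rightarrow> 'a gword \<Rightarrow> 'b" where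
  "word_value K g w = foldr (\<lambda>l y. letter_value K g l \<otimes>\<^bsub>K\<^esub> y) w \<one>\<^bsub>K\<^esub>"

definition flip :: "'a \<times> bool \<Rightarrow> 'a \<times> bool" where
  "flip l = (fst l, \<not> snd l)"

definition inverse_word :: "'a gword \<Rightarrow> 'a gword" where
  "inverse_word w = rev (map flip w)"

lemma flip_simps [simp]: "flip (a, b) = (a, \<not> b)" "fst (flip l) = fst l" "snd (flip l) = (\<not> snd l)"
  "flip (flip l) = l" "flip l \<noteq> l" "l \<noteq> flip l" "flip l = flip l' \<longleftrightarrow> l = l'"
  "flip l \<in> X \<times> UNIV \<longleftrightarrow> l \<in> X \<times> UNIV"
  by (auto simp: flip_def prod_eq_iff mem_Times_iff split: prod.splits)

lemma flip_eq_iff: "l = flip l' \<longleftrightarrow> l' = flip l"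
  by auto

lemma inverse_word_simps [simp]: "inverse_word [] = []"
  "inverse_word (l # w) = inverse_word w @ [flip l]"
  "inverse_word w = [] \<longleftrightarrow> w = []"
  "inverse_word w \<in> gwords X \<longleftrightarrow> w \<in> gwords X"
proof -
  show "inverse_word w \<in> gwords X \<longleftrightarrow> w \<in> gwords X"
    by (induction w) (auto simp: inverse_word_def flip_simps(8) simp del: mem_Times_iff)
qed (simp_all add: inverse_word_def)

lemma hd_inverse_word: "w \<noteq> [] \<Longrightarrow> hd (inverse_word w) = flip (last w)"
  by (simp add: inverse_word_def hd_rev last_map)

lemma last_inverse_word: "w \<noteq> [] \<Longrightarrow> last (inverse_word w) = flip (hd w)"
  by (simp add: inverse_word_def last_rev hd_map)

lemma word_value_simps [simp]: "word_value K g [] = \<one>\<^bsub>K\<^esub>"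
  "word_value K g (l # w) = letter_value K g l \<otimes>\<^bsub>K\<^esub> word_value K g w"
  by (simp_all add: word_value_def)

context group
begin

lemma letter_value_closed [simp]:
  "g \<in> S \<rightarrow> carrier G \<Longrightarrow> l \<in> S \<times> UNIV \<Longrightarrow> letter_value G g l \<in> carrier G"
  by (auto simp: letter_value_def)

lemma word_value_closed [simp]:
  "g \<in> S \<rightarrow> carrier G \<Longrightarrow> w \<in> gwords S \<Longrightarrow> word_value G g w \<in> carrier G"
  by (induction w) auto

lemma letter_value_flip: "g \<in> S \<rightarrow> carrier G \<Longrightarrow> l \<in> S \<times> UNIV \<Longrightarrow>
    letter_value G g (flip l) = inv (letter_value G g l)"
  by (auto simp: letter_value_def Pi_iff)

lemma word_value_append:
  "g \<in> S \<rightarrow> carrier G \<Longrightarrow> u \<in> gwords S \<Longrightarrow> v \<in> gwords S \<Longrightarrow>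
    word_value G g (u @ v) = word_value G g u \<otimes> word_value G g v"
  by (induction u) (auto simp: m_assoc)

lemma word_value_inverse:
  "g \<in> S \<rightarrow> carrier G \<Longrightarrow> w \<in> gwords S \<Longrightarrow>
    word_value G g (inverse_word w) = inv (word_value G g w)"
proof (induction w)
  case (Cons l w)
  then have "l \<in> S \<times> UNIV" "w \<in> gwords S" by auto
  moreover from this have "[flip l] \<in> gwords S" by (auto simp: mem_Times_iff)
  ultimately show ?case
    using Cons by (simp add: word_value_append[of g S] letter_value_flip[of g S] inv_mult_group)
qed simp

lemma word_value_in_subgroup:
  assumes "subgroup H G" "g \<in> S \<rightarrow> H" "w \<in> gwords S"
  shows "word_value G g w \<in> H"
  using assms(3)
proof (induction w)
  case (Cons l w)
  then show ?case
    using assms(2) subgroup.m_closed[OF assms(1)] subgroup.m_inv_closed[OF assms(1)]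
    by (auto simp: letter_value_def Pi_iff)
qed (simp add: subgroup.one_closed[OF assms(1)])

end

lemma letter_value_hom:
  assumes "group P" "group K" "h \<in> hom P K" "g \<in> S \<rightarrow> carrier P" "l \<in> S \<times> UNIV"
  shows "h (letter_value P g l) = letter_value K (\<lambda>a. h (g a)) l"
proof -
  interpret group_hom P K h
    using assms by (simp add: group_hom_def group_hom_axioms_def)
  show ?thesis
    using assms(4,5) by (auto simp: letter_value_def Pi_iff)
qed

lemma word_value_hom:
  assumes "group P" "group K" "h \<in> hom P K" "g \<in> S \<rightarrow> carrier P" "w \<in> gwords S"
  shows "h (word_value P g w) = word_value K (\<lambda>a. h (g a)) w"
proof -
  interpret group_hom P K h
    using assms by (simp add: group_hom_def group_hom_axioms_def)
  show ?thesis
    using assms(5)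
  proof (induction w)
    case (Cons l w)
    then have "letter_value P g l \<in> carrier P" "word_value P g w \<in> carrier P"
      using assms(4) by auto
    with Cons show ?case
      using letter_value_hom[OF assms(1-4)] by simp
  qed simp
qed

lemma word_value_cong:
  assumes "\<And>a. a \<in> S \<Longrightarrow> g a = g' a" "w \<in> gwords S"
  shows "word_value K g w = word_value K g' w"
  using assms(2) by (induction w) (auto simp: letter_value_def assms(1))

lemma word_value_carrier_restrict:
  assumes "group K" "subgroup N K" "g \<in> S \<rightarrow> N" "w \<in> gwords S"
  shows "word_value (K\<lparr>carrier := N\<rparr>) g w = word_value K g w"
  using assms(4)
proof (induction w)
  case (Cons l w)
  then have "g (fst l) \<in> N" using assms(3) by auto
  with Cons show ?case
    using group.m_inv_consistent[OF assms(1,2)] by (auto simp: letter_value_def)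
qed simp

lemma presented_gen_closed: "a \<in> S \<Longrightarrow> presented_gen S R a \<in> carrier (presented_group S R)"
  by (auto simp: presented_gen_def presented_group_def intro!: quotientI)

lemma presented_word_value:
  assumes "w \<in> gwords S"
  shows "word_value (presented_group S R) (presented_gen S R) w = gword_eq S R `` {w}"
  using assms
proof (induction w)
  case Nil
  then show ?case by (simp add: presented_group_def)
next
  case (Cons l w)
  then have lS: "l \<in> S \<times> UNIV" and w: "w \<in> gwords S" by simp_all
  let ?P = "presented_group S R" and ?c = "\<lambda>u. gword_eq S R `` {u}"
  interpret P: group ?P by (rule group_presented_group)
  obtain a b where l: "l = (a, b)" by (cases l)
  have a: "a \<in> S" and words: "[(a, True)] \<in> gwords S" "[(a, False)] \<in> gwords S"
    using lS by (simp_all add: l)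
  have "?c [(a, False)] \<otimes>\<^bsub>?P\<^esub> ?c [(a, True)] = ?c ([] @ [(a, False), (a, \<not> False)] @ [])"
    using presented_group_mult_class[OF words(2,1)] by simp
  also have "\<dots> = ?c ([] @ [])"
    by (rule equiv_class_eq[OF equiv_gword_eq gword_eq.cancel]) (use a in auto)
  finally have "inv\<^bsub>?P\<^esub> ?c [(a, True)] = ?c [(a, False)]"
    using words by (intro P.inv_equality) (auto simp: presented_group_def intro!: quotientI)
  then have "letter_value ?P (presented_gen S R) l = ?c [l]"
    by (cases b) (auto simp: l letter_value_def presented_gen_def)
  moreover have "[l] \<in> gwords S" using l a by auto
  ultimately show ?case
    using Cons.IH presented_group_mult_class[of "[l]" S w R] w by simp
qed

lemma presented_group_word:
  assumes "x \<in> carrier (presented_group S R)"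
  obtains w where "w \<in> gwords S" "x = word_value (presented_group S R) (presented_gen S R) w"
proof -
  obtain w where "w \<in> gwords S" "x = gword_eq S R `` {w}"
    using assms by (auto simp: presented_group_def quotient_def)
  then show ?thesis using that presented_word_value by metis
qed

lemma presented_hom_eqI:
  assumes "group K" "h \<in> hom (presented_group S R) K" "h' \<in> hom (presented_group S R) K"
    and "\<And>a. a \<in> S \<Longrightarrow> h (presented_gen S R a) = h' (presented_gen S R a)"
    and "x \<in> carrier (presented_group S R)"
  shows "h x = h' x"
proof -
  let ?P = "presented_group S R" and ?e = "presented_gen S R"
  from assms(5) obtain w where w: "w \<in> gwords S" "x = word_value ?P ?e w"
    by (rule presented_group_word)
  have e: "?e \<in> S \<rightarrow> carrier ?P"
    by (rule funcsetI) (rule presented_gen_closed)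
  have "h x = word_value K (\<lambda>a. h (?e a)) w"
    unfolding w(2) by (rule word_value_hom[OF group_presented_group assms(1,2) e w(1)])
  also have "\<dots> = word_value K (\<lambda>a. h' (?e a)) w"
    by (rule word_value_cong[OF assms(4) w(1)])
  also have "\<dots> = h' x"
    unfolding w(2) by (rule word_value_hom[OF group_presented_group assms(1,3) e w(1), symmetric])
  finally show ?thesis .
qed

lemma (in group) presented_lift:
  assumes g: "g \<in> S \<rightarrow> carrier G"
    and rel: "\<And>r s. (r, s) \<in> R \<Longrightarrow> r \<in> gwords S \<Longrightarrow> s \<in> gwords S \<Longrightarrow>
      word_value G g r = word_value G g s"
  shows "\<exists>h \<in> hom (presented_group S R) G. \<forall>a \<in> S. h (presented_gen S R a) = g a"
proof -
  let ?P = "presented_group S R" and ?c = "\<lambda>u. gword_eq S R `` {u}"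
  define h where "h X = (THE y. y \<in> word_value G g ` X)" for X
  have eq: "word_value G g u = word_value G g v" if "(u, v) \<in> gword_eq S R" for u v
    using that
  proof (induction rule: gword_eq.induct)
    case (cancel u v a b)
    have l: "(a, b) \<in> S \<times> UNIV" and w: "[(a, b), (a, \<not> b)] \<in> gwords S"
      using cancel by auto
    have "word_value G g ([(a, b), (a, \<not> b)] @ v) = word_value G g v"
      using letter_value_flip[OF g l] letter_value_closed[OF g l] word_value_closed[OF g cancel(2)]
      by (simp add: m_assoc[symmetric])
    moreover have "[(a, b), (a, \<not> b)] @ v \<in> gwords S" using w cancel by auto
    ultimately show ?case
      using cancel by (metis word_value_append[OF g])
  next
    case (relation u v r s)
    then have "r @ v \<in> gwords S" "s @ v \<in> gwords S" by auto
    then show ?case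
      using relation rel[OF relation(3-5)] by (metis word_value_append[OF g])
  qed auto
  have h: "h (?c u) = word_value G g u" if "u \<in> gwords S" for u
  proof -
    have "u \<in> ?c u" using gword_eq.refl[OF that] by simp
    then have mem: "word_value G g u \<in> word_value G g ` ?c u" by (rule imageI)
    have "y = word_value G g u" if "y \<in> word_value G g ` ?c u" for y
    proof -
      from that obtain v where "(u, v) \<in> gword_eq S R" "y = word_value G g v" by blast
      then show ?thesis using eq by metis
    qed
    with mem show ?thesis unfolding h_def by (rule the_equality)
  qed
  have "h \<in> hom ?P G"
  proof (rule homI)
    fix x assume "x \<in> carrier ?P"
    then obtain u where "u \<in> gwords S" "x = ?c u" by (auto simp: presented_group_def quotient_def)
    then show "h x \<in> carrier G" using h word_value_closed[OF g] by metis
  next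
    fix x y assume "x \<in> carrier ?P" "y \<in> carrier ?P"
    then obtain u v where u: "u \<in> gwords S" "x = ?c u" and v: "v \<in> gwords S" "y = ?c v"
      by (auto simp: presented_group_def quotient_def)
    then have "u @ v \<in> gwords S" by auto
    then show "h (x \<otimes>\<^bsub>?P\<^esub> y) = h x \<otimes> h y"
      unfolding u(2) v(2) presented_group_mult_class[OF u(1) v(1)]
      using h u v word_value_append[OF g] by metis
  qed
  moreover have "h (presented_gen S R a) = g a" if "a \<in> S" for a
  proof -
    have "[(a, True)] \<in> gwords S" using that by auto
    then have "h (presented_gen S R a) = word_value G g [(a, True)]"
      unfolding presented_gen_def by (rule h)
    also have "\<dots> = g a" using that g by (simp add: letter_value_def Pi_iff)
    finally show ?thesis .
  qed
  ultimately show ?thesis by blast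
qed


section \<open>Reduced words\<close>

definition reduced :: "'a gword \<Rightarrow> bool" where
  "reduced w \<longleftrightarrow> successively (\<lambda>l l'. l' \<noteq> flip l) w"

definition reduced_words :: "'a set \<Rightarrow> 'a gword set" where
  "reduced_words X = {w \<in> gwords X. reduced w}"

text \<open>
Left multiplication by a letter, followed by free reduction. On reduced words it is a permutation,
with inverse \<open>push (flip l)\<close>, so that the free group acts on its own reduced words.
\<close>

definition push :: "'a \<times> bool \<Rightarrow> 'a gword \<Rightarrow> 'a gword" where
  "push l w = (if w \<noteq> [] \<and> hd w = flip l then tl w else l # w)"

lemma reduced_simps [simp]: "reduced []" "reduced [l]"
  "reduced (l # l' # w) \<longleftrightarrow> l' \<noteq> flip l \<and> reduced (l' # w)"
  by (simp_all add: reduced_def)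

lemma reduced_Cons: "reduced (l # w) \<longleftrightarrow> reduced w \<and> (w \<noteq> [] \<longrightarrow> hd w \<noteq> flip l)"
  by (cases w) auto

lemma reduced_append: "reduced (u @ v) \<longleftrightarrow>
    reduced u \<and> reduced v \<and> (u = [] \<or> v = [] \<or> hd v \<noteq> flip (last u))"
  by (auto simp: reduced_def successively_append_iff)

lemma reduced_inverse: "reduced w \<Longrightarrow> reduced (inverse_word w)"
proof (induction w)
  case (Cons l w)
  then show ?case
    by (cases "w = []") (auto simp: reduced_append reduced_Cons last_inverse_word)
qed simp

lemma Nil_in_reduced_words [simp]: "[] \<in> reduced_words X"
  by (simp add: reduced_words_def)

lemma push_reduced_words: "l \<in> X \<times> UNIV \<Longrightarrow> w \<in> reduced_words X \<Longrightarrow> push l w \<in> reduced_words X"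
  by (cases w) (auto simp: reduced_words_def push_def reduced_Cons)

lemma push_flip: "reduced w \<Longrightarrow> push (flip l) (push l w) = w" "reduced w \<Longrightarrow> push l (push (flip l) w) = w"
  by (cases w; auto simp: push_def reduced_Cons)+

lemma bij_betw_push: "l \<in> X \<times> UNIV \<Longrightarrow> bij_betw (push l) (reduced_words X) (reduced_words X)"
proof (rule bij_betw_byWitness[where f' = "push (flip l)"])
  assume l: "l \<in> X \<times> UNIV"
  show "push l ` reduced_words X \<subseteq> reduced_words X"
    using push_reduced_words[OF l] by blast
  show "push (flip l) ` reduced_words X \<subseteq> reduced_words X"
    using push_reduced_words l flip_simps(8) by blast
qed (simp_all add: reduced_words_def push_flip)

lemma foldr_push_reduced_words: "u \<in> gwords X \<Longrightarrow> foldr push u [] \<in> reduced_words X"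
  by (induction u) (auto intro: push_reduced_words)

lemma foldr_push_reduced: "reduced u \<Longrightarrow> foldr push u [] = u"
  by (induction u) (auto simp: reduced_Cons push_def)

lemma (in group) word_value_push:
  assumes "g \<in> S \<rightarrow> carrier G" "l \<in> S \<times> UNIV" "w \<in> gwords S"
  shows "word_value G g (push l w) = letter_value G g l \<otimes> word_value G g w"
proof (cases "w \<noteq> [] \<and> hd w = flip l")
  case True
  then obtain w' where w: "w = flip l # w'" by (cases w) auto
  then have "word_value G g w' \<in> carrier G"
    using assms by (intro word_value_closed[of g S]) auto
  then show ?thesis
    using letter_value_closed[OF assms(1,2)] letter_value_flip[OF assms(1,2)]
    by (simp add: w push_def m_assoc[symmetric])
qed (auto simp: push_def)

lemma (in group) word_value_reduce:
  assumes "g \<in> S \<rightarrow> carrier G" "w \<in> gwords S"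
  shows "word_value G g (foldr push w []) = word_value G g w"
  using assms(2)
proof (induction w)
  case (Cons l w)
  then have "foldr push w [] \<in> gwords S"
    using foldr_push_reduced_words by (auto simp: reduced_words_def)
  with Cons show ?case
    using word_value_push[OF assms(1)] by auto
qed simp

section \<open>Free subgroups by ping-pong\<close>

text \<open>
Every element of the free group is the value of some reduced word, so a homomorphism that kills no
nonempty reduced word is injective.
\<close>

lemma full_sizedI:
  fixes g :: "bool \<Rightarrow> 'a"
  assumes "group A" "subgroup N A" "\<And>c. g c \<in> N"
    and nontriv: "\<And>w. reduced w \<Longrightarrow> w \<noteq> [] \<Longrightarrow> word_value A g w \<noteq> \<one>\<^bsub>A\<^esub>"
  shows "full_sized (A\<lparr>carrier := N\<rparr>)"
proof -
  let ?K = "A\<lparr>carrier := N\<rparr>" and ?F = "free_group (UNIV :: bool set)"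
    and ?e = "presented_gen (UNIV :: bool set) {}"
  interpret K: group ?K
    using assms(1,2) by (simp add: group.subgroup_imp_group)
  interpret F: group ?F
    unfolding free_group_def by (rule group_presented_group)
  have g: "g \<in> UNIV \<rightarrow> carrier ?K" "g \<in> UNIV \<rightarrow> N" using assms(3) by auto
  obtain h where h: "h \<in> hom ?F ?K" and hg: "\<And>a. h (?e a) = g a"
    using K.presented_lift[OF g(1), of "{}"] unfolding free_group_def by auto
  interpret h: group_hom ?F ?K h
    using h by unfold_locales
  have e: "?e \<in> UNIV \<rightarrow> carrier ?F"
    unfolding free_group_def by (simp add: presented_gen_closed)
  have "x = \<one>\<^bsub>?F\<^esub>" if x: "x \<in> carrier ?F" "h x = \<one>\<^bsub>?K\<^esub>" for x
  proof -
    obtain w where w: "w \<in> gwords UNIV" "x = word_value ?F ?e w"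
      using x(1) unfolding free_group_def by (rule presented_group_word)
    define v where "v = foldr push w []"
    have v: "v \<in> gwords UNIV" "reduced v"
      using foldr_push_reduced_words[OF w(1)] by (auto simp: v_def reduced_words_def)
    have xv: "x = word_value ?F ?e v"
      unfolding w(2) v_def by (rule F.word_value_reduce[OF e w(1), symmetric])
    have "word_value A g v = word_value ?K g v"
      by (rule word_value_carrier_restrict[OF assms(1,2) g(2) v(1), symmetric])
    also have "\<dots> = h x"
      unfolding xv using word_value_hom[OF F.is_group K.is_group h e v(1)] by (simp add: hg)
    finally have "word_value A g v = \<one>\<^bsub>A\<^esub>" using x(2) by simp
    then have "v = []" using nontriv v(2) by blast
    then show ?thesis using xv by simp
  qed
  then have "inj_on h (carrier ?F)"
    by (auto simp: h.inj_on_one_iff)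
  then have "h \<in> iso ?F (?K\<lparr>carrier := h ` carrier ?F\<rparr>)"
    using h by (auto simp: iso_def hom_def bij_betw_def)
  then have "?K\<lparr>carrier := h ` carrier ?F\<rparr> \<cong> ?F"
    using F.iso_sym is_isoI by blast
  moreover have "subgroup (h ` carrier ?F) ?K"
    by (rule h.img_is_subgroup)
  ultimately show ?thesis
    unfolding full_sized_def by blast
qed

text \<open>
Each letter \<open>l\<close> owns a set \<open>S l\<close>, and applying \<open>l\<close> moves the base point and every \<open>S l'\<close> into \<open>S l\<close>, unless
\<open>l'\<close> is the inverse of \<open>l\<close>. Only the base point and the points in these sets are controlled, so that
parabolic generators such as transvections are covered: their fixed points lie outside the sets.
\<close>

locale ping_pong = group_action G E \<phi> for G (structure) and E and \<phi> +
  fixes X :: "'x set" and gen :: "'x \<Rightarrow> _" and S :: "'x \<times> bool \<Rightarrow> _ set" and base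
  assumes gen: "gen \<in> X \<rightarrow> carrier G"
    and base: "base \<in> E"
    and S_subset: "l \<in> X \<times> UNIV \<Longrightarrow> S l \<subseteq> E"
    and base_notin: "l \<in> X \<times> UNIV \<Longrightarrow> base \<notin> S l"
    and step: "l \<in> X \<times> UNIV \<Longrightarrow> l' \<in> X \<times> UNIV \<Longrightarrow> l' \<noteq> flip l \<Longrightarrow> x \<in> S l' \<Longrightarrow>
      \<phi> (letter_value G gen l) x \<in> S l"
    and step_base: "l \<in> X \<times> UNIV \<Longrightarrow> \<phi> (letter_value G gen l) base \<in> S l"
begin

sublocale group G
  using group_hom by (rule group_hom.axioms)

lemma word_step_aux:
  assumes "w \<noteq> []" "w \<in> gwords X" "reduced w" "x \<in> E"
    and "\<phi> (letter_value G gen (last w)) x \<in> S (last w)"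
  shows "\<phi> (word_value G gen w) x \<in> S (hd w)"
  using assms(1,2,3,5)
proof (induction w rule: list_nonempty_induct)
  case (single l)
  then show ?case using gen by (simp add: letter_value_closed[of gen X])
next
  case (cons l w)
  have l: "l \<in> X \<times> UNIV" and w: "w \<in> gwords X" and hd: "hd w \<in> X \<times> UNIV"
    using cons.prems(1) cons.hyps(1) by (auto simp: neq_Nil_conv)
  have "\<phi> (word_value G gen w) x \<in> S (hd w)"
    using cons w by (auto simp: reduced_Cons)
  then have "\<phi> (letter_value G gen l) (\<phi> (word_value G gen w) x) \<in> S l"
    using cons by (intro step[OF l hd]) (auto simp: reduced_Cons)
  then show ?case
    using composition_rule[OF assms(4) letter_value_closed[OF gen l] word_value_closed[OF gen w]]
    by simp
qed

lemma word_step: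
  assumes "w \<noteq> []" "w \<in> gwords X" "reduced w" "l \<in> X \<times> UNIV" "l \<noteq> flip (last w)" "x \<in> S l"
  shows "\<phi> (word_value G gen w) x \<in> S (hd w)"
proof -
  have "last w \<in> X \<times> UNIV"
    by (rule in_listsD[OF assms(2), rule_format]) (simp add: assms(1))
  moreover have "x \<in> E" using S_subset[OF assms(4)] assms(6) by blast
  ultimately show ?thesis
    by (intro word_step_aux[OF assms(1-3)] step[OF _ assms(4-6)])
qed

lemma word_base:
  assumes "w \<noteq> []" "w \<in> gwords X" "reduced w"
  shows "\<phi> (word_value G gen w) base \<in> S (hd w)"
proof -
  have "last w \<in> X \<times> UNIV"
    by (rule in_listsD[OF assms(2), rule_format]) (simp add: assms(1))
  then show ?thesis
    by (intro word_step_aux[OF assms base] step_base)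
qed

lemma word_moves_base:
  assumes "w \<noteq> []" "w \<in> gwords X" "reduced w"
  shows "\<phi> (word_value G gen w) base \<noteq> base"
proof -
  have "hd w \<in> X \<times> UNIV"
    by (rule in_listsD[OF assms(2), rule_format]) (simp add: assms(1))
  then show ?thesis
    using word_base[OF assms] base_notin by metis
qed

end

text \<open>
Conjugating away a matching first and last letter shortens the word and stays in the normal subgroup.
\<close>

lemma cyclically_reduced_conjugate:
  assumes "group G" "gen \<in> X \<rightarrow> carrier G" "group A" "\<theta> \<in> hom G A" "N \<lhd> A"
    and "Y \<in> gwords X" "reduced Y" "Y \<noteq> []" "\<theta> (word_value G gen Y) \<in> N"
  shows "\<exists>Y' \<in> gwords X. reduced Y' \<and> Y' \<noteq> [] \<and> last Y' \<noteq> flip (hd Y') \<and>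
    \<theta> (word_value G gen Y') \<in> N"
  using assms(6-9)
proof (induction "length Y" arbitrary: Y rule: less_induct)
  case less
  interpret G: group G by fact
  interpret \<theta>: group_hom G A \<theta>
    using assms by (simp add: group_hom_def group_hom_axioms_def)
  note gen = assms(2)
  show ?case
  proof (cases "last Y = flip (hd Y)")
    case True
    then obtain l W where Y: "Y = l # W @ [flip l]"
      using less.prems(3)
      by (cases Y rule: list.exhaust; cases "tl Y" rule: rev_exhaust) (auto simp del: flip_simps(1))
    have W: "W \<noteq> []" using less.prems(2) by (auto simp: Y)
    have l: "l \<in> X \<times> UNIV" and Ww: "W \<in> gwords X" and fl: "[flip l] \<in> gwords X"
      using less.prems(1) Y by auto
    have red: "reduced W" using less.prems(2) Y by (simp add: reduced_Cons reduced_append)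
    let ?a = "letter_value G gen l" and ?y = "word_value G gen W"
    have a: "?a \<in> carrier G" and y: "?y \<in> carrier G"
      using l Ww gen by (auto intro: G.letter_value_closed G.word_value_closed)
    have "word_value G gen Y = ?a \<otimes>\<^bsub>G\<^esub> (?y \<otimes>\<^bsub>G\<^esub> inv\<^bsub>G\<^esub> ?a)"
      using a y by (simp add: Y G.word_value_append[OF gen Ww fl] G.letter_value_flip[OF gen l])
    then have "?y = inv\<^bsub>G\<^esub> ?a \<otimes>\<^bsub>G\<^esub> word_value G gen Y \<otimes>\<^bsub>G\<^esub> inv\<^bsub>G\<^esub> (inv\<^bsub>G\<^esub> ?a)"
      using a y by (simp add: G.m_assoc) (simp add: G.m_assoc[symmetric])
    then have "\<theta> ?y = inv\<^bsub>A\<^esub> (\<theta> ?a) \<otimes>\<^bsub>A\<^esub> \<theta> (word_value G gen Y) \<otimes>\<^bsub>A\<^esub> inv\<^bsub>A\<^esub> (inv\<^bsub>A\<^esub> (\<theta> ?a))"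
      using a less.prems(1) gen by (simp add: G.word_value_closed[of gen X])
    also have "\<dots> \<in> N"
      using normal.inv_op_closed2[OF assms(5), of "inv\<^bsub>A\<^esub> (\<theta> ?a)"] a less.prems(4) by simp
    finally show ?thesis
      using less.hyps[of W] Ww red W by (simp add: Y)
  qed (use less.prems in blast)
qed

text \<open>
Let \<open>W\<close> be a cyclically reduced word with first letter \<open>p\<close>, last letter \<open>q\<close> and value \<open>y\<close>. If two distinct
letters \<open>s\<close> and \<open>t\<close> avoid both \<open>p\<inverse>\<close> and \<open>q\<close>, no letter cancels in \<open>s W s\<inverse>\<close> or \<open>t W t\<inverse>\<close>, and the conjugates
of \<open>y\<close> by \<open>s\<close> and \<open>t\<close> play ping-pong on the translates by \<open>s\<close> and \<open>t\<close> of \<open>S p\<close> and \<open>S q\<inverse>\<close>. Two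
generators give four letters, hence there are two such letters.

The homomorphism \<open>\<theta>\<close> covers the case in which the ping-pong is played by a group of which \<open>A\<close> contains
only a quotient: it suffices that elements of the kernel fix the base point.
\<close>

lemma (in ping_pong) normal_subgroup_full_sized:
  assumes A: "group A" and \<theta>: "\<theta> \<in> hom G A" and N: "N \<lhd> A"
    and ker: "\<And>g. g \<in> carrier G \<Longrightarrow> \<theta> g = \<one>\<^bsub>A\<^esub> \<Longrightarrow> \<phi> g base = base"
    and X: "a \<in> X" "b \<in> X" "a \<noteq> b"
    and Y: "Y \<in> gwords X" "word_value G gen Y \<noteq> \<one>" "\<theta> (word_value G gen Y) \<in> N"
  shows "full_sized (A\<lparr>carrier := N\<rparr>)"
proof -
  interpret \<theta>: group_hom G A \<theta>
    using A \<theta> by (simp add: group_hom_def group_hom_axioms_def)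
  define Y1 where "Y1 = foldr push Y []"
  have Y1: "Y1 \<in> gwords X" "reduced Y1" "word_value G gen Y1 = word_value G gen Y"
    using foldr_push_reduced_words[OF Y(1)] word_value_reduce[OF gen Y(1)]
    by (auto simp: Y1_def reduced_words_def)
  then have "Y1 \<noteq> []" using Y(2) by auto
  from cyclically_reduced_conjugate[OF _ gen A \<theta> N Y1(1,2) this] Y1(3) Y(3)
  obtain W where W: "W \<in> gwords X" "reduced W" "W \<noteq> []" "last W \<noteq> flip (hd W)"
    "\<theta> (word_value G gen W) \<in> N" by auto
  let ?p = "hd W" and ?q = "last W" and ?y = "word_value G gen W"
  have pq: "?p \<in> X \<times> UNIV" "?q \<in> X \<times> UNIV" "flip ?q \<in> X \<times> UNIV"
    using in_listsD[OF W(1)] W(3) flip_simps(8)[of ?q X] by (auto simp del: flip_simps)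
  have pq_neq: "?p \<noteq> flip ?q" "flip ?q \<noteq> ?p" using W(4) by (metis flip_simps(4))+
  have y: "?y \<in> carrier G" by (rule word_value_closed[OF gen W(1)])
  have "\<exists>s t. s \<in> X \<times> UNIV \<and> t \<in> X \<times> UNIV \<and> s \<noteq> t \<and> {s, t} \<inter> {flip ?p, ?q} = {}"
  proof -
    have "card ({a, b} \<times> (UNIV :: bool set)) = 4"
      using X(3) by (simp add: card_cartesian_product)
    moreover have "card {flip ?p, ?q} \<le> 2" by (simp add: card_insert_if)
    ultimately have "2 \<le> card ({a, b} \<times> UNIV - {flip ?p, ?q})"
      using diff_card_le_card_Diff[of "{flip ?p, ?q}" "{a, b} \<times> UNIV"] by simp
    then obtain B where B: "B \<subseteq> {a, b} \<times> UNIV - {flip ?p, ?q}" "card B = 2"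
      by (rule obtain_subset_with_card_n)
    then obtain s t where "B = {s, t}" "s \<noteq> t" by (auto simp: card_2_iff)
    moreover have "{a, b} \<times> UNIV \<subseteq> X \<times> (UNIV :: bool set)" using X(1,2) by auto
    ultimately have "s \<in> X \<times> UNIV \<and> t \<in> X \<times> UNIV \<and> s \<noteq> t \<and> {s, t} \<inter> {flip ?p, ?q} = {}"
      using B(1) by blast
    then show ?thesis by (intro exI)
  qed
  then obtain s t where "s \<in> X \<times> UNIV \<and> t \<in> X \<times> UNIV \<and> s \<noteq> t \<and> {s, t} \<inter> {flip ?p, ?q} = {}"
    by (elim exE)
  then have st: "s \<in> X \<times> UNIV" "t \<in> X \<times> UNIV" "s \<noteq> t"
    "s \<noteq> flip ?p" "t \<noteq> flip ?p" "s \<noteq> ?q" "t \<noteq> ?q" by blast+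
  define r where "r c = (if c then s else t)" for c
  have r: "r c \<in> X \<times> UNIV" "flip (r c) \<in> X \<times> UNIV" "r c \<noteq> flip ?p" "r c \<noteq> ?q" for c
    using st by (simp_all add: r_def del: flip_simps(1))
  have r_neq: "r d \<noteq> r c" if "d \<noteq> c" for c d using st(3) that by (auto simp: r_def)
  let ?v = "\<lambda>c. letter_value G gen (r c)"
  have v: "?v c \<in> carrier G" for c by (rule letter_value_closed[OF gen r(1)])
  have vf: "letter_value G gen (flip (r c)) = inv (?v c)" for c
    by (rule letter_value_flip[OF gen r(1)])
  define f where "f c = ?v c \<otimes> ?y \<otimes> inv (?v c)" for c
  have f: "f c \<in> carrier G" for c using v y by (simp add: f_def)
  define U where "U l = \<phi> (?v (fst l)) ` S (if snd l then ?p else flip ?q)" for l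
  have in_E: "\<phi> g x \<in> E" if "g \<in> carrier G" "x \<in> E" for g x
    using element_image[OF that] by simp
  have y_step: "\<phi> ?y x \<in> S ?p" if "x \<in> S l" "l \<in> X \<times> UNIV" "l \<noteq> flip ?q" for x l
    using word_step[OF W(3,1,2) that(2,3,1)] .
  have yi_step: "\<phi> (inv ?y) x \<in> S (flip ?q)" if "x \<in> S l" "l \<in> X \<times> UNIV" "l \<noteq> ?p" for x l
    using word_step[of "inverse_word W" l x] W that reduced_inverse[of W]
      word_value_inverse[OF gen W(1)] by (simp add: hd_inverse_word last_inverse_word)
  have lv: "letter_value G f l = ?v (fst l) \<otimes> (if snd l then ?y else inv ?y) \<otimes> inv (?v (fst l))" for l
    using v y by (simp add: letter_value_def f_def inv_mult_group m_assoc)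
  have act: "\<phi> (letter_value G f l) x =
      \<phi> (?v (fst l)) (\<phi> (if snd l then ?y else inv ?y) (\<phi> (inv (?v (fst l))) x))" if "x \<in> E" for l x
    using that v y in_E by (simp add: lv composition_rule)
  \<comment> \<open>Moving \<open>x\<close> back by \<open>s\<close> or \<open>t\<close> must not lead into the one set on which \<open>y\<close> (or its inverse) may cancel.\<close>
  have key: "\<phi> (letter_value G f l) x \<in> U l"
    if "x \<in> E" "\<phi> (inv (?v (fst l))) x \<in> S m" "m \<in> X \<times> UNIV" "m \<noteq> (if snd l then flip ?q else ?p)" for l x m
    unfolding act[OF that(1)] U_def using y_step[OF that(2,3)] yi_step[OF that(2,3)] that(4)
    by (intro imageI) (auto split: if_splits)
  have U_S: "U l \<subseteq> S (r (fst l))" for l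
  proof -
    have "(if snd l then ?p else flip ?q) \<noteq> flip (r (fst l))"
      using r(3,4)[of "fst l"] by (metis flip_simps(4))
    then show ?thesis
      unfolding U_def using step[OF r(1)] pq by auto
  qed
  interpret Q: ping_pong G E \<phi> "UNIV :: bool set" f U base
  proof unfold_locales
    show "f \<in> UNIV \<rightarrow> carrier G" using f by blast
    show "base \<in> E" by (rule base)
  next
    fix l :: "bool \<times> bool"
    show "U l \<subseteq> E" using U_S S_subset[OF r(1)] by blast
    show "base \<notin> U l" using U_S base_notin[OF r(1)] by blast
    have "\<phi> (inv (?v (fst l))) base \<in> S (flip (r (fst l)))"
      using step_base[OF r(2)] by (simp add: vf)
    then show "\<phi> (letter_value G f l) base \<in> U l"
      using r(3,4)[of "fst l"] by (intro key[OF base _ r(2)]) (auto simp: flip_eq_iff)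
  next
    fix l l' :: "bool \<times> bool" and x
    assume l': "l' \<noteq> flip l" and x: "x \<in> U l'"
    have xE: "x \<in> E" using x U_S S_subset[OF r(1)] by blast
    show "\<phi> (letter_value G f l) x \<in> U l"
    proof (cases "fst l' = fst l")
      case True
      then have eq: "snd l' = snd l" using l' by (auto simp: flip_def prod_eq_iff)
      let ?m = "if snd l then ?p else flip ?q"
      obtain z where z: "z \<in> S ?m" "x = \<phi> (?v (fst l)) z"
        using x True eq by (auto simp: U_def)
      have m: "?m \<in> X \<times> UNIV" using pq by simp
      have "z \<in> E" using z(1) S_subset[OF m] by blast
      then have "\<phi> (inv (?v (fst l))) x \<in> S ?m"
        using orbit_sym_aux[OF v, of z] z by simp
      then show ?thesis
        using pq_neq by (intro key[OF xE _ m]) (auto split: if_splits)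
    next
      case False
      have "\<phi> (inv (?v (fst l))) x \<in> S (flip (r (fst l)))"
        using step[OF r(2) r(1), of "fst l'" "fst l" x] r_neq[OF False] subsetD[OF U_S x]
        by (simp add: vf)
      then show ?thesis
        using r(3,4)[of "fst l"] by (intro key[OF xE _ r(2)]) (auto simp: flip_eq_iff)
    qed
  qed
  have fN: "\<theta> (f c) \<in> N" for c
    using normal.inv_op_closed2[OF N, of "\<theta> (?v c)" "\<theta> ?y"] v y W(5) by (simp add: f_def)
  show ?thesis
  proof (rule full_sizedI[OF A normal_imp_subgroup[OF N] fN])
    fix w :: "bool gword"
    assume w: "reduced w" "w \<noteq> []"
    have wU: "w \<in> gwords UNIV" by auto
    have "word_value A (\<lambda>c. \<theta> (f c)) w = \<theta> (word_value G f w)"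
      using word_value_hom[OF is_group A \<theta> Q.gen wU] by simp
    moreover have "\<theta> (word_value G f w) \<noteq> \<one>\<^bsub>A\<^esub>"
      using ker[OF word_value_closed[OF Q.gen wU]] Q.word_moves_base[OF w(2) wU w(1)] by blast
    ultimately show "word_value A (\<lambda>c. \<theta> (f c)) w \<noteq> \<one>\<^bsub>A\<^esub>" by simp
  qed
qed

section \<open>Actions on reduced words\<close>

definition rename :: "('a \<Rightarrow> 'b) \<Rightarrow> 'a gword \<Rightarrow> 'b gword" where
  "rename f = map (map_prod f id)"

lemma rename_simps [simp]: "rename f [] = []" "rename f (l # w) = map_prod f id l # rename f w"
  "rename f w = [] \<longleftrightarrow> w = []"
  by (simp_all add: rename_def)

lemma rename_cong: "(\<And>x. x \<in> X \<Longrightarrow> f x = f' x) \<Longrightarrow> w \<in> gwords X \<Longrightarrow> rename f w = rename f' w"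
  by (induction w) auto

lemma rename_rename: "rename f (rename f' w) = rename (\<lambda>x. f (f' x)) w"
  by (induction w) auto

lemma rename_id [simp]: "rename (\<lambda>x. x) w = w"
  by (induction w) auto

lemma rename_closed: "f \<in> X \<rightarrow> Y \<Longrightarrow> w \<in> gwords X \<Longrightarrow> rename f w \<in> gwords Y"
  by (induction w) (auto simp: Pi_iff)

lemma map_prod_eq_flip: "inj_on f X \<Longrightarrow> l \<in> X \<times> UNIV \<Longrightarrow> l' \<in> X \<times> UNIV \<Longrightarrow>
    map_prod f id l' = flip (map_prod f id l) \<longleftrightarrow> l' = flip l"
  by (auto simp: flip_def prod_eq_iff inj_on_def)

lemma reduced_rename: "inj_on f X \<Longrightarrow> w \<in> gwords X \<Longrightarrow> reduced (rename f w) = reduced w"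
proof (induction w)
  case (Cons l w)
  then show ?case
    by (cases w) (auto simp: reduced_Cons map_prod_eq_flip[of f X] simp del: flip_simps(1))
qed simp

lemma rename_reduced_words:
  "inj_on f X \<Longrightarrow> f \<in> X \<rightarrow> Y \<Longrightarrow> w \<in> reduced_words X \<Longrightarrow> rename f w \<in> reduced_words Y"
  using rename_closed[of f X Y] reduced_rename[of f X] by (auto simp: reduced_words_def)

lemma rename_push:
  assumes "inj_on f X" "l \<in> X \<times> UNIV" "w \<in> gwords X"
  shows "rename f (push l w) = push (map_prod f id l) (rename f w)"
proof (cases w)
  case (Cons m v)
  then have "m \<in> X \<times> UNIV" using assms(3) by auto
  then show ?thesis
    using map_prod_eq_flip[OF assms(1,2)] by (simp add: Cons push_def)
qed (simp add: push_def)

lemma word_value_rename: "word_value K g (rename f w) = word_value K (\<lambda>a. g (f a)) w"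
  by (induction w) (simp_all add: letter_value_def)

lemma BijGroup_simps: "carrier (BijGroup E) = Bij E" "\<one>\<^bsub>BijGroup E\<^esub> = (\<lambda>x\<in>E. x)"
  "f \<in> Bij E \<Longrightarrow> g \<in> Bij E \<Longrightarrow> f \<otimes>\<^bsub>BijGroup E\<^esub> g = compose E f g"
  by (simp_all add: BijGroup_def)

lemma restrict_Bij: "bij_betw f E E \<Longrightarrow> restrict f E \<in> Bij E"
  by (simp add: Bij_def)

lemma group_actionI: "group G \<Longrightarrow> h \<in> hom G (BijGroup E) \<Longrightarrow> group_action G E h"
  by (simp add: group_action_def group_hom_def group_hom_axioms_def group_BijGroup)

text \<open>
A group acting on reduced words such that the elements \<open>gen x\<close> act as left multiplication by basis
letters: these elements then play ping-pong, with \<open>S l\<close> the set of words that begin with \<open>l\<close>.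
\<close>

locale reduced_word_action = group_action G "reduced_words X" \<phi> for G (structure) and X :: "'x set" and \<phi> +
  fixes gen :: "'x \<Rightarrow> _"
  assumes gen: "gen \<in> X \<rightarrow> carrier G"
    and gen_push: "x \<in> X \<Longrightarrow> w \<in> reduced_words X \<Longrightarrow> \<phi> (gen x) w = push (x, True) w"
begin

lemma letter_action:
  assumes "l \<in> X \<times> UNIV" "w \<in> reduced_words X"
  shows "\<phi> (letter_value G gen l) w = push l w"
proof -
  obtain x b where l: "l = (x, b)" by (cases l)
  have x: "x \<in> X" using assms(1) l by simp
  have g: "gen x \<in> carrier G" using gen x by auto
  have in_E: "push (x, False) w \<in> reduced_words X"
    using assms(2) x push_reduced_words[of "(x, False)" X] by simp
  have "push (x, True) (push (x, False) w) = w"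
    using push_flip(2)[of w "(x, True)"] assms(2) by (simp add: reduced_words_def)
  then have "\<phi> (gen x) (push (x, False) w) = w"
    using gen_push[OF x in_E] by simp
  then have "\<phi> (inv (gen x)) w = push (x, False) w"
    by (rule orbit_sym_aux[OF g in_E])
  then show ?thesis
    using gen_push[OF x assms(2)] by (cases b) (simp_all add: l letter_value_def)
qed

sublocale ping_pong G "reduced_words X" \<phi> X gen "\<lambda>l. {w \<in> reduced_words X. w \<noteq> [] \<and> hd w = l}" "[]"
proof unfold_locales
  fix l l' :: "'x \<times> bool" and x
  assume l: "l \<in> X \<times> UNIV"
  show "\<phi> (letter_value G gen l) [] \<in> {w \<in> reduced_words X. w \<noteq> [] \<and> hd w = l}"
    using letter_action[OF l, of "[]"] push_reduced_words[OF l, of "[]"] by (simp add: push_def)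
  assume "l' \<noteq> flip l" "x \<in> {w \<in> reduced_words X. w \<noteq> [] \<and> hd w = l'}"
  then show "\<phi> (letter_value G gen l) x \<in> {w \<in> reduced_words X. w \<noteq> [] \<and> hd w = l}"
    using letter_action[OF l, of x] push_reduced_words[OF l, of x] by (auto simp: push_def)
qed (use gen in auto)

lemma word_action:
  assumes "u \<in> gwords X" "w \<in> reduced_words X"
  shows "\<phi> (word_value G gen u) w = foldr push u w" "foldr push u w \<in> reduced_words X"
proof -
  have "\<phi> (word_value G gen u) w = foldr push u w \<and> foldr push u w \<in> reduced_words X"
    using assms(1)
  proof (induction u)
    case Nil
    then show ?case using id_eq_one[symmetric] assms(2) by simp
  next
    case (Cons l u)
    then show ?case
      using letter_action[OF Cons.hyps(1)] push_reduced_words[OF Cons.hyps(1)]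
        composition_rule[OF assms(2) letter_value_closed[OF gen Cons.hyps(1)]
          word_value_closed[OF gen Cons.hyps(2)]]
      by simp
  qed
  then show "\<phi> (word_value G gen u) w = foldr push u w" "foldr push u w \<in> reduced_words X"
    by simp_all
qed

end

text \<open>
The obstruction used to recognise groups that are not full-sized: in the free group on \<open>a\<close> and \<open>b\<close>, the
words \<open>aabb\<close> and \<open>bbaa\<close> are reduced and differ.
\<close>

lemma full_sized_noncommuting_squares:
  assumes "full_sized K" "group K"
  shows "\<exists>x \<in> carrier K. \<exists>y \<in> carrier K.
    (x \<otimes>\<^bsub>K\<^esub> x) \<otimes>\<^bsub>K\<^esub> (y \<otimes>\<^bsub>K\<^esub> y) \<noteq> (y \<otimes>\<^bsub>K\<^esub> y) \<otimes>\<^bsub>K\<^esub> (x \<otimes>\<^bsub>K\<^esub> x)"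
proof -
  let ?F = "free_group (UNIV :: bool set)" and ?E = "reduced_words (UNIV :: bool set)"
    and ?e = "presented_gen (UNIV :: bool set) {}"
  obtain H where H: "subgroup H K" "K\<lparr>carrier := H\<rparr> \<cong> ?F"
    using assms(1) by (auto simp: full_sized_def)
  interpret F: group ?F unfolding free_group_def by (rule group_presented_group)
  interpret B: group "BijGroup ?E" by (rule group_BijGroup)
  interpret H: group "K\<lparr>carrier := H\<rparr>" using assms(2) H(1) by (rule group.subgroup_imp_group)
  have "(\<lambda>c. restrict (push (c, True)) ?E) \<in> (UNIV :: bool set) \<rightarrow> carrier (BijGroup ?E)"
    using bij_betw_push[of "(_, True)" UNIV] by (auto simp: BijGroup_simps intro!: restrict_Bij)
  from B.presented_lift[OF this, of "{}"] obtain h where h: "h \<in> hom ?F (BijGroup ?E)"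
    and hc: "\<And>c. h (?e c) = restrict (push (c, True)) ?E"
    unfolding free_group_def by auto
  have e: "?e c \<in> carrier ?F" for c unfolding free_group_def by (simp add: presented_gen_closed)
  have e': "?e \<in> UNIV \<rightarrow> carrier ?F" using e by blast
  interpret reduced_word_action ?F UNIV h ?e
    using group_actionI[OF F.is_group h] e'
    by (simp add: reduced_word_action_def reduced_word_action_axioms_def hc)
  have act: "h (word_value ?F ?e u) [] = foldr push u []" for u
    by (rule word_action) auto
  let ?u = "[(True, True), (True, True), (False, True), (False, True)]"
    and ?v = "[(False, True), (False, True), (True, True), (True, True)]"
  have "word_value ?F ?e ?u \<noteq> word_value ?F ?e ?v"
    using act[of ?u] act[of ?v] by (auto simp: push_def)
  then have neq: "(?e True \<otimes>\<^bsub>?F\<^esub> ?e True) \<otimes>\<^bsub>?F\<^esub> (?e False \<otimes>\<^bsub>?F\<^esub> ?e False) \<noteq>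
      (?e False \<otimes>\<^bsub>?F\<^esub> ?e False) \<otimes>\<^bsub>?F\<^esub> (?e True \<otimes>\<^bsub>?F\<^esub> ?e True)"
    using e by (simp add: letter_value_def F.m_assoc)
  obtain \<psi> where \<psi>: "\<psi> \<in> iso ?F (K\<lparr>carrier := H\<rparr>)"
    using H.iso_sym[OF H(2)] by (auto simp: is_iso_def)
  then have hom: "\<psi> (x \<otimes>\<^bsub>?F\<^esub> y) = \<psi> x \<otimes>\<^bsub>K\<^esub> \<psi> y" and mem: "\<psi> x \<in> H"
    if "x \<in> carrier ?F" "y \<in> carrier ?F" for x y
    using that by (auto simp: iso_def hom_def)
  have "\<psi> (?e True \<otimes>\<^bsub>?F\<^esub> ?e True \<otimes>\<^bsub>?F\<^esub> (?e False \<otimes>\<^bsub>?F\<^esub> ?e False)) \<noteq>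
      \<psi> (?e False \<otimes>\<^bsub>?F\<^esub> ?e False \<otimes>\<^bsub>?F\<^esub> (?e True \<otimes>\<^bsub>?F\<^esub> ?e True))"
    using neq \<psi> e by (auto simp: iso_def bij_betw_def inj_on_eq_iff)
  moreover have "\<psi> (?e c) \<in> carrier K" for c
    using mem[OF e e] subgroup.subset[OF H(1)] by blast
  ultimately show ?thesis
    using e by (auto simp: hom)
qed

section \<open>Right-angled Artin groups\<close>

lemma (in group) commute_mult_inv:
  assumes "x \<in> carrier G" "y \<in> carrier G" "z \<in> carrier G" "x \<otimes> z = z \<otimes> x" "y \<otimes> z = z \<otimes> y"
  shows "x \<otimes> y \<otimes> z = z \<otimes> (x \<otimes> y)" "inv x \<otimes> z = z \<otimes> inv x"
proof -
  show "x \<otimes> y \<otimes> z = z \<otimes> (x \<otimes> y)"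
    using assms by (metis m_assoc)
  show "inv x \<otimes> z = z \<otimes> inv x"
    using assms(1,3,4) by (metis inv_closed inv_solve_left inv_solve_right m_assoc m_closed)
qed

locale raag_graph =
  fixes V :: "'v set" and E :: "'v set set" and G :: "'v gword set monoid" (structure)
  assumes finite_V: "finite V" and graph: "simplicial_graph V E" and G_eq: "G = raag V E"
begin

abbreviation e :: "'v \<Rightarrow> 'v gword set" where "e \<equiv> raag_gen V E"
abbreviation D :: "'v set" where "D \<equiv> cone_vertices V E"
abbreviation Z :: "'v gword set set" where "Z \<equiv> cone_subgroup V E"

sublocale group G
  unfolding G_eq raag_def by (rule group_presented_group)

lemma e_closed [simp]: "v \<in> V \<Longrightarrow> e v \<in> carrier G"
  unfolding G_eq raag_def raag_gen_def by (rule presented_gen_closed)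

lemma e_funcset: "e \<in> V \<rightarrow> carrier G"
  by auto

lemma D_subset: "D \<subseteq> V"
  by (auto simp: cone_vertices_def)

lemma edgeD: "{v, w} \<in> E \<Longrightarrow> v \<in> V \<and> w \<in> V \<and> v \<noteq> w"
  using graph by (fastforce simp: simplicial_graph_def)

lemma cone_vertex_edge: "v \<in> D \<Longrightarrow> w \<in> V \<Longrightarrow> w \<noteq> v \<Longrightarrow> {v, w} \<in> E"
  by (auto simp: cone_vertices_def star_def)

lemma not_cone_vertex: "v \<in> V - D \<Longrightarrow> \<exists>u \<in> V. u \<noteq> v \<and> {u, v} \<notin> E"
  by (auto simp: cone_vertices_def star_def insert_commute)

lemma word_exists:
  assumes "x \<in> carrier G"
  obtains w where "w \<in> gwords V" "x = word_value G e w"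
  using assms presented_group_word[of x V "raag_relations E"]
  unfolding G_eq raag_def raag_gen_def[abs_def] by auto

lemma e_commute:
  assumes "{v, w} \<in> E"
  shows "e v \<otimes> e w = e w \<otimes> e v"
proof -
  let ?R = "raag_relations E"
  have V: "v \<in> V" "w \<in> V" using edgeD[OF assms] by auto
  let ?r = "[(v, True), (w, True)]" and ?s = "[(w, True), (v, True)]"
  have words: "?r \<in> gwords V" "?s \<in> gwords V" using V by auto
  have "(?r, ?s) \<in> ?R" using assms by (auto simp: raag_relations_def)
  then have "([] @ ?r @ [], [] @ ?s @ []) \<in> gword_eq V ?R"
    using words by (intro gword_eq.relation) auto
  then have "word_value (presented_group V ?R) (presented_gen V ?R) ?r =
      word_value (presented_group V ?R) (presented_gen V ?R) ?s"
    unfolding presented_word_value[OF words(1)] presented_word_value[OF words(2)]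
    by (intro equiv_class_eq[OF equiv_gword_eq]) simp
  then have "word_value G e ?r = word_value G e ?s"
    by (simp add: G_eq raag_def raag_gen_def[abs_def])
  then show ?thesis
    using V by (simp add: letter_value_def)
qed

lemma hom_eqI:
  assumes "group K" "h \<in> hom G K" "h' \<in> hom G K" "\<And>v. v \<in> V \<Longrightarrow> h (e v) = h' (e v)"
    and "x \<in> carrier G"
  shows "h x = h' x"
  using presented_hom_eqI[OF assms(1), of h V "raag_relations E" h' x] assms(2-5)
  unfolding G_eq raag_def raag_gen_def[abs_def] by blast

lemma lift:
  assumes "group K" "g \<in> V \<rightarrow> carrier K"
    and "\<And>v w. {v, w} \<in> E \<Longrightarrow> g v \<otimes>\<^bsub>K\<^esub> g w = g w \<otimes>\<^bsub>K\<^esub> g v"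
  shows "\<exists>h \<in> hom G K. \<forall>v \<in> V. h (e v) = g v"
proof -
  interpret K: group K by fact
  have "word_value K g r = word_value K g s" if rs: "(r, s) \<in> raag_relations E" for r s
  proof -
    obtain v w where "{v, w} \<in> E" and r: "r = [(v, True), (w, True)]" "s = [(w, True), (v, True)]"
      using rs by (auto simp: raag_relations_def)
    then have "g v \<in> carrier K" "g w \<in> carrier K" "g v \<otimes>\<^bsub>K\<^esub> g w = g w \<otimes>\<^bsub>K\<^esub> g v"
      using edgeD assms(2,3) by blast+
    then show ?thesis by (simp add: r letter_value_def)
  qed
  from K.presented_lift[OF assms(2) this] show ?thesis
    unfolding G_eq raag_def raag_gen_def[abs_def] by blast
qed

lemma generated:
  assumes "subgroup H G" "e ` V \<subseteq> H"
  shows "carrier G \<subseteq> H"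
proof
  fix x assume "x \<in> carrier G"
  then obtain w where "w \<in> gwords V" "x = word_value G e w" by (rule word_exists)
  then show "x \<in> H" using word_value_in_subgroup[OF assms(1), of e V w] assms(2) by auto
qed

text \<open>
The two vertices can be sent to the generators of a free group of rank two and all other vertices to
the identity, because only the two nonadjacent ones have nontrivial images.
\<close>

lemma nonadjacent_not_commute:
  assumes "u \<in> V" "v \<in> V" "u \<noteq> v" "{u, v} \<notin> E"
  shows "e u \<otimes> e v \<noteq> e v \<otimes> e u"
proof
  assume comm: "e u \<otimes> e v = e v \<otimes> e u"
  let ?E = "reduced_words (UNIV :: bool set)"
  define g where "g w = (if w = u then restrict (push (True, True)) ?E
    else if w = v then restrict (push (False, True)) ?E else \<one>\<^bsub>BijGroup ?E\<^esub>)" for w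
  interpret B: group "BijGroup ?E" by (rule group_BijGroup)
  have gc: "g w \<in> carrier (BijGroup ?E)" for w
    using bij_betw_push[of "(_, True)" "UNIV :: bool set"] B.one_closed
    by (auto simp: g_def BijGroup_simps(1) intro!: restrict_Bij)
  have "g w \<otimes>\<^bsub>BijGroup ?E\<^esub> g w' = g w' \<otimes>\<^bsub>BijGroup ?E\<^esub> g w" if "{w, w'} \<in> E" for w w'
  proof -
    have "w \<notin> {u, v} \<or> w' \<notin> {u, v}"
      using that edgeD[OF that] assms(4) by (auto simp: insert_commute)
    then have "g w = \<one>\<^bsub>BijGroup ?E\<^esub> \<or> g w' = \<one>\<^bsub>BijGroup ?E\<^esub>"
      by (auto simp: g_def)
    then show ?thesis using gc by auto
  qed
  then obtain h where h: "h \<in> hom G (BijGroup ?E)" "\<And>w. w \<in> V \<Longrightarrow> h (e w) = g w"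
    using lift[OF B.is_group, of g] gc by blast
  have "h (e u) \<otimes>\<^bsub>BijGroup ?E\<^esub> h (e v) = h (e v) \<otimes>\<^bsub>BijGroup ?E\<^esub> h (e u)"
    using comm h(1) assms(1,2) by (metis e_closed hom_mult)
  then have "compose ?E (g u) (g v) = compose ?E (g v) (g u)"
    using h(2) assms(1,2) gc by (simp add: BijGroup_simps)
  then have "compose ?E (g u) (g v) [] = compose ?E (g v) (g u) []" by simp
  then show False
    using assms(3) push_reduced_words[of "(True, True)" UNIV "[]"]
      push_reduced_words[of "(False, True)" UNIV "[]"]
    by (simp add: compose_eq g_def push_def)
qed

lemma Z_subgroup: "subgroup Z G"
  unfolding cone_subgroup_def G_eq[symmetric]
  using D_subset by (intro generate_is_subgroup) auto

lemma Z_carrier: "x \<in> Z \<Longrightarrow> x \<in> carrier G"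
  using subgroup.subset[OF Z_subgroup] by blast

lemma e_in_Z: "v \<in> D \<Longrightarrow> e v \<in> Z"
  unfolding cone_subgroup_def by (intro generate.incl) simp

lemma commute_generatedI:
  assumes "z \<in> carrier G" "\<And>v. v \<in> V \<Longrightarrow> e v \<otimes> z = z \<otimes> e v" "x \<in> carrier G"
  shows "x \<otimes> z = z \<otimes> x"
proof -
  have "subgroup {x \<in> carrier G. x \<otimes> z = z \<otimes> x} G"
    using assms(1) by (intro subgroupI) (auto simp: commute_mult_inv)
  moreover have "e ` V \<subseteq> {x \<in> carrier G. x \<otimes> z = z \<otimes> x}"
    using assms(2) by (simp add: image_subset_iff)
  ultimately show ?thesis using generated assms(3) by blast
qed

lemma Z_central:
  assumes "z \<in> Z" "x \<in> carrier G"
  shows "x \<otimes> z = z \<otimes> x"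
proof -
  have e: "e v \<otimes> x = x \<otimes> e v" if v: "v \<in> D" for v
  proof (rule commute_generatedI[OF _ _ assms(2), symmetric])
    show "e v \<in> carrier G" using D_subset v by auto
    show "e w \<otimes> e v = e v \<otimes> e w" if "w \<in> V" for w
      using e_commute[OF cone_vertex_edge[OF v that]] by (cases "w = v") simp_all
  qed
  have "subgroup {z \<in> carrier G. z \<otimes> x = x \<otimes> z} G"
    using assms(2) by (intro subgroupI) (auto simp: commute_mult_inv)
  then have "Z \<subseteq> {z \<in> carrier G. z \<otimes> x = x \<otimes> z}"
    unfolding cone_subgroup_def G_eq[symmetric] using e D_subset
    by (intro generate_subgroup_incl) (auto simp: image_subset_iff subset_iff simp del: set_eq_iff)
  then show ?thesis using assms(1) by force
qed

end

context group
begin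

definition inner :: "'a \<Rightarrow> 'a \<Rightarrow> 'a" where
  "inner g = (\<lambda>x \<in> carrier G. g \<otimes> x \<otimes> inv g)"

lemma inner_hom_Bij: "inner \<in> hom G (BijGroup (carrier G))"
  using conjugation_is_hom unfolding inner_def[abs_def] .

lemma inner_apply: "x \<in> carrier G \<Longrightarrow> inner g x = g \<otimes> x \<otimes> inv g"
  by (simp add: inner_def)

lemma inner_closed [simp]: "g \<in> carrier G \<Longrightarrow> x \<in> carrier G \<Longrightarrow> inner g x \<in> carrier G"
  by (simp add: inner_apply)

lemma inner_mult: "g \<in> carrier G \<Longrightarrow> h \<in> carrier G \<Longrightarrow> x \<in> carrier G \<Longrightarrow>
    inner (g \<otimes> h) x = inner g (inner h x)"
  by (simp add: inner_apply inv_mult_group m_assoc)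

lemma inner_one: "x \<in> carrier G \<Longrightarrow> inner \<one> x = x"
  by (simp add: inner_apply)

lemma inner_hom: "g \<in> carrier G \<Longrightarrow> inner g \<in> hom G G"
proof (rule homI)
  fix x y assume xy: "g \<in> carrier G" "x \<in> carrier G" "y \<in> carrier G"
  have "inv g \<otimes> (g \<otimes> (y \<otimes> inv g)) = y \<otimes> inv g"
    using xy by (simp add: m_assoc[symmetric])
  then show "inner g (x \<otimes> y) = inner g x \<otimes> inner g y"
    using xy by (simp add: inner_apply m_assoc)
qed simp

lemma inner_inj: "g \<in> carrier G \<Longrightarrow> inj_on (inner g) (carrier G)"
  using inner_hom_Bij by (auto simp: hom_def Pi_iff BijGroup_simps(1) Bij_def bij_betw_def)

lemma inner_auto: "g \<in> carrier G \<Longrightarrow> inner g \<in> auto G"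
  using inner_hom_Bij inner_hom by (auto simp: auto_def hom_def Pi_iff BijGroup_simps(1))

lemma inner_hom_AutoGroup: "inner \<in> hom G (AutoGroup G)"
  using inner_hom_Bij inner_auto by (auto simp: hom_def AutoGroup_def)

lemma inner_eq_iff: "g \<in> carrier G \<Longrightarrow> x \<in> carrier G \<Longrightarrow> inner g x = x \<longleftrightarrow> g \<otimes> x = x \<otimes> g"
  by (simp add: inner_apply) (metis inv_solve_right' m_closed)

end

section \<open>The free normal closure of a vertex\<close>

text \<open>
Let \<open>H\<close> be generated by the vertices other than \<open>v\<close>. The group is the semidirect product of \<open>H\<close> and the
normal closure of \<open>v\<close>, which is free on the set \<open>X\<close> of \<open>H\<close>-conjugates of \<open>v\<close>. Instead of this
decomposition, an action on the reduced words over \<open>X\<close> is constructed: \<open>v\<close> multiplies by itself as a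
letter, and every other vertex conjugates the letters of a word.
\<close>

locale raag_vertex = raag_graph V E G for V :: "'v set" and E and G (structure) +
  fixes v :: 'v
  assumes v: "v \<in> V - D"
begin

definition H :: "'v gword set set" where "H = generate G (e ` (V - {v}))"

definition X :: "'v gword set set" where "X = (\<lambda>h. inner h (e v)) ` H"

lemma H_subgroup: "subgroup H G"
  unfolding H_def by (rule generate_is_subgroup) auto

lemma H_carrier: "h \<in> H \<Longrightarrow> h \<in> carrier G"
  using subgroup.subset[OF H_subgroup] by blast

lemma e_in_H: "u \<in> V \<Longrightarrow> u \<noteq> v \<Longrightarrow> e u \<in> H"
  unfolding H_def by (intro generate.incl) auto

lemma e_v_closed: "e v \<in> carrier G"
  using v by simp

lemma X_carrier: "x \<in> X \<Longrightarrow> x \<in> carrier G"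
  using e_v_closed H_carrier by (auto simp: X_def)

lemma id_X: "(\<lambda>x. x) \<in> X \<rightarrow> carrier G"
  using X_carrier by blast

lemma e_v_in_X: "e v \<in> X"
  unfolding X_def using inner_one[OF e_v_closed] subgroup.one_closed[OF H_subgroup]
  by (intro image_eqI[where x = "\<one>"]) simp_all

lemma inner_X: "h \<in> H \<Longrightarrow> x \<in> X \<Longrightarrow> inner h x \<in> X"
proof -
  assume h: "h \<in> H" and "x \<in> X"
  then obtain k where k: "k \<in> H" "x = inner k (e v)" by (auto simp: X_def)
  have "inner h x = inner (h \<otimes> k) (e v)"
    unfolding k(2) using h k(1) H_carrier e_v_closed by (simp add: inner_mult)
  then show ?thesis
    unfolding X_def using subgroup.m_closed[OF H_subgroup h k(1)] by blast
qed

lemma inner_X_inj: "h \<in> H \<Longrightarrow> inj_on (inner h) X"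
  using inner_inj[OF H_carrier] X_carrier by (meson inj_on_subset subsetI)

abbreviation \<Omega> :: "'v gword set gword set" where "\<Omega> \<equiv> reduced_words X"

lemma rename_inner_\<Omega>: "h \<in> H \<Longrightarrow> w \<in> \<Omega> \<Longrightarrow> rename (inner h) w \<in> \<Omega>"
  using rename_reduced_words[OF inner_X_inj] inner_X by blast

lemma \<Omega>_gwords: "w \<in> \<Omega> \<Longrightarrow> w \<in> gwords X"
  by (simp add: reduced_words_def)

lemma rename_inner_mult:
  "h \<in> H \<Longrightarrow> k \<in> H \<Longrightarrow> w \<in> \<Omega> \<Longrightarrow> rename (inner h) (rename (inner k) w) = rename (inner (h \<otimes> k)) w"
  unfolding rename_rename
  by (rule rename_cong[of X]) (simp_all add: inner_mult H_carrier X_carrier \<Omega>_gwords)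

lemma rename_inner_cancel:
  assumes "h \<in> H" "w \<in> \<Omega>"
  shows "rename (inner h) (rename (inner (inv h)) w) = w"
proof -
  have "inv h \<in> H" using assms(1) subgroup.m_inv_closed[OF H_subgroup] by blast
  then have "rename (inner h) (rename (inner (inv h)) w) = rename (inner (h \<otimes> inv h)) w"
    using rename_inner_mult assms by blast
  also have "\<dots> = rename (\<lambda>x. x) w"
    using assms H_carrier by (intro rename_cong[of X]) (simp_all add: inner_one X_carrier \<Omega>_gwords)
  finally show ?thesis by simp
qed

lemma bij_rename_inner: "h \<in> H \<Longrightarrow> bij_betw (rename (inner h)) \<Omega> \<Omega>"
proof (rule bij_betw_byWitness[where f' = "rename (inner (inv h))"])
  assume h: "h \<in> H"
  then have h': "inv h \<in> H" using subgroup.m_inv_closed[OF H_subgroup] by blast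
  show "\<forall>w\<in>\<Omega>. rename (inner (inv h)) (rename (inner h) w) = w"
    using rename_inner_cancel[OF h'] h H_carrier by simp
  show "\<forall>w\<in>\<Omega>. rename (inner h) (rename (inner (inv h)) w) = w"
    using rename_inner_cancel[OF h] by blast
qed (use rename_inner_\<Omega> subgroup.m_inv_closed[OF H_subgroup] in blast)+

definition letter_perm :: "'v \<Rightarrow> 'v gword set gword \<Rightarrow> 'v gword set gword" where
  "letter_perm u = restrict (if u = v then push (e v, True) else rename (inner (e u))) \<Omega>"

lemma letter_perm_Bij: "u \<in> V \<Longrightarrow> letter_perm u \<in> Bij \<Omega>"
  unfolding letter_perm_def using e_v_in_X bij_betw_push[of "(e v, True)" X]
  by (auto intro!: restrict_Bij bij_rename_inner e_in_H)

text \<open>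
These are the defining relations. A neighbour of \<open>v\<close> fixes the letter \<open>v\<close>, so it commutes with \<open>push\<close> of
this letter; this is where \<open>X\<close> has to be a set of conjugates and not the set \<open>H\<close> itself.
\<close>

lemma letter_perm_commute:
  assumes "{u, w} \<in> E" "w \<noteq> v"
  shows "compose \<Omega> (letter_perm u) (letter_perm w) = compose \<Omega> (letter_perm w) (letter_perm u)"
proof (rule extensionalityI[of _ \<Omega>])
  fix x assume x: "x \<in> \<Omega>"
  have uw: "u \<in> V" "w \<in> V" "u \<noteq> w" using edgeD[OF assms(1)] by auto
  have wH: "e w \<in> H" using e_in_H uw(2) assms(2) .
  show "compose \<Omega> (letter_perm u) (letter_perm w) x = compose \<Omega> (letter_perm w) (letter_perm u) x"
  proof (cases "u = v")
    case True
    have fix_v: "inner (e w) (e v) = e v"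
      using e_commute[OF assms(1)] uw True by (simp add: inner_eq_iff)
    have "push (e v, True) x \<in> \<Omega>" using x e_v_in_X by (intro push_reduced_words) auto
    moreover have "rename (inner (e w)) (push (e v, True) x) = push (e v, True) (rename (inner (e w)) x)"
      using rename_push[OF inner_X_inj[OF wH] _ \<Omega>_gwords[OF x], of "(e v, True)"] e_v_in_X fix_v by simp
    ultimately show ?thesis
      using x assms(2) True rename_inner_\<Omega>[OF wH x] by (simp add: compose_eq letter_perm_def)
  next
    case False
    then have uH: "e u \<in> H" using e_in_H uw(1) by blast
    have "rename (inner (e u)) (rename (inner (e w)) x) = rename (inner (e w)) (rename (inner (e u)) x)"
      using rename_inner_mult[OF uH wH x] rename_inner_mult[OF wH uH x] e_commute[OF assms(1)] by simp
    then show ?thesis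
      using x assms(2) False rename_inner_\<Omega>[OF wH x] rename_inner_\<Omega>[OF uH x]
      by (simp add: compose_eq letter_perm_def)
  qed
qed (simp_all add: compose_extensional)

lemma action_exists: "\<exists>\<Phi> \<in> hom G (BijGroup \<Omega>). \<forall>u \<in> V. \<Phi> (e u) = letter_perm u"
proof (rule lift[OF group_BijGroup])
  show "letter_perm \<in> V \<rightarrow> carrier (BijGroup \<Omega>)"
    using letter_perm_Bij by (simp add: BijGroup_simps)
  fix u w assume uw: "{u, w} \<in> E"
  then have "u \<in> V" "w \<in> V" "u \<noteq> v \<or> w \<noteq> v" using edgeD[OF uw] by auto
  then show "letter_perm u \<otimes>\<^bsub>BijGroup \<Omega>\<^esub> letter_perm w = letter_perm w \<otimes>\<^bsub>BijGroup \<Omega>\<^esub> letter_perm u"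
    using letter_perm_commute[of u w] letter_perm_commute[of w u] uw letter_perm_Bij
    by (auto simp: BijGroup_simps insert_commute)
qed

definition \<Phi> :: "'v gword set \<Rightarrow> 'v gword set gword \<Rightarrow> 'v gword set gword" where
  "\<Phi> = (SOME f. f \<in> hom G (BijGroup \<Omega>) \<and> (\<forall>u \<in> V. f (e u) = letter_perm u))"

lemma \<Phi>: "\<Phi> \<in> hom G (BijGroup \<Omega>)" "u \<in> V \<Longrightarrow> \<Phi> (e u) = letter_perm u"
  using someI_ex[of "\<lambda>f. f \<in> hom G (BijGroup \<Omega>) \<and> (\<forall>u \<in> V. f (e u) = letter_perm u)"] action_exists
  unfolding \<Phi>_def by blast+

sublocale group_action G \<Omega> \<Phi>
  by (rule group_actionI[OF is_group \<Phi>(1)])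

lemma \<Phi>_H:
  assumes "h \<in> H" "w \<in> \<Omega>"
  shows "\<Phi> h w = rename (inner h) w"
  using assms(1)[unfolded H_def] assms(2)
proof (induction h arbitrary: w rule: generate.induct)
  case one
  have "rename (inner \<one>) w = rename (\<lambda>x. x) w"
    using one by (intro rename_cong[of X]) (simp_all add: inner_one X_carrier \<Omega>_gwords)
  then show ?case using one id_eq_one[symmetric] by simp
next
  case (incl h)
  then obtain u where "u \<in> V" "u \<noteq> v" "h = e u" by auto
  then show ?case using \<Phi>(2) incl.prems by (simp add: letter_perm_def)
next
  case (inv h)
  then obtain u where u: "u \<in> V" "u \<noteq> v" "h = e u" by auto
  have hH: "h \<in> H" unfolding u(3) by (rule e_in_H[OF u(1,2)])
  then have h: "h \<in> carrier G" "inv h \<in> H"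
    using H_carrier subgroup.m_inv_closed[OF H_subgroup] by auto
  let ?w = "rename (inner (inv h)) w"
  have w: "?w \<in> \<Omega>" by (rule rename_inner_\<Omega>[OF h(2) inv.prems])
  have "\<Phi> h ?w = w"
    using w \<Phi>(2)[OF u(1)] u(2,3) rename_inner_cancel[OF hH inv.prems] by (simp add: letter_perm_def)
  then show ?case by (rule orbit_sym_aux[OF h(1) w])
next
  case (eng h k)
  then have hk: "h \<in> H" "k \<in> H" by (simp_all add: H_def)
  show ?case
    using composition_rule[OF eng.prems H_carrier[OF hk(1)] H_carrier[OF hk(2)]] eng.IH(1)[OF rename_inner_\<Omega>[OF hk(2) eng.prems]]
      eng.IH(2)[OF eng.prems] rename_inner_mult[OF hk eng.prems] by simp
qed

text \<open>
Conjugating multiplication by the letter \<open>v\<close> with \<open>h\<close> gives multiplication by the letter \<open>h v h\<inverse>\<close>.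
\<close>

lemma \<Phi>_X:
  assumes "x \<in> X" "w \<in> \<Omega>"
  shows "\<Phi> x w = push (x, True) w"
proof -
  obtain h where h: "h \<in> H" "x = inner h (e v)" using assms(1) by (auto simp: X_def)
  have hc: "h \<in> carrier G" and ih: "inv h \<in> H"
    using h H_carrier subgroup.m_inv_closed[OF H_subgroup] by auto
  let ?w = "rename (inner (inv h)) w"
  have w: "?w \<in> \<Omega>" by (rule rename_inner_\<Omega>[OF ih assms(2)])
  have p: "push (e v, True) ?w \<in> \<Omega>" using w e_v_in_X by (intro push_reduced_words) auto
  have "\<Phi> x w = \<Phi> h (\<Phi> (e v) (\<Phi> (inv h) w))"
    unfolding h(2) inner_apply[OF e_v_closed] m_assoc[OF hc e_v_closed inv_closed[OF hc]]
    using hc e_v_closed assms(2) w \<Phi>_H[OF ih assms(2)] by (simp add: composition_rule)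
  also have "\<dots> = rename (inner h) (push (e v, True) ?w)"
    using \<Phi>_H[OF ih assms(2)] \<Phi>_H[OF h(1) p] \<Phi>(2) v w by (simp add: letter_perm_def)
  also have "\<dots> = push (x, True) (rename (inner h) ?w)"
    using rename_push[OF inner_X_inj[OF h(1)] _ \<Omega>_gwords[OF w], of "(e v, True)"] e_v_in_X h(2) by simp
  also have "rename (inner h) ?w = w"
    by (rule rename_inner_cancel[OF h(1) assms(2)])
  finally show ?thesis .
qed

sublocale reduced_word_action G X \<Phi> "\<lambda>x. x"
  using id_X \<Phi>_X by unfold_locales auto

text \<open>
The normal closure of \<open>v\<close> and \<open>H\<close> generate the group, with \<open>H\<close> moved to the right: passing a letter of
\<open>H\<close> over a word over \<open>X\<close> only renames the letters of that word.
\<close>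

lemma decomposition:
  assumes "g \<in> carrier G"
  shows "\<exists>R \<in> \<Omega>. \<exists>h \<in> H. g = word_value G (\<lambda>x. x) R \<otimes> h"
proof -
  let ?wv = "word_value G (\<lambda>x. x)"
  have "\<exists>R \<in> gwords X. \<exists>h \<in> H. word_value G e w = ?wv R \<otimes> h" if "w \<in> gwords V" for w
    using that
  proof (induction w)
    case Nil
    show ?case
      using subgroup.one_closed[OF H_subgroup] by (intro bexI[of _ "[]"] bexI[of _ "\<one>"]) auto
  next
    case (Cons l w)
    then obtain R h where R: "R \<in> gwords X" "h \<in> H" "word_value G e w = ?wv R \<otimes> h" by blast
    obtain u b where l: "l = (u, b)" by (cases l)
    have u: "u \<in> V" using Cons.hyps(1) l by simp
    let ?l = "letter_value G e l"
    have lc: "?l \<in> carrier G" using Cons.hyps(1) e_funcset by (rule letter_value_closed[rotated])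
    have Rc: "?wv R \<in> carrier G" by (rule word_value_closed[OF id_X R(1)])
    have hc: "h \<in> carrier G" using H_carrier R(2) .
    show ?case
    proof (cases "u = v")
      case True
      have "?l = letter_value G (\<lambda>x. x) (e v, b)" by (simp add: l True letter_value_def)
      then have "word_value G e (l # w) = ?wv ((e v, b) # R) \<otimes> h"
        using R(3) lc Rc hc by (simp add: m_assoc)
      moreover have "(e v, b) # R \<in> gwords X" using e_v_in_X R(1) by auto
      ultimately show ?thesis using R(2) by blast
    next
      case False
      have lH: "?l \<in> H"
        using e_in_H[OF u False] subgroup.m_inv_closed[OF H_subgroup] by (simp add: l letter_value_def)
      have "?wv (rename (inner ?l) R) = inner ?l (?wv R)"
        using word_value_hom[OF is_group is_group inner_hom[OF lc] id_X R(1)]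
        by (simp add: word_value_rename)
      moreover have "?l \<otimes> (?wv R \<otimes> h) = ?l \<otimes> ?wv R \<otimes> inv ?l \<otimes> (?l \<otimes> h)"
      proof -
        have "inv ?l \<otimes> (?l \<otimes> h) = h" using lc hc by (simp add: m_assoc[symmetric])
        then show ?thesis using lc Rc hc by (simp add: m_assoc)
      qed
      ultimately have "word_value G e (l # w) = ?wv (rename (inner ?l) R) \<otimes> (?l \<otimes> h)"
        using R(3) Rc by (simp add: inner_apply)
      moreover have "rename (inner ?l) R \<in> gwords X"
        using rename_closed[of "inner ?l" X X] inner_X[OF lH] R(1) by blast
      moreover have "?l \<otimes> h \<in> H" using subgroup.m_closed[OF H_subgroup lH R(2)] .
      ultimately show ?thesis by blast
    qed
  qed
  moreover obtain w where "w \<in> gwords V" "g = word_value G e w"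
    using assms by (rule word_exists)
  ultimately obtain R h where R: "R \<in> gwords X" "h \<in> H" "g = ?wv R \<otimes> h" by blast
  have "?wv (foldr push R []) = ?wv R" by (rule word_value_reduce[OF id_X R(1)])
  then show ?thesis
    using R foldr_push_reduced_words[OF R(1)] by metis
qed

end

lemma foldr_push_hd:
  assumes "reduced R" "R \<noteq> []"
  shows "foldr push R [l] = [] \<or> hd (foldr push R [l]) = hd R"
  using assms(2,1)
proof (induction R rule: list_nonempty_induct)
  case (single m)
  then show ?case by (simp add: push_def)
next
  case (cons m R)
  then show ?case by (auto simp: reduced_Cons push_def)
qed

context raag_vertex
begin

lemma X_two: "\<exists>x \<in> X. x \<noteq> e v"
proof -
  obtain u where u: "u \<in> V" "u \<noteq> v" "{u, v} \<notin> E"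
    using not_cone_vertex[OF v] by blast
  have "inner (e u) (e v) \<in> X"
    by (rule inner_X[OF e_in_H[OF u(1,2)] e_v_in_X])
  moreover have "inner (e u) (e v) \<noteq> e v"
    using nonadjacent_not_commute[of u v] u v by (simp add: inner_eq_iff)
  ultimately show ?thesis by blast
qed

lemma \<Phi>_H_Nil: "h \<in> H \<Longrightarrow> \<Phi> h [] = []"
  by (simp add: \<Phi>_H)

text \<open>
Write \<open>g = R h\<close> with a nonempty reduced word \<open>R\<close>, and let \<open>x \<in> X\<close> differ from the first basis element of
\<open>R\<close>. Then \<open>x g\<close> moves the empty word to \<open>x R\<close>, beginning with \<open>x\<close>, whereas \<open>g x\<close> moves it to \<open>R (h x h\<inverse>)\<close>,
which begins with the first letter of \<open>R\<close> or is empty.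
\<close>

lemma not_commute_X:
  assumes "g \<in> carrier G" "g \<notin> H"
  shows "\<exists>x \<in> X. g \<otimes> x \<noteq> x \<otimes> g"
proof (rule ccontr)
  assume "\<not> ?thesis"
  then have comm: "g \<otimes> x = x \<otimes> g" if "x \<in> X" for x using that by blast
  obtain R h where R: "R \<in> \<Omega>" and h: "h \<in> H" and g: "g = word_value G (\<lambda>x. x) R \<otimes> h"
    using decomposition[OF assms(1)] by blast
  have hc: "h \<in> carrier G" and Rw: "R \<in> gwords X" and red: "reduced R"
    using h H_carrier R by (auto simp: reduced_words_def)
  have "R \<noteq> []" using assms(2) h g hc by auto
  obtain x where x: "x \<in> X" "(x, False) \<noteq> hd R" "(x, True) \<noteq> hd R"
    using X_two e_v_in_X by (metis fst_conv)
  have act: "\<Phi> g w = foldr push R (rename (inner h) w)" if "w \<in> \<Omega>" for w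
    unfolding g using composition_rule[OF that word_value_closed[OF id_X Rw] hc] \<Phi>_H[OF h that]
      word_action(1)[OF Rw rename_inner_\<Omega>[OF h that]] by simp
  have x\<Omega>: "[(x, True)] \<in> \<Omega>" using x(1) by (auto simp: reduced_words_def)
  have "\<Phi> (x \<otimes> g) [] = (x, True) # R"
    using composition_rule[OF Nil_in_reduced_words X_carrier[OF x(1)] assms(1)] act[of "[]"]
      foldr_push_reduced[OF red] \<Phi>_X[OF x(1) R] x(2) by (auto simp: push_def)
  moreover have "\<Phi> (g \<otimes> x) [] = foldr push R [(inner h x, True)]"
    using composition_rule[OF Nil_in_reduced_words assms(1) X_carrier[OF x(1)]]
      \<Phi>_X[OF x(1), of "[]"] act[OF x\<Omega>] by (simp add: push_def)
  ultimately show False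
    using comm[OF x(1)] foldr_push_hd[OF red \<open>R \<noteq> []\<close>] x(3) by (metis list.distinct(1) list.sel(1))
qed

text \<open>
With \<open>g = R h\<close>, the commutator \<open>[g, x]\<close> is the value of the word \<open>R (h x h\<inverse>) R\<inverse> x\<inverse>\<close> over \<open>X\<close>, so it lies in
the free normal closure of \<open>v\<close>. An element whose conjugation is trivial commutes with \<open>X\<close>, hence it
belongs to \<open>H\<close> and fixes the empty word.
\<close>

lemma inner_normal_full_sized:
  assumes N: "N \<lhd> AutoGroup G" and g: "g \<in> carrier G" "g \<notin> H" "inner g \<in> N"
  shows "full_sized ((AutoGroup G)\<lparr>carrier := N\<rparr>)"
proof -
  let ?A = "AutoGroup G"
  interpret A: group ?A by (rule AutoGroup)
  interpret inner: group_hom G ?A inner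
    using inner_hom_AutoGroup by unfold_locales
  obtain x where x: "x \<in> X" "g \<otimes> x \<noteq> x \<otimes> g" using not_commute_X[OF g(1,2)] by blast
  have xc: "x \<in> carrier G" using X_carrier x(1) .
  obtain x' where x': "x' \<in> X" "x' \<noteq> e v" using X_two by blast
  obtain R h where R: "R \<in> \<Omega>" and h: "h \<in> H" and gk: "g = word_value G (\<lambda>x. x) R \<otimes> h"
    using decomposition[OF g(1)] by blast
  let ?k = "word_value G (\<lambda>x. x) R"
  have hc: "h \<in> carrier G" and Rw: "R \<in> gwords X"
    using h H_carrier R by (auto simp: reduced_words_def)
  have kc: "?k \<in> carrier G" by (rule word_value_closed[OF id_X Rw])
  have hx: "inner h x \<in> X" by (rule inner_X[OF h x(1)])
  let ?u = "(inner h x, True) # inverse_word R @ [(x, False)]"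
  have w: "[(x, False)] \<in> gwords X" "inverse_word R \<in> gwords X" "?u \<in> gwords X" "R @ ?u \<in> gwords X"
    using x(1) hx Rw by auto
  have "word_value G (\<lambda>x. x) (R @ ?u) = ?k \<otimes> (inner h x \<otimes> (inv ?k \<otimes> inv x))"
    using word_value_append[OF id_X Rw w(3)] word_value_append[OF id_X w(2,1)]
      word_value_inverse[OF id_X Rw] xc by (simp add: letter_value_def)
  also have "\<dots> = g \<otimes> x \<otimes> inv g \<otimes> inv x"
    using kc hc xc by (simp add: gk inner_apply inv_mult_group m_assoc)
  finally have y: "word_value G (\<lambda>x. x) (R @ ?u) = g \<otimes> x \<otimes> inv g \<otimes> inv x" .
  have y1: "g \<otimes> x \<otimes> inv g \<otimes> inv x \<noteq> \<one>"
  proof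
    assume "g \<otimes> x \<otimes> inv g \<otimes> inv x = \<one>"
    then have "g \<otimes> x \<otimes> inv g = x"
      using g(1) xc by (metis inv_closed inv_equality inv_inv m_closed)
    then show False using inner_eq_iff[OF g(1) xc] x(2) by (simp add: inner_apply xc)
  qed
  have "inner x \<otimes>\<^bsub>?A\<^esub> inv\<^bsub>?A\<^esub> inner g \<otimes>\<^bsub>?A\<^esub> inv\<^bsub>?A\<^esub> inner x \<in> N"
    using normal.inv_op_closed2[OF N] subgroup.m_inv_closed[OF normal_imp_subgroup[OF N] g(3)]
      inner.hom_closed[OF xc] by blast
  from subgroup.m_closed[OF normal_imp_subgroup[OF N] g(3) this]
  have yN: "inner (g \<otimes> x \<otimes> inv g \<otimes> inv x) \<in> N"
    using g(1) xc by (simp add: A.m_assoc)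
  show ?thesis
  proof (rule normal_subgroup_full_sized[OF A.is_group inner_hom_AutoGroup N _ e_v_in_X x'(1)])
    show "R @ ?u \<in> gwords X" by (rule w)
    show "word_value G (\<lambda>x. x) (R @ ?u) \<noteq> \<one>" "inner (word_value G (\<lambda>x. x) (R @ ?u)) \<in> N"
      unfolding y by (fact y1, fact yN)
    show "e v \<noteq> x'" using x'(2) by simp
    fix z assume z: "z \<in> carrier G" "inner z = \<one>\<^bsub>?A\<^esub>"
    then have "inner z x = x" if "x \<in> carrier G" for x
      using that by (simp add: AutoGroup_def BijGroup_def)
    then have "z \<in> H"
      using not_commute_X[OF z(1)] inner_eq_iff[OF z(1)] X_carrier by metis
    then show "\<Phi> z [] = []" by (rule \<Phi>_H_Nil)
  qed
qed

end

context raag_graph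
begin

definition retraction :: "'v set \<Rightarrow> 'v gword set \<Rightarrow> 'v gword set" where
  "retraction S = (SOME f. f \<in> hom G G \<and> (\<forall>u \<in> V. f (e u) = (if u \<in> S then e u else \<one>)))"

lemma retraction: "retraction S \<in> hom G G"
  "u \<in> V \<Longrightarrow> retraction S (e u) = (if u \<in> S then e u else \<one>)"
proof -
  have "\<exists>f \<in> hom G G. \<forall>u \<in> V. f (e u) = (if u \<in> S then e u else \<one>)"
  proof (rule lift[OF is_group])
    fix u w assume "{u, w} \<in> E"
    then show "(if u \<in> S then e u else \<one>) \<otimes> (if w \<in> S then e w else \<one>) =
        (if w \<in> S then e w else \<one>) \<otimes> (if u \<in> S then e u else \<one>)"
      using edgeD[of u w] e_commute[of u w] by simp
  qed auto
  then have "\<exists>f. f \<in> hom G G \<and> (\<forall>u \<in> V. f (e u) = (if u \<in> S then e u else \<one>))" by blast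
  from someI_ex[OF this]
  show "retraction S \<in> hom G G" "u \<in> V \<Longrightarrow> retraction S (e u) = (if u \<in> S then e u else \<one>)"
    unfolding retraction_def by blast+
qed

lemma retraction_generate:
  assumes "S \<subseteq> V" "x \<in> generate G (e ` S)"
  shows "retraction S x = x"
proof -
  interpret r: group_hom G G "retraction S"
    using retraction(1) by unfold_locales
  have c: "generate G (e ` S) \<subseteq> carrier G"
    using assms(1) by (intro generate_incl) auto
  show ?thesis
    using assms(2)
  proof (induction rule: generate.induct)
    case (incl h)
    then show ?case using retraction(2) assms(1) by auto
  next
    case (inv h)
    then obtain u where "h = e u" "u \<in> S" "u \<in> V" using assms(1) by auto
    then show ?case using retraction(2) by simp
  next
    case (eng h k)
    then have "h \<in> carrier G" "k \<in> carrier G" using c by auto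
    then show ?case using eng.IH by simp
  qed simp
qed

lemma retraction_retraction:
  assumes "x \<in> carrier G"
  shows "retraction S (retraction S' x) = retraction (S \<inter> S') x"
proof -
  have one: "retraction S \<one> = \<one>"
    by (rule hom_one[OF retraction(1) is_group is_group])
  have "retraction S \<circ> retraction S' \<in> hom G G"
    by (rule Group.hom_compose[OF retraction(1) retraction(1)])
  from hom_eqI[OF is_group this retraction(1) _ assms, of "S \<inter> S'"] show ?thesis
    using one by (simp add: retraction(2))
qed

text \<open>
Each of the hypotheses says that \<open>g\<close> is fixed when the single vertex \<open>v\<close> is killed. Killing all
non-cone vertices, one after the other, therefore fixes \<open>g\<close> and maps it into \<open>Z\<close>.
\<close>

lemma in_Z_if_in_all:
  assumes g: "g \<in> carrier G" "\<And>v. v \<in> V - D \<Longrightarrow> g \<in> generate G (e ` (V - {v}))"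
  shows "g \<in> Z"
proof -
  have "retraction (V - F) g = g" if "finite F" "F \<subseteq> V - D" for F
    using that
  proof (induction rule: finite_induct)
    case empty
    have "id g = retraction V g"
      by (rule hom_eqI[OF is_group _ retraction(1) _ g(1)]) (auto simp: retraction(2) hom_def)
    then show ?case by simp
  next
    case (insert v F)
    have "V - insert v F = (V - {v}) \<inter> (V - F)" by auto
    then have "retraction (V - insert v F) g = retraction (V - {v}) (retraction (V - F) g)"
      using retraction_retraction[OF g(1)] by simp
    also have "\<dots> = g"
      using insert g(2) by (simp add: retraction_generate)
    finally show ?case .
  qed
  from this[of "V - D"] have "retraction D g = g"
    using finite_V D_subset by (simp add: double_diff)
  moreover have "retraction D g \<in> Z"
  proof -
    obtain w where w: "w \<in> gwords V" "g = word_value G e w"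
      using g(1) by (rule word_exists)
    have "(\<lambda>a. retraction D (e a)) \<in> V \<rightarrow> Z"
      using e_in_Z subgroup.one_closed[OF Z_subgroup] by (simp add: retraction(2))
    then show ?thesis
      unfolding w(2) word_value_hom[OF is_group is_group retraction(1) e_funcset w(1)]
      using w(1) by (intro word_value_in_subgroup[OF Z_subgroup])
  qed
  ultimately show ?thesis by simp
qed

lemma not_in_Z:
  assumes "g \<in> carrier G" "g \<notin> Z"
  obtains v where "raag_vertex V E G v" "g \<notin> raag_vertex.H V E G v"
proof -
  obtain v where v: "v \<in> V - D" "g \<notin> generate G (e ` (V - {v}))"
    using in_Z_if_in_all assms by blast
  interpret vertex: raag_vertex V E G v using v(1) by unfold_locales
  have "g \<notin> vertex.H" using v(2) by (simp add: vertex.H_def)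
  then show ?thesis using that vertex.raag_vertex_axioms by blast
qed

lemma Z_eq_center: "Z = {z \<in> carrier G. \<forall>x \<in> carrier G. x \<otimes> z = z \<otimes> x}"
proof (intro equalityI subsetI)
  fix z assume "z \<in> Z"
  then show "z \<in> {z \<in> carrier G. \<forall>x \<in> carrier G. x \<otimes> z = z \<otimes> x}"
    using Z_central Z_carrier by blast
next
  fix z assume z: "z \<in> {z \<in> carrier G. \<forall>x \<in> carrier G. x \<otimes> z = z \<otimes> x}"
  show "z \<in> Z"
  proof (rule ccontr)
    assume "z \<notin> Z"
    then obtain v where v: "raag_vertex V E G v" "z \<notin> raag_vertex.H V E G v"
      using z not_in_Z by blast
    interpret vertex: raag_vertex V E G v by (rule v(1))
    show False using vertex.not_commute_X[of z] v(2) z vertex.X_carrier by blast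
  qed
qed

theorem inner_full_sized:
  assumes "N \<lhd> AutoGroup G" "g \<in> carrier G" "g \<notin> Z" "inner g \<in> N"
  shows "full_sized ((AutoGroup G)\<lparr>carrier := N\<rparr>)"
proof -
  obtain v where v: "raag_vertex V E G v" "g \<notin> raag_vertex.H V E G v"
    using assms(2,3) not_in_Z by blast
  interpret vertex: raag_vertex V E G v by (rule v(1))
  show ?thesis by (rule vertex.inner_normal_full_sized[OF assms(1,2) v(2) assms(4)])
qed

end

section \<open>Automorphisms and exponent sums\<close>

context group
begin

lemma carrier_AutoGroup: "carrier (AutoGroup G) = auto G"
  by (simp add: AutoGroup_def)

lemma auto_hom: "f \<in> auto G \<Longrightarrow> f \<in> hom G G"
  by (simp add: auto_def)

lemma auto_closed: "f \<in> auto G \<Longrightarrow> x \<in> carrier G \<Longrightarrow> f x \<in> carrier G"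
  using auto_hom hom_in_carrier by metis

lemma auto_mult: "f \<in> auto G \<Longrightarrow> x \<in> carrier G \<Longrightarrow> y \<in> carrier G \<Longrightarrow> f (x \<otimes> y) = f x \<otimes> f y"
  using auto_hom hom_mult by metis

lemma auto_inv: "f \<in> auto G \<Longrightarrow> x \<in> carrier G \<Longrightarrow> f (inv x) = inv (f x)"
  using auto_hom group_hom.hom_inv[of G G f] by (simp add: group_hom_def group_hom_axioms_def)

lemma auto_int_pow: "f \<in> auto G \<Longrightarrow> x \<in> carrier G \<Longrightarrow> f (x [^] (k :: int)) = f x [^] k"
  using auto_hom hom_int_pow is_group by metis

lemma AutoGroup_mult: "f \<in> auto G \<Longrightarrow> g \<in> auto G \<Longrightarrow> x \<in> carrier G \<Longrightarrow>
    (f \<otimes>\<^bsub>AutoGroup G\<^esub> g) x = f (g x)"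
  by (simp add: AutoGroup_def BijGroup_def auto_def compose_eq)

lemma AutoGroup_one: "x \<in> carrier G \<Longrightarrow> \<one>\<^bsub>AutoGroup G\<^esub> x = x"
  by (simp add: AutoGroup_def BijGroup_def)

lemma AutoGroup_inv_closed: "f \<in> auto G \<Longrightarrow> inv\<^bsub>AutoGroup G\<^esub> f \<in> auto G"
  using group.inv_closed[OF AutoGroup] carrier_AutoGroup by metis

lemma AutoGroup_mult_closed: "f \<in> auto G \<Longrightarrow> g \<in> auto G \<Longrightarrow> f \<otimes>\<^bsub>AutoGroup G\<^esub> g \<in> auto G"
  using monoid.m_closed[OF group.is_monoid[OF AutoGroup]] carrier_AutoGroup by metis

lemma AutoGroup_inv_cancel:
  assumes "f \<in> auto G" "x \<in> carrier G"
  shows "(inv\<^bsub>AutoGroup G\<^esub> f) (f x) = x" "f ((inv\<^bsub>AutoGroup G\<^esub> f) x) = x"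
proof -
  interpret A: group "AutoGroup G" by (rule AutoGroup)
  have f: "f \<in> carrier (AutoGroup G)" using assms(1) carrier_AutoGroup by simp
  show "(inv\<^bsub>AutoGroup G\<^esub> f) (f x) = x"
    using AutoGroup_mult[OF AutoGroup_inv_closed[OF assms(1)] assms] A.l_inv[OF f] AutoGroup_one[OF assms(2)]
    by simp
  show "f ((inv\<^bsub>AutoGroup G\<^esub> f) x) = x"
    using AutoGroup_mult[OF assms(1) AutoGroup_inv_closed[OF assms(1)] assms(2)] A.r_inv[OF f]
      AutoGroup_one[OF assms(2)] by simp
qed

lemma auto_eqI:
  assumes "f \<in> auto G" "g \<in> auto G" "\<And>x. x \<in> carrier G \<Longrightarrow> f x = g x"
  shows "f = g"
  using assms by (intro extensionalityI[of f "carrier G" g]) (auto simp: auto_def Bij_def)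

lemma AutoGroup_action: "group_action (AutoGroup G) (carrier G) (\<lambda>f. f)"
  by (rule group_actionI[OF AutoGroup]) (auto simp: hom_def AutoGroup_def BijGroup_def auto_def)

lemma AutoGroup_conj_inner:
  assumes "f \<in> auto G" "x \<in> carrier G"
  shows "f \<otimes>\<^bsub>AutoGroup G\<^esub> inner x \<otimes>\<^bsub>AutoGroup G\<^esub> inv\<^bsub>AutoGroup G\<^esub> f = inner (f x)"
proof (rule auto_eqI)
  note fi = AutoGroup_inv_closed[OF assms(1)]
  show "inner (f x) \<in> auto G"
    using inner_auto auto_closed[OF assms] by blast
  show "f \<otimes>\<^bsub>AutoGroup G\<^esub> inner x \<otimes>\<^bsub>AutoGroup G\<^esub> inv\<^bsub>AutoGroup G\<^esub> f \<in> auto G"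
    using assms inner_auto fi by (simp add: AutoGroup_mult_closed)
  fix y assume y: "y \<in> carrier G"
  then have "(f \<otimes>\<^bsub>AutoGroup G\<^esub> inner x \<otimes>\<^bsub>AutoGroup G\<^esub> inv\<^bsub>AutoGroup G\<^esub> f) y =
      f (inner x ((inv\<^bsub>AutoGroup G\<^esub> f) y))"
    using assms inner_auto fi auto_closed[OF fi y]
    by (simp add: AutoGroup_mult AutoGroup_mult_closed)
  also have "\<dots> = inner (f x) y"
    using assms y auto_closed[OF fi y] AutoGroup_inv_cancel(2)[OF assms(1) y]
    by (simp add: inner_apply auto_mult auto_inv auto_closed)
  finally show "(f \<otimes>\<^bsub>AutoGroup G\<^esub> inner x \<otimes>\<^bsub>AutoGroup G\<^esub> inv\<^bsub>AutoGroup G\<^esub> f) y = inner (f x) y" .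
qed

text \<open>
For a homomorphism \<open>\<zeta>\<close> into the center this is an endomorphism. Transvections, the inversion of the cone
vertices and the elements of \<open>T_cone\<close> are all of this form.
\<close>

definition shear :: "('a \<Rightarrow> 'a) \<Rightarrow> 'a \<Rightarrow> 'a" where
  "shear \<zeta> = (\<lambda>x \<in> carrier G. x \<otimes> \<zeta> x)"

lemma shear_apply: "x \<in> carrier G \<Longrightarrow> shear \<zeta> x = x \<otimes> \<zeta> x"
  by (simp add: shear_def)

lemma shear_hom:
  assumes "\<zeta> \<in> hom G G" "\<And>x y. x \<in> carrier G \<Longrightarrow> y \<in> carrier G \<Longrightarrow> \<zeta> x \<otimes> y = y \<otimes> \<zeta> x"
  shows "shear \<zeta> \<in> hom G G"
proof (rule homI)
  have c: "\<zeta> x \<in> carrier G" if "x \<in> carrier G" for x using hom_in_carrier[OF assms(1) that] .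
  show "shear \<zeta> x \<in> carrier G" if "x \<in> carrier G" for x
    using that c by (simp add: shear_apply)
  fix x y assume xy: "x \<in> carrier G" "y \<in> carrier G"
  have "x \<otimes> y \<otimes> (\<zeta> x \<otimes> \<zeta> y) = x \<otimes> (y \<otimes> \<zeta> x) \<otimes> \<zeta> y"
    using xy c by (simp add: m_assoc)
  also have "\<dots> = x \<otimes> \<zeta> x \<otimes> (y \<otimes> \<zeta> y)"
    using xy c assms(2)[OF xy, symmetric] by (simp add: m_assoc)
  finally show "shear \<zeta> (x \<otimes> y) = shear \<zeta> x \<otimes> shear \<zeta> y"
    using xy hom_mult[OF assms(1) xy] by (simp add: shear_apply)
qed

text \<open>
The hypotheses on \<open>\<zeta>'\<close> say that \<open>shear \<zeta>'\<close> is inverse to \<open>shear \<zeta>\<close>.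
\<close>

lemma shear_auto:
  assumes "\<zeta> \<in> hom G G" "\<And>x y. x \<in> carrier G \<Longrightarrow> y \<in> carrier G \<Longrightarrow> \<zeta> x \<otimes> y = y \<otimes> \<zeta> x"
    and "\<zeta>' \<in> carrier G \<rightarrow> carrier G"
    and "\<And>x. x \<in> carrier G \<Longrightarrow> \<zeta>' (x \<otimes> \<zeta> x) = inv (\<zeta> x)"
    and "\<And>x. x \<in> carrier G \<Longrightarrow> \<zeta> (x \<otimes> \<zeta>' x) = inv (\<zeta>' x)"
  shows "shear \<zeta> \<in> auto G"
proof -
  have c: "\<zeta> x \<in> carrier G" "\<zeta>' x \<in> carrier G" if "x \<in> carrier G" for x
    using hom_in_carrier[OF assms(1) that] assms(3) that by auto
  have "bij_betw (shear \<zeta>) (carrier G) (carrier G)"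
    by (rule bij_betw_byWitness[where f' = "shear \<zeta>'"])
      (auto simp: shear_apply c assms(4,5) m_assoc)
  then show ?thesis
    using shear_hom[OF assms(1,2)] by (simp add: auto_def Bij_def shear_def)
qed

end

context raag_graph
begin

abbreviation A :: "('v gword set \<Rightarrow> 'v gword set) monoid" where "A \<equiv> AutoGroup G"

abbreviation aut_comp :: "('v gword set \<Rightarrow> 'v gword set) \<Rightarrow> ('v gword set \<Rightarrow> 'v gword set) \<Rightarrow>
    'v gword set \<Rightarrow> 'v gword set" (infixl \<open>\<star>\<close> 70) where
  "f \<star> g \<equiv> f \<otimes>\<^bsub>A\<^esub> g"

lemma auto_Z: "f \<in> auto G \<Longrightarrow> z \<in> Z \<Longrightarrow> f z \<in> Z"
proof -
  assume f: "f \<in> auto G" and z: "z \<in> Z"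
  have zc: "z \<in> carrier G" by (rule Z_carrier[OF z])
  have "x \<otimes> f z = f z \<otimes> x" if x: "x \<in> carrier G" for x
  proof -
    let ?x = "(inv\<^bsub>A\<^esub> f) x"
    have x': "?x \<in> carrier G" using auto_closed[OF AutoGroup_inv_closed[OF f] x] .
    then have "f ?x \<otimes> f z = f z \<otimes> f ?x"
      using Z_central[OF z x'] auto_mult[OF f x' zc] auto_mult[OF f zc x'] by simp
    then show ?thesis using AutoGroup_inv_cancel(2)[OF f x] by simp
  qed
  then show ?thesis unfolding Z_eq_center using auto_closed[OF f zc] by simp
qed

text \<open>
If \<open>g = f(x) x\<inverse>\<close>, then conjugation by \<open>g\<close> is the commutator of \<open>f\<close> and conjugation by \<open>x\<close>, so it belongs to
\<open>N\<close>; by \<open>inner_full_sized\<close> this forces \<open>g \<in> Z\<close>, and then \<open>g = x\<inverse> g x = x\<inverse> f(x)\<close>.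
\<close>

lemma displacement_in_Z:
  assumes N: "N \<lhd> A" "\<not> full_sized (A\<lparr>carrier := N\<rparr>)" and f: "f \<in> N" and x: "x \<in> carrier G"
  shows "inv x \<otimes> f x \<in> Z"
proof -
  interpret A: group A by (rule AutoGroup)
  have fa: "f \<in> auto G"
    using subgroup.subset[OF normal_imp_subgroup[OF N(1)]] f carrier_AutoGroup by blast
  interpret inner: group_hom G A inner using inner_hom_AutoGroup by unfold_locales
  have fx: "f x \<in> carrier G" by (rule auto_closed[OF fa x])
  have fA: "f \<in> carrier A" "inner x \<in> carrier A" using fa inner_auto[OF x] carrier_AutoGroup by auto
  have "inner x \<star> inv\<^bsub>A\<^esub> f \<star> inv\<^bsub>A\<^esub> inner x \<in> N"
    using normal.inv_op_closed2[OF N(1) fA(2)] subgroup.m_inv_closed[OF normal_imp_subgroup[OF N(1)] f]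
    by blast
  from subgroup.m_closed[OF normal_imp_subgroup[OF N(1)] f this]
  have "f \<star> inner x \<star> inv\<^bsub>A\<^esub> f \<star> inv\<^bsub>A\<^esub> inner x \<in> N"
    using fA by (simp add: A.m_assoc)
  then have "inner (f x \<otimes> inv x) \<in> N"
    using fx x by (simp add: AutoGroup_conj_inner[OF fa x])
  then have z: "f x \<otimes> inv x \<in> Z"
    using inner_full_sized[OF N(1)] N(2) fx x by blast
  have "inv x \<otimes> f x = inv x \<otimes> (f x \<otimes> inv x) \<otimes> x"
    using fx x by (simp add: m_assoc)
  also have "\<dots> = f x \<otimes> inv x"
    using Z_central[OF z, of "inv x"] fx x by (simp add: m_assoc)
  finally show ?thesis using z by simp
qed

text \<open>
The exponent sum of the generator \<open>u\<close>.
\<close>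

definition deg :: "'v \<Rightarrow> 'v gword set \<Rightarrow> int" where
  "deg u = (SOME f. f \<in> hom G integer_group \<and> (\<forall>w \<in> V. f (e w) = (if w = u then 1 else 0)))"

lemma deg_hom: "deg u \<in> hom G integer_group"
  and deg_e: "w \<in> V \<Longrightarrow> deg u (e w) = (if w = u then 1 else 0)"
proof -
  have "\<exists>f \<in> hom G integer_group. \<forall>w \<in> V. f (e w) = (if w = u then 1 else 0)"
    by (rule lift) auto
  then have "\<exists>f. f \<in> hom G integer_group \<and> (\<forall>w \<in> V. f (e w) = (if w = u then 1 else 0))" by blast
  from someI_ex[OF this]
  show "deg u \<in> hom G integer_group" "w \<in> V \<Longrightarrow> deg u (e w) = (if w = u then 1 else 0)"
    unfolding deg_def by blast+
qed

lemma int_hom_simps: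
  assumes "\<phi> \<in> hom G integer_group" "x \<in> carrier G"
  shows "y \<in> carrier G \<Longrightarrow> \<phi> (x \<otimes> y) = \<phi> x + \<phi> y" "\<phi> \<one> = 0" "\<phi> (inv x) = - \<phi> x"
    "\<phi> (x [^] (k :: int)) = k * \<phi> x"
proof -
  interpret h: group_hom G integer_group \<phi>
    using assms(1) by (simp add: group_hom_def group_hom_axioms_def)
  show "y \<in> carrier G \<Longrightarrow> \<phi> (x \<otimes> y) = \<phi> x + \<phi> y" "\<phi> \<one> = 0" "\<phi> (inv x) = - \<phi> x"
    "\<phi> (x [^] (k :: int)) = k * \<phi> x"
    using assms(2) h.hom_one h.hom_inv[of x] h.hom_int_pow[of x k] by simp_all
qed

lemmas deg_simps = int_hom_simps[OF deg_hom]

lemma Z_comm_group: "comm_group (G\<lparr>carrier := Z\<rparr>)"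
  using Z_central Z_carrier
  by (intro group.group_comm_groupI[OF subgroup_imp_group[OF Z_subgroup]]) auto

lemma Z_m_closed: "x \<in> Z \<Longrightarrow> y \<in> Z \<Longrightarrow> x \<otimes> y \<in> Z"
  by (rule subgroup.m_closed[OF Z_subgroup])

lemma Z_inv_closed: "x \<in> Z \<Longrightarrow> inv x \<in> Z"
  by (rule subgroup.m_inv_closed[OF Z_subgroup])

lemma Z_pow_closed: "x \<in> Z \<Longrightarrow> x [^] (k :: int) \<in> Z"
  by (rule subgroup_int_pow_closed[OF Z_subgroup])

definition zprod :: "('v \<Rightarrow> int) \<Rightarrow> 'v gword set" where
  "zprod k = finprod (G\<lparr>carrier := Z\<rparr>) (\<lambda>v. e v [^] k v) D"

interpretation ZG: comm_group "G\<lparr>carrier := Z\<rparr>"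
  by (rule Z_comm_group)

lemma zprod_Z: "zprod k \<in> Z"
  unfolding zprod_def using ZG.finprod_closed[of "\<lambda>v. e v [^] k v" D] e_in_Z Z_pow_closed by auto

lemma zprod_carrier [simp]: "zprod k \<in> carrier G"
  using zprod_Z Z_carrier by blast

lemma zprod_add: "zprod (\<lambda>v. k v + l v) = zprod k \<otimes> zprod l"
proof -
  have "zprod (\<lambda>v. k v + l v) = finprod (G\<lparr>carrier := Z\<rparr>) (\<lambda>v. e v [^] k v \<otimes> e v [^] l v) D"
    unfolding zprod_def using D_subset e_in_Z Z_pow_closed
    by (intro ZG.finprod_cong') (auto simp: int_pow_mult[symmetric] intro!: Z_m_closed)
  also have "\<dots> = zprod k \<otimes> zprod l"
    unfolding zprod_def using ZG.finprod_multf[of "\<lambda>v. e v [^] k v" D "\<lambda>v. e v [^] l v"] e_in_Z Z_pow_closed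
    by auto
  finally show ?thesis .
qed

lemma zprod_zero: "zprod (\<lambda>v. 0) = \<one>"
  unfolding zprod_def using ZG.finprod_one_eqI[of D "\<lambda>v. \<one>"] by simp

lemma zprod_uminus: "zprod (\<lambda>v. - k v) = inv (zprod k)"
proof -
  have "zprod (\<lambda>v. - k v) \<otimes> zprod k = \<one>"
    using zprod_add[of "\<lambda>v. - k v" k] zprod_zero by simp
  then show ?thesis by (intro inv_equality[symmetric]) simp_all
qed

lemma zprod_cong: "(\<And>v. v \<in> D \<Longrightarrow> k v = l v) \<Longrightarrow> zprod k = zprod l"
  unfolding zprod_def using e_in_Z Z_pow_closed
  by (intro ZG.finprod_cong') auto

lemma deg_zprod:
  assumes "u \<in> D"
  shows "deg u (zprod k) = k u"
proof -
  have "deg u (finprod (G\<lparr>carrier := Z\<rparr>) (\<lambda>v. e v [^] k v) S) = (if u \<in> S then k u else 0)"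
    if "finite S" "S \<subseteq> D" for S
    using that
  proof (induction rule: finite_induct)
    case empty
    then show ?case using deg_simps(2)[OF one_closed] by simp
  next
    case (insert v S)
    have v: "v \<in> V" "e v [^] k v \<in> Z" using insert.prems D_subset e_in_Z Z_pow_closed by auto
    have f: "(\<lambda>v. e v [^] k v) \<in> S \<rightarrow> carrier (G\<lparr>carrier := Z\<rparr>)"
      using insert.prems e_in_Z Z_pow_closed by auto
    have "finprod (G\<lparr>carrier := Z\<rparr>) (\<lambda>v. e v [^] k v) S \<in> carrier G"
      using ZG.finprod_closed[OF f] Z_carrier by simp
    then show ?case
      using insert v f Z_carrier[OF v(2)] by (auto simp: deg_simps deg_e)
  qed
  then show ?thesis
    unfolding zprod_def using finite_subset[OF D_subset finite_V] assms by simp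
qed

text \<open>
Together with \<open>deg_zprod\<close>, this identifies \<open>Z\<close> with the integer vectors indexed by the cone vertices.
\<close>

lemma zprod_deg:
  assumes "z \<in> Z"
  shows "zprod (\<lambda>v. deg v z) = z"
  using assms[unfolded cone_subgroup_def G_eq[symmetric]]
proof (induction rule: generate.induct)
  case one
  then show ?case using deg_simps(2)[OF one_closed] zprod_zero by simp
next
  have eq: "zprod (\<lambda>v. deg v (e u)) = e u" if u: "u \<in> D" for u
  proof -
    have "zprod (\<lambda>v. deg v (e u)) = finprod (G\<lparr>carrier := Z\<rparr>) (\<lambda>v. if v = u then e v else \<one>) D"
      unfolding zprod_def using u D_subset e_in_Z subgroup.one_closed[OF Z_subgroup]
      by (intro ZG.finprod_cong') (auto simp: deg_e)
    also have "\<dots> = e u"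
      using ZG.finprod_singleton_swap[of u D e] u finite_subset[OF D_subset finite_V] e_in_Z
      by (simp add: Pi_iff cong: if_cong)
    finally show ?thesis .
  qed
  { case (incl h)
    then show ?case using eq by auto
  next
    case (inv h)
    then obtain u where u: "u \<in> D" "h = e u" by auto
    then have "u \<in> V" using D_subset by auto
    then show ?case using eq[OF u(1)] u(2) by (simp add: deg_simps zprod_uminus) }
next
  case (eng h k)
  then have "h \<in> carrier G" "k \<in> carrier G"
    using Z_carrier by (simp_all add: cone_subgroup_def G_eq[symmetric])
  then show ?case using eng.IH by (simp add: deg_simps zprod_add)
qed

lemma Z_eqI: "x \<in> Z \<Longrightarrow> y \<in> Z \<Longrightarrow> (\<And>v. v \<in> D \<Longrightarrow> deg v x = deg v y) \<Longrightarrow> x = y"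
  using zprod_deg zprod_cong[of "\<lambda>v. deg v x" "\<lambda>v. deg v y"] by metis

end

section \<open>Free groups generated by transvections\<close>

text \<open>
The ping-pong estimate for the elementary matrix that adds \<open>k * q\<close> times \<open>a\<close> to \<open>b\<close>. The letter owns the
pairs in which \<open>b\<close> dominates \<open>a\<close> by a factor \<open>M\<close> with the sign of \<open>q * a\<close>. Starting there, the added
term has the sign of \<open>b\<close>; starting where \<open>a\<close> dominates, the added term outweighs \<open>b\<close>.
\<close>

lemma shear_step_int:
  fixes a b q k M :: int
  assumes "M \<ge> 1" "k \<ge> M + 2" "q \<noteq> 0" "a \<noteq> 0"
    and "(\<bar>b\<bar> > M * \<bar>a\<bar> \<and> a * b * q > 0) \<or> \<bar>a\<bar> > M * \<bar>b\<bar>"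
  shows "\<bar>b + k * q * a\<bar> > M * \<bar>a\<bar> \<and> a * (b + k * q * a) * q > 0"
proof -
  have k: "k \<ge> 3" using assms(1,2) by linarith
  have q: "\<bar>q\<bar> \<ge> 1" using assms(3) by linarith
  have qq: "q * q * (a * a) > 0" using assms(3,4) by (simp add: zero_less_mult_iff mult_less_0_iff) linarith
  have expand: "a * (b + k * q * a) * q = a * b * q + k * (q * q * (a * a))" by (simp add: algebra_simps)
  show ?thesis
    using assms(5)
  proof
    assume b: "\<bar>b\<bar> > M * \<bar>a\<bar> \<and> a * b * q > 0"
    have pos: "a * (b + k * q * a) * q > 0"
      unfolding expand using b qq k by (simp add: add_pos_pos)
    have "b * (k * q * a) = k * (a * b * q)" by (simp add: algebra_simps)
    also have "\<dots> > 0" by (rule mult_pos_pos) (use b k in auto)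
    finally have "b * (k * q * a) > 0" .
    moreover have "\<bar>x + y\<bar> \<ge> \<bar>x\<bar>" if "x * y > 0" for x y :: int
      using that by (auto simp: zero_less_mult_iff)
    ultimately have "\<bar>b + k * q * a\<bar> \<ge> \<bar>b\<bar>" by blast
    with b pos show ?thesis by linarith
  next
    assume b: "\<bar>a\<bar> > M * \<bar>b\<bar>"
    have "M * \<bar>b\<bar> \<ge> 1 * \<bar>b\<bar>" using assms(1) by (intro mult_right_mono) auto
    then have ba: "\<bar>b\<bar> < \<bar>a\<bar>" using b by linarith
    have "(M + 2) * 1 * \<bar>a\<bar> \<le> k * \<bar>q\<bar> * \<bar>a\<bar>"
      using assms(1,2) q by (intro mult_right_mono mult_mono) auto
    then have big: "\<bar>k * q * a\<bar> \<ge> M * \<bar>a\<bar> + 2 * \<bar>a\<bar>"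
      using k by (simp add: abs_mult algebra_simps)
    have "\<bar>a * b * q\<bar> = \<bar>a\<bar> * \<bar>q\<bar> * \<bar>b\<bar>" by (simp add: abs_mult)
    also have "\<dots> \<le> \<bar>a\<bar> * \<bar>q\<bar> * (\<bar>a\<bar> * \<bar>q\<bar>)"
      using ba q mult_left_mono[of 1 "\<bar>q\<bar>" "\<bar>a\<bar>"] by (intro mult_left_mono) auto
    also have "\<dots> = q * q * (a * a)" by (simp add: algebra_simps flip: abs_mult)
    finally have "\<bar>a * b * q\<bar> \<le> q * q * (a * a)" .
    moreover have "k * (q * q * (a * a)) \<ge> 3 * (q * q * (a * a))"
      using k qq by (intro mult_right_mono) auto
    ultimately have "a * (b + k * q * a) * q > 0" unfolding expand using qq by linarith
    with big ba show ?thesis using assms(4) by linarith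
  qed
qed

text \<open>
The same estimate for the base point \<open>(p, q)\<close>, which is balanced: it belongs to none of the four sets.
The letter and its inverse correspond to \<open>r = q\<close> and \<open>r = - q\<close>.
\<close>

lemma shear_base_int:
  fixes p q k M :: int
  assumes "M \<ge> 1" "k \<ge> M + 2" "q \<noteq> 0" "p \<noteq> 0" "\<bar>r\<bar> = \<bar>q\<bar>"
  shows "\<bar>q + k * r * p\<bar> > M * \<bar>p\<bar> \<and> p * (q + k * r * p) * r > 0"
proof -
  have k: "k \<ge> 3" using assms(1,2) by linarith
  have q: "\<bar>q\<bar> \<ge> 1" "\<bar>p\<bar> \<ge> 1" using assms(3,4) by linarith+
  have r: "r = q \<or> r = -q" using assms(5) by linarith
  have "\<bar>k * r * p\<bar> = k * \<bar>q\<bar> * \<bar>p\<bar>" using k assms(5) by (simp add: abs_mult)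
  also have "\<dots> = \<bar>q\<bar> * (k * \<bar>p\<bar>)" by simp
  finally have "\<bar>q + k * r * p\<bar> \<ge> \<bar>q\<bar> * (k * \<bar>p\<bar>) - \<bar>q\<bar>" by linarith
  also have "\<bar>q\<bar> * (k * \<bar>p\<bar>) - \<bar>q\<bar> = \<bar>q\<bar> * (k * \<bar>p\<bar> - 1)" by (simp add: algebra_simps)
  finally have low: "\<bar>q\<bar> * (k * \<bar>p\<bar> - 1) \<le> \<bar>q + k * r * p\<bar>" .
  have kp: "k * \<bar>p\<bar> \<ge> (M + 2) * \<bar>p\<bar>" using assms(2) by (intro mult_right_mono) auto
  then have kp': "k * \<bar>p\<bar> - 1 > M * \<bar>p\<bar>" using q by (simp add: algebra_simps)
  have "M * \<bar>p\<bar> \<ge> 0" using assms(1) by simp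
  then have "1 * (k * \<bar>p\<bar> - 1) \<le> \<bar>q\<bar> * (k * \<bar>p\<bar> - 1)"
    using q kp' by (intro mult_right_mono) auto
  from less_le_trans[OF kp' order.trans[OF this[unfolded mult_1] low]]
  have 1: "\<bar>q + k * r * p\<bar> > M * \<bar>p\<bar>" .
  have pp: "p * p * k \<ge> \<bar>p\<bar> * 3"
  proof -
    have "p * p * k = \<bar>p\<bar> * (\<bar>p\<bar> * k)" by (simp add: abs_mult_self_eq mult.assoc[symmetric])
    also have "\<dots> \<ge> \<bar>p\<bar> * (1 * 3)" using q k by (intro mult_left_mono mult_mono) auto
    finally show ?thesis by simp
  qed
  have "p * (q + k * r * p) * r = (q * q) * (p * p * k + (if r = q then p else - p))"
    using r assms(3) by (auto simp: algebra_simps)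
  moreover have "p * p * k + (if r = q then p else - p) > 0" using pp q(2) by auto
  moreover have "q * q > 0" using assms(3) by (simp add: zero_less_mult_iff) linarith
  ultimately have "p * (q + k * r * p) * r > 0" by (simp add: zero_less_mult_iff)
  with 1 show ?thesis by blast
qed

context raag_graph
begin

definition transvection :: "'v gword set \<Rightarrow> ('v gword set \<Rightarrow> int) \<Rightarrow> 'v gword set \<Rightarrow> 'v gword set" where
  "transvection u \<phi> = shear (\<lambda>x. u [^] \<phi> x)"

lemma int_hom_scale: "\<phi> \<in> hom G integer_group \<Longrightarrow> (\<lambda>x. k * \<phi> x) \<in> hom G integer_group"
  by (rule homI) (simp_all add: int_hom_simps algebra_simps)

lemma transvection_apply: "x \<in> carrier G \<Longrightarrow> transvection u \<phi> x = x \<otimes> u [^] \<phi> x"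
  by (simp add: transvection_def shear_apply)

lemma int_hom_transvection:
  assumes "\<phi> \<in> hom G integer_group" "\<psi> \<in> hom G integer_group" "u \<in> carrier G" "x \<in> carrier G"
  shows "\<psi> (transvection u \<phi> x) = \<psi> x + \<phi> x * \<psi> u"
  using assms(3,4) by (simp add: transvection_apply int_hom_simps[OF assms(2)])

lemma transvection_auto:
  assumes "u \<in> Z" "\<phi> \<in> hom G integer_group" "\<phi> u = 0"
  shows "transvection u \<phi> \<in> auto G"
  unfolding transvection_def
proof (rule shear_auto)
  have u: "u \<in> carrier G" by (rule Z_carrier[OF assms(1)])
  show "(\<lambda>x. u [^] \<phi> x) \<in> hom G G"
    using u by (intro homI) (simp_all add: int_hom_simps[OF assms(2)] int_pow_mult)
  show "(\<lambda>x. u [^] - \<phi> x) \<in> carrier G \<rightarrow> carrier G" using u by simp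
  fix x assume x: "x \<in> carrier G"
  show "u [^] \<phi> x \<otimes> y = y \<otimes> u [^] \<phi> x" if "y \<in> carrier G" for y
    using Z_central[OF Z_pow_closed[OF assms(1)] that] by simp
  show "u [^] - \<phi> (x \<otimes> u [^] \<phi> x) = inv (u [^] \<phi> x)"
    "u [^] \<phi> (x \<otimes> u [^] - \<phi> x) = inv (u [^] - \<phi> x)"
    using x u assms(3) by (simp_all add: int_hom_simps[OF assms(2)] int_pow_neg)
qed

lemma transvection_inv:
  assumes "u \<in> Z" "\<phi> \<in> hom G integer_group" "\<phi> u = 0"
  shows "inv\<^bsub>A\<^esub> (transvection u \<phi>) = transvection u (\<lambda>x. - \<phi> x)"
proof -
  interpret A: group A by (rule AutoGroup)
  have u: "u \<in> carrier G" by (rule Z_carrier[OF assms(1)])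
  have n: "(\<lambda>x. - \<phi> x) \<in> hom G integer_group" using int_hom_scale[OF assms(2), of "-1"] by simp
  have t: "transvection u \<phi> \<in> auto G" "transvection u (\<lambda>x. - \<phi> x) \<in> auto G"
    using transvection_auto assms n by simp_all
  have "transvection u (\<lambda>x. - \<phi> x) \<star> transvection u \<phi> = \<one>\<^bsub>A\<^esub>"
  proof (rule auto_eqI)
    show "transvection u (\<lambda>x. - \<phi> x) \<star> transvection u \<phi> \<in> auto G"
      using t by (simp add: AutoGroup_mult_closed)
    show "\<one>\<^bsub>A\<^esub> \<in> auto G" using A.one_closed carrier_AutoGroup by simp
    fix x assume x: "x \<in> carrier G"
    then show "(transvection u (\<lambda>x. - \<phi> x) \<star> transvection u \<phi>) x = \<one>\<^bsub>A\<^esub> x"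
      using u t assms(3)
      by (simp add: AutoGroup_mult AutoGroup_one transvection_apply int_hom_simps[OF assms(2)] int_pow_neg m_assoc)
  qed
  then show ?thesis
    using t carrier_AutoGroup by (intro A.inv_equality) simp_all
qed

lemma transvection_conj:
  assumes f: "f \<in> auto G" and "u \<in> Z" "\<phi> \<in> hom G integer_group" "\<phi> u = 0"
  shows "f \<star> transvection u \<phi> \<star> inv\<^bsub>A\<^esub> f = transvection (f u) (\<lambda>x. \<phi> ((inv\<^bsub>A\<^esub> f) x))"
proof (rule auto_eqI)
  note fi = AutoGroup_inv_closed[OF f]
  have u: "u \<in> carrier G" by (rule Z_carrier[OF assms(2)])
  have t: "transvection u \<phi> \<in> auto G" by (rule transvection_auto[OF assms(2-4)])
  show "f \<star> transvection u \<phi> \<star> inv\<^bsub>A\<^esub> f \<in> auto G"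
    using f fi t by (simp add: AutoGroup_mult_closed)
  have "(\<lambda>x. \<phi> ((inv\<^bsub>A\<^esub> f) x)) \<in> hom G integer_group"
    using fi by (intro homI) (simp_all add: auto_mult auto_closed int_hom_simps[OF assms(3)])
  then show "transvection (f u) (\<lambda>x. \<phi> ((inv\<^bsub>A\<^esub> f) x)) \<in> auto G"
    using auto_Z[OF f assms(2)] AutoGroup_inv_cancel[OF f u] assms(4) by (intro transvection_auto) simp_all
  fix x assume x: "x \<in> carrier G"
  have fx: "(inv\<^bsub>A\<^esub> f) x \<in> carrier G" by (rule auto_closed[OF fi x])
  show "(f \<star> transvection u \<phi> \<star> inv\<^bsub>A\<^esub> f) x = transvection (f u) (\<lambda>x. \<phi> ((inv\<^bsub>A\<^esub> f) x)) x"
    using f fi t x fx u AutoGroup_inv_cancel(2)[OF f x]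
    by (simp add: AutoGroup_mult AutoGroup_mult_closed transvection_apply auto_mult auto_int_pow)
qed

text \<open>
Put \<open>\<psi> x = \<phi> (f\<inverse> x)\<close>. A transvection along \<open>u\<close> with functional \<open>k * \<phi>\<close> fixes \<open>\<phi> x\<close> and adds \<open>k * \<psi> u * \<phi> x\<close> to
\<open>\<psi> x\<close>; its conjugate by \<open>f\<close> is the transvection along \<open>f u\<close> with functional \<open>k * \<psi>\<close>, which fixes \<open>\<psi> x\<close> and
adds \<open>k * \<phi> (f u) * \<psi> x\<close> to \<open>\<phi> x\<close>. As both coefficients are nonzero, the two generate a free group if \<open>k\<close>
is large, and the commutator of the transvection with \<open>f\<close> is a nonempty reduced word in it.
\<close>

lemma transvection_full_sized:
  assumes N: "N \<lhd> A" and f: "f \<in> N" and u: "u \<in> Z" and \<phi>: "\<phi> \<in> hom G integer_group" "\<phi> u = 0"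
    and nz: "\<phi> (f u) \<noteq> 0" "\<phi> ((inv\<^bsub>A\<^esub> f) u) \<noteq> 0"
  shows "full_sized (A\<lparr>carrier := N\<rparr>)"
proof -
  interpret A: group A by (rule AutoGroup)
  have fa: "f \<in> auto G"
    using subgroup.subset[OF normal_imp_subgroup[OF N]] f carrier_AutoGroup by blast
  let ?fi = "inv\<^bsub>A\<^esub> f"
  have fi: "?fi \<in> auto G" by (rule AutoGroup_inv_closed[OF fa])
  define \<psi> where "\<psi> x = \<phi> (?fi x)" for x
  have \<psi>: "\<psi> \<in> hom G integer_group"
    unfolding \<psi>_def using fi by (intro homI) (simp_all add: auto_mult auto_closed int_hom_simps[OF \<phi>(1)])
  have uc: "u \<in> carrier G" and fu: "f u \<in> Z" and fuc: "f u \<in> carrier G"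
    using Z_carrier u auto_Z[OF fa u] by auto
  define p where "p = \<phi> (f u)"
  define q where "q = \<psi> u"
  \<comment> \<open>The factor \<open>M\<close> exceeds both ratios of \<open>p\<close> and \<open>q\<close>, so that the base point \<open>(p, q)\<close> lies in none of the sets.\<close>
  define M where "M = \<bar>p\<bar> + \<bar>q\<bar> + 1"
  define k where "k = M + 2"
  have pq: "p \<noteq> 0" "q \<noteq> 0" using nz by (simp_all add: p_def q_def \<psi>_def)
  have M: "M \<ge> 1" "k \<ge> M + 2" by (simp_all add: M_def k_def)
  have \<psi>fu: "\<psi> (f u) = 0"
    using AutoGroup_inv_cancel(1)[OF fa uc] \<phi>(2) by (simp add: \<psi>_def)
  define t where "t s = transvection u (\<lambda>x. (if s then k else - k) * \<phi> x)" for s :: bool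
  define t' where "t' s = transvection (f u) (\<lambda>x. (if s then k else - k) * \<psi> x)" for s :: bool
  have t_auto: "t s \<in> auto G" "t' s \<in> auto G" for s
    unfolding t_def t'_def
    using transvection_auto[OF u int_hom_scale[OF \<phi>(1), of "if s then k else - k"]] \<phi>(2)
      transvection_auto[OF fu int_hom_scale[OF \<psi>, of "if s then k else - k"]] \<psi>fu by simp_all
  define gen where "gen c = (if c then t True else t' True)" for c :: bool
  have gen: "gen \<in> UNIV \<rightarrow> carrier A" using t_auto carrier_AutoGroup by (auto simp: gen_def)
  have lv: "letter_value A gen l = (if fst l then t (snd l) else t' (snd l))" for l
  proof -
    have "inv\<^bsub>A\<^esub> (t True) = t False"
      unfolding t_def using transvection_inv[OF u int_hom_scale[OF \<phi>(1)], of k] \<phi>(2) by simp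
    moreover have "inv\<^bsub>A\<^esub> (t' True) = t' False"
      unfolding t'_def using transvection_inv[OF fu int_hom_scale[OF \<psi>], of k] \<psi>fu by simp
    ultimately show ?thesis by (auto simp: letter_value_def gen_def)
  qed
  have t_act: "t s x \<in> carrier G" "\<phi> (t s x) = \<phi> x" "\<psi> (t s x) = \<psi> x + k * (if s then q else - q) * \<phi> x"
    if "x \<in> carrier G" for s x
    using that auto_closed[OF t_auto(1)] \<phi>(2)
      int_hom_transvection[OF int_hom_scale[OF \<phi>(1)] \<phi>(1) uc that] int_hom_transvection[OF int_hom_scale[OF \<phi>(1)] \<psi> uc that]
    by (simp_all add: t_def q_def)
  have t'_act: "t' s x \<in> carrier G" "\<psi> (t' s x) = \<psi> x" "\<phi> (t' s x) = \<phi> x + k * (if s then p else - p) * \<psi> x"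
    if "x \<in> carrier G" for s x
    using that auto_closed[OF t_auto(2)] \<psi>fu
      int_hom_transvection[OF int_hom_scale[OF \<psi>] \<psi> fuc that] int_hom_transvection[OF int_hom_scale[OF \<psi>] \<phi>(1) fuc that]
    by (simp_all add: t'_def p_def)
  define S where "S l = {x \<in> carrier G. if fst l
      then M * \<bar>\<phi> x\<bar> < \<bar>\<psi> x\<bar> \<and> \<phi> x * \<psi> x * (if snd l then q else - q) > 0
      else M * \<bar>\<psi> x\<bar> < \<bar>\<phi> x\<bar> \<and> \<psi> x * \<phi> x * (if snd l then p else - p) > 0}" for l :: "bool \<times> bool"
  define b where "b = u \<otimes> f u"
  have b: "b \<in> carrier G" "\<phi> b = p" "\<psi> b = q"
    using uc fuc \<phi>(2) \<psi>fu by (simp_all add: b_def p_def q_def int_hom_simps[OF \<phi>(1)] int_hom_simps[OF \<psi>])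
  interpret group_action A "carrier G" "\<lambda>f. f" by (rule AutoGroup_action)
  interpret ping_pong A "carrier G" "\<lambda>f. f" "UNIV :: bool set" gen S b
  proof unfold_locales
    show "gen \<in> UNIV \<rightarrow> carrier A" by (rule gen)
    show "b \<in> carrier G" by (rule b)
  next
    fix l :: "bool \<times> bool"
    obtain c s where l: "l = (c, s)" by (cases l)
    show "S l \<subseteq> carrier G" by (auto simp: S_def)
    have "\<bar>q\<bar> * 1 \<le> M * \<bar>p\<bar>" "\<bar>p\<bar> * 1 \<le> M * \<bar>q\<bar>"
      using pq by (intro mult_mono; simp add: M_def)+
    then show "b \<notin> S l" using b by (auto simp: S_def)
    show "letter_value A gen l b \<in> S l"
      using t_act[OF b(1), of s] t'_act[OF b(1), of s] b
        shear_base_int[OF M pq(2,1), of "if s then q else - q"]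
        shear_base_int[OF M pq, of "if s then p else - p"]
      by (cases c) (auto simp: S_def lv l)
  next
    fix l l' :: "bool \<times> bool" and x
    assume l': "l' \<noteq> flip l" and x: "x \<in> S l'"
    obtain c s where l: "l = (c, s)" by (cases l)
    obtain c' s' where l'_eq: "l' = (c', s')" by (cases l')
    have xc: "x \<in> carrier G" using x by (auto simp: S_def)
    have Ma: "M * \<bar>a\<bar> \<ge> 0" for a using M by simp
    show "letter_value A gen l x \<in> S l"
    proof (cases c)
      case True
      have "\<phi> x \<noteq> 0"
        using x Ma[of "\<psi> x"] by (auto simp: S_def l'_eq split: if_splits)
      moreover have "(M * \<bar>\<phi> x\<bar> < \<bar>\<psi> x\<bar> \<and> \<phi> x * \<psi> x * (if s then q else - q) > 0) \<or> M * \<bar>\<psi> x\<bar> < \<bar>\<phi> x\<bar>"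
        using x l' True by (auto simp: S_def l'_eq l split: if_splits)
      ultimately have "\<bar>\<psi> x + k * (if s then q else - q) * \<phi> x\<bar> > M * \<bar>\<phi> x\<bar> \<and>
          \<phi> x * (\<psi> x + k * (if s then q else - q) * \<phi> x) * (if s then q else - q) > 0"
        using pq by (intro shear_step_int[OF M]) auto
      then show ?thesis
        using t_act[OF xc, of s] True by (auto simp: S_def lv l)
    next
      case False
      have "\<psi> x \<noteq> 0"
        using x Ma[of "\<phi> x"] by (auto simp: S_def l'_eq split: if_splits)
      moreover have "(M * \<bar>\<psi> x\<bar> < \<bar>\<phi> x\<bar> \<and> \<psi> x * \<phi> x * (if s then p else - p) > 0) \<or> M * \<bar>\<phi> x\<bar> < \<bar>\<psi> x\<bar>"
        using x l' False by (auto simp: S_def l'_eq l split: if_splits)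
      ultimately have "\<bar>\<phi> x + k * (if s then p else - p) * \<psi> x\<bar> > M * \<bar>\<psi> x\<bar> \<and>
          \<psi> x * (\<phi> x + k * (if s then p else - p) * \<psi> x) * (if s then p else - p) > 0"
        using pq by (intro shear_step_int[OF M]) auto
      then show ?thesis
        using t'_act[OF xc, of s] False by (auto simp: S_def lv l)
    qed
  qed
  let ?Y = "[(True, True), (False, False)]"
  have tA: "t True \<in> carrier A" "inv\<^bsub>A\<^esub> (t True) \<in> carrier A" "f \<in> carrier A"
    using t_auto(1)[of True] fa carrier_AutoGroup AutoGroup_inv_closed by auto
  have "t' True = f \<star> t True \<star> inv\<^bsub>A\<^esub> f"
    unfolding t_def t'_def \<psi>_def using transvection_conj[OF fa u int_hom_scale[OF \<phi>(1)], of k] \<phi>(2) by simp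
  then have "word_value A gen ?Y = (t True \<star> f \<star> inv\<^bsub>A\<^esub> (t True)) \<star> inv\<^bsub>A\<^esub> f"
    using tA by (simp add: letter_value_def gen_def A.inv_mult_group A.m_assoc)
  moreover have "t True \<star> f \<star> inv\<^bsub>A\<^esub> (t True) \<in> N"
    by (rule normal.inv_op_closed2[OF N tA(1) f])
  ultimately have YN: "word_value A gen ?Y \<in> N"
    using subgroup.m_closed[OF normal_imp_subgroup[OF N]]
      subgroup.m_inv_closed[OF normal_imp_subgroup[OF N] f] by simp
  have Yw: "?Y \<in> gwords UNIV" by simp
  have "word_value A gen ?Y \<noteq> \<one>\<^bsub>A\<^esub>"
    using word_moves_base[OF _ Yw] AutoGroup_one[OF b(1)] by fastforce
  moreover have "(\<lambda>f. f) \<in> hom A A" by (simp add: hom_def)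
  ultimately show ?thesis
    using normal_subgroup_full_sized[where A = A and \<theta> = "\<lambda>f. f" and N = N and a = True and b = False and Y = ?Y]
      A.is_group N Yw YN AutoGroup_one[OF b(1)] by simp
qed

end

section \<open>Normal subgroups that are not full-sized\<close>

context raag_graph
begin

text \<open>
Suppose that \<open>f(v)\<close> involves another cone vertex \<open>w\<close>. Then \<open>f\<inverse>(v)\<close> also involves some cone vertex \<open>u\<close>
other than \<open>v\<close>, because otherwise \<open>v\<close> would be a power of \<open>f(v)\<close>. One of the functionals \<open>deg w\<close>, \<open>deg u\<close> and
\<open>deg w + deg u\<close> vanishes on \<open>v\<close> and neither on \<open>f(v)\<close> nor on \<open>f\<inverse>(v)\<close>.
\<close>

lemma preserves_cone_lines:
  assumes N: "N \<lhd> A" "\<not> full_sized (A\<lparr>carrier := N\<rparr>)" and f: "f \<in> N"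
    and vD: "v \<in> D" "w \<in> D" "w \<noteq> v"
  shows "deg w (f (e v)) = 0"
proof (rule ccontr)
  assume nz: "deg w (f (e v)) \<noteq> 0"
  have fa: "f \<in> auto G"
    using subgroup.subset[OF normal_imp_subgroup[OF N(1)]] f carrier_AutoGroup by blast
  let ?fi = "inv\<^bsub>A\<^esub> f"
  have fi: "?fi \<in> auto G" by (rule AutoGroup_inv_closed[OF fa])
  have V: "v \<in> V" "w \<in> V" using vD D_subset by auto
  have ev: "e v \<in> Z" "e v \<in> carrier G" "f (e v) \<in> carrier G" "?fi (e v) \<in> carrier G"
    using e_in_Z[OF vD(1)] V auto_closed[OF fa] auto_closed[OF fi] by auto
  have no: "\<phi> (f (e v)) = 0 \<or> \<phi> (?fi (e v)) = 0"
    if "\<phi> \<in> hom G integer_group" "\<phi> (e v) = 0" for \<phi>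
    using transvection_full_sized[OF N(1) f ev(1) that] N(2) by blast
  have w0: "deg w (?fi (e v)) = 0"
    using no[OF deg_hom, of w] nz V vD(3) by (simp add: deg_e)
  have "\<exists>u \<in> D. u \<noteq> v \<and> deg u (?fi (e v)) \<noteq> 0"
  proof (rule ccontr)
    assume all0: "\<not> ?thesis"
    let ?c = "deg v (?fi (e v))"
    have "?fi (e v) = e v [^] ?c"
      using all0 V ev D_subset
      by (intro Z_eqI auto_Z[OF fi ev(1)] Z_pow_closed[OF ev(1)]) (auto simp: deg_simps deg_e)
    then have "e v = f (e v) [^] ?c"
      using AutoGroup_inv_cancel(2)[OF fa ev(2)] auto_int_pow[OF fa ev(2), of ?c] by simp
    then have eq: "deg u (e v) = ?c * deg u (f (e v))" for u
      using ev(3) by (metis deg_simps(4))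
    have "?c = 0" using eq[of w] nz V vD(3) by (simp add: deg_e)
    then show False using eq[of v] V by (simp add: deg_e)
  qed
  then obtain u where u: "u \<in> D" "u \<noteq> v" "deg u (?fi (e v)) \<noteq> 0" by blast
  then have "u \<in> V" using D_subset by auto
  have u0: "deg u (f (e v)) = 0"
    using no[OF deg_hom, of u] u V by (simp add: deg_e)
  have "(\<lambda>x. deg w x + deg u x) \<in> hom G integer_group"
    by (rule homI) (simp_all add: deg_simps)
  from no[OF this] show False
    using u0 w0 u nz V vD(3) by (simp add: deg_e)
qed

text \<open>
Every cone vertex is mapped to itself or its inverse. If \<open>f\<close> fixed \<open>v\<close> but inverted \<open>w\<close>, the element
\<open>v w\<close> and the functional \<open>deg v - deg w\<close> would contradict \<open>transvection_full_sized\<close>.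
\<close>

lemma acts_on_Z_by_sign:
  assumes N: "N \<lhd> A" "\<not> full_sized (A\<lparr>carrier := N\<rparr>)" and f: "f \<in> N"
  shows "\<exists>s \<in> {1, -1 :: int}. \<forall>z \<in> Z. f z = z [^] s"
proof -
  have fa: "f \<in> auto G"
    using subgroup.subset[OF normal_imp_subgroup[OF N(1)]] f carrier_AutoGroup by blast
  let ?fi = "inv\<^bsub>A\<^esub> f"
  have fi: "?fi \<in> auto G" by (rule AutoGroup_inv_closed[OF fa])
  have fiN: "?fi \<in> N" by (rule subgroup.m_inv_closed[OF normal_imp_subgroup[OF N(1)] f])
  define c where "c v = deg v (f (e v))" for v
  define d where "d v = deg v (?fi (e v))" for v
  have pow: "g (e v) = e v [^] deg v (g (e v))" if "g \<in> N" "g \<in> auto G" "v \<in> D" for g v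
  proof -
    have V: "v \<in> V" "e v \<in> carrier G" using that(3) D_subset by auto
    show ?thesis
      using preserves_cone_lines[OF N that(1,3)] V D_subset
      by (intro Z_eqI auto_Z[OF that(2)] Z_pow_closed e_in_Z that(3)) (auto simp: deg_simps deg_e)
  qed
  have fe: "f (e v) = e v [^] c v" "?fi (e v) = e v [^] d v" and cd: "c v \<in> {1, -1}" "d v = c v" if v: "v \<in> D" for v
  proof -
    have V: "v \<in> V" "e v \<in> carrier G" using v D_subset by auto
    show 1: "f (e v) = e v [^] c v" "?fi (e v) = e v [^] d v"
      unfolding c_def d_def by (rule pow[OF f fa v], rule pow[OF fiN fi v])
    have "e v = (e v [^] c v) [^] d v"
      using AutoGroup_inv_cancel(2)[OF fa V(2)] auto_int_pow[OF fa V(2), of "d v"] 1 by simp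
    from arg_cong[OF this, of "deg v"] have "c v * d v = 1"
      using V by (simp add: deg_simps deg_e mult.commute)
    then show "c v \<in> {1, -1}" "d v = c v"
      using zmult_eq_1_iff by auto
  qed
  have same: "c v = c w" if vw: "v \<in> D" "w \<in> D" for v w
  proof (rule ccontr)
    assume ne: "c v \<noteq> c w"
    then have "v \<noteq> w" by auto
    have V: "v \<in> V" "w \<in> V" using vw D_subset by auto
    let ?u = "e v \<otimes> e w" and ?\<phi> = "\<lambda>x. deg v x + - 1 * deg w x"
    have \<phi>: "?\<phi> \<in> hom G integer_group"
      by (rule homI) (simp_all add: deg_simps)
    have u: "?u \<in> Z" using vw e_in_Z Z_m_closed by blast
    have "?\<phi> (f ?u) = c v - c w" "?\<phi> (?fi ?u) = c v - c w" "?\<phi> ?u = 0"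
      using V \<open>v \<noteq> w\<close> vw auto_mult[OF fa] auto_mult[OF fi] by (simp_all add: fe cd(2) deg_simps deg_e)
    then show False
      using transvection_full_sized[OF N(1) f u \<phi>] N(2) ne by auto
  qed
  have "\<exists>s \<in> {1, -1}. \<forall>v \<in> D. c v = s"
  proof (cases "D = {}")
    case False
    then obtain v where "v \<in> D" by blast
    then show ?thesis using cd(1) same by blast
  qed blast
  then obtain s where s1: "s \<in> {1, -1}" and cs: "\<forall>v \<in> D. c v = s" by (rule bexE)
  have s: "s \<in> {1, -1}" "f (e v) = e v [^] s" if "v \<in> D" for v
    using s1 fe(1)[OF that] cs that by simp_all
  have "f z = z [^] s" if "z \<in> Z" for z
    using that[unfolded cone_subgroup_def G_eq[symmetric]]
  proof (induction rule: generate.induct)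
    case one
    then show ?case using hom_one[OF auto_hom[OF fa] is_group is_group] by simp
  next
    case (incl h)
    then obtain v where "v \<in> D" "h = e v" by auto
    then show ?case using s(2) by simp
  next
    case (inv h)
    then obtain v where "v \<in> D" "h = e v" by auto
    moreover have "e v \<in> carrier G" using D_subset \<open>v \<in> D\<close> by auto
    ultimately show ?case using s(2) by (simp add: auto_inv[OF fa] int_pow_inv)
  next
    case (eng h k)
    then have hk: "h \<in> Z" "k \<in> Z" by (simp_all add: cone_subgroup_def G_eq[symmetric])
    show ?case
      using eng.IH hk Z_carrier Z_central[OF hk(2), of h]
      by (simp add: auto_mult[OF fa] int_pow_mult_distrib)
  qed
  with s1 show ?thesis by blast
qed

text \<open>
For \<open>s = 1\<close> this is \<open>T_cone\<close> (\<open>T_cone_eq\<close>), described without reference to the generators, so that normality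
becomes visible; for \<open>s = -1\<close> it is the coset of \<open>T_cone\<close> that consists of automorphisms inverting \<open>Z\<close>.
\<close>

definition central_autos :: "int \<Rightarrow> ('v gword set \<Rightarrow> 'v gword set) set" where
  "central_autos s = {f \<in> auto G. (\<forall>x \<in> carrier G. \<exists>c \<in> Z. f x = x \<otimes> c) \<and> (\<forall>z \<in> Z. f z = z [^] s)}"

lemma central_autosD:
  assumes "f \<in> central_autos s"
  shows "f \<in> auto G" "x \<in> carrier G \<Longrightarrow> \<exists>c \<in> Z. f x = x \<otimes> c" "z \<in> Z \<Longrightarrow> f z = z [^] s"
  using assms by (simp_all add: central_autos_def)

lemma central_autos_1_fix: "f \<in> central_autos 1 \<Longrightarrow> z \<in> Z \<Longrightarrow> f z = z"
  using central_autosD(3)[of f 1 z] Z_carrier by simp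

lemma central_autos_m1_inv: "f \<in> central_autos (-1) \<Longrightarrow> z \<in> Z \<Longrightarrow> f z = inv z"
  using central_autosD(3)[of f "-1" z] Z_carrier int_pow_neg[of z 1] by simp

lemma central_autos_one: "\<one>\<^bsub>A\<^esub> \<in> central_autos 1"
proof -
  have "\<one>\<^bsub>A\<^esub> \<in> auto G"
    using monoid.one_closed[OF group.is_monoid[OF AutoGroup]] carrier_AutoGroup by simp
  then show ?thesis
    using subgroup.one_closed[OF Z_subgroup] Z_carrier
    by (auto simp: central_autos_def AutoGroup_one intro!: bexI[of _ "\<one>"])
qed

lemma central_autos_mult:
  assumes f: "f \<in> central_autos s" and g: "g \<in> central_autos t"
  shows "f \<star> g \<in> central_autos (s * t)"
proof -
  note fa = central_autosD(1)[OF f] and ga = central_autosD(1)[OF g]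
  have "\<exists>c \<in> Z. (f \<star> g) x = x \<otimes> c" if x: "x \<in> carrier G" for x
  proof -
    obtain c where c: "c \<in> Z" "g x = x \<otimes> c" using central_autosD(2)[OF g x] by blast
    obtain d where d: "d \<in> Z" "f x = x \<otimes> d" using central_autosD(2)[OF f x] by blast
    have fc: "f c \<in> Z" by (rule auto_Z[OF fa c(1)])
    have "(f \<star> g) x = x \<otimes> (d \<otimes> f c)"
      using x c d fc Z_carrier by (simp add: AutoGroup_mult[OF fa ga] auto_mult[OF fa] m_assoc)
    then show ?thesis using Z_m_closed[OF d(1) fc] by blast
  qed
  moreover have "(f \<star> g) z = z [^] (s * t)" if z: "z \<in> Z" for z
    using z Z_carrier[OF z] central_autosD(3)[OF f z] central_autosD(3)[OF g z]
    by (simp add: AutoGroup_mult[OF fa ga] auto_int_pow[OF fa] int_pow_pow)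
  ultimately show ?thesis
    using AutoGroup_mult_closed[OF fa ga] by (simp add: central_autos_def)
qed

lemma central_autos_conj:
  assumes h: "h \<in> auto G" and f: "f \<in> central_autos s"
  shows "h \<star> f \<star> inv\<^bsub>A\<^esub> h \<in> central_autos s"
proof -
  let ?hi = "inv\<^bsub>A\<^esub> h" and ?g = "h \<star> f \<star> inv\<^bsub>A\<^esub> h"
  note fa = central_autosD(1)[OF f] and hi = AutoGroup_inv_closed[OF h]
  have app: "?g x = h (f (?hi x))" if "x \<in> carrier G" for x
    using that auto_closed[OF hi that] by (simp add: AutoGroup_mult AutoGroup_mult_closed h fa hi)
  have "\<exists>c \<in> Z. ?g x = x \<otimes> c" if x: "x \<in> carrier G" for x
  proof -
    have hx: "?hi x \<in> carrier G" by (rule auto_closed[OF hi x])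
    obtain c where c: "c \<in> Z" "f (?hi x) = ?hi x \<otimes> c" using central_autosD(2)[OF f hx] by blast
    have "?g x = x \<otimes> h c"
      using app[OF x] c hx Z_carrier[OF c(1)] auto_mult[OF h] AutoGroup_inv_cancel(2)[OF h x] by simp
    then show ?thesis using auto_Z[OF h c(1)] by blast
  qed
  moreover have "?g z = z [^] s" if z: "z \<in> Z" for z
    using app[OF Z_carrier[OF z]] central_autosD(3)[OF f auto_Z[OF hi z]] AutoGroup_inv_cancel(2)[OF h Z_carrier[OF z]]
      auto_int_pow[OF h auto_closed[OF hi Z_carrier[OF z]]] by simp
  ultimately show ?thesis
    using h fa hi by (simp add: central_autos_def AutoGroup_mult_closed)
qed

lemma central_autos_inv:
  assumes f: "f \<in> central_autos s" and s: "s \<in> {1, -1}"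
  shows "inv\<^bsub>A\<^esub> f \<in> central_autos s"
proof -
  let ?fi = "inv\<^bsub>A\<^esub> f"
  note fa = central_autosD(1)[OF f]
  note fi = AutoGroup_inv_closed[OF fa]
  have "\<exists>c \<in> Z. ?fi x = x \<otimes> c" if x: "x \<in> carrier G" for x
  proof -
    have fx: "?fi x \<in> carrier G" by (rule auto_closed[OF fi x])
    obtain c where c: "c \<in> Z" "f (?fi x) = ?fi x \<otimes> c" using central_autosD(2)[OF f fx] by blast
    have cc: "c \<in> carrier G" by (rule Z_carrier[OF c(1)])
    have "x = ?fi x \<otimes> c" using c(2) AutoGroup_inv_cancel(2)[OF fa x] by simp
    then have "?fi x = x \<otimes> inv c" using x fx cc by (metis inv_solve_right')
    then show ?thesis using Z_inv_closed[OF c(1)] by blast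
  qed
  moreover have "?fi z = z [^] s" if z: "z \<in> Z" for z
  proof -
    have fz: "?fi z \<in> Z" by (rule auto_Z[OF fi z])
    have "z = ?fi z [^] s"
      using central_autosD(3)[OF f fz] AutoGroup_inv_cancel(2)[OF fa Z_carrier[OF z]] by simp
    then have "z [^] s = ?fi z [^] (s * s)"
      using int_pow_pow[OF Z_carrier[OF fz], of s s] by simp
    moreover have "s * s = 1" using s by auto
    ultimately show ?thesis using Z_carrier[OF fz] by simp
  qed
  ultimately show ?thesis
    using fi by (simp add: central_autos_def)
qed

definition signed_central_autos :: "('v gword set \<Rightarrow> 'v gword set) set" where
  "signed_central_autos = central_autos 1 \<union> central_autos (-1)"

lemma central_autos_normal: "central_autos 1 \<lhd> A"
proof -
  interpret A: group A by (rule AutoGroup)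
  have "subgroup (central_autos 1) A"
    using central_autos_mult[of _ 1 _ 1] central_autos_inv[of _ 1] central_autos_one
      central_autosD(1) carrier_AutoGroup
    by (intro A.subgroupI) auto
  then show ?thesis
    unfolding A.normal_inv_iff using central_autos_conj carrier_AutoGroup by blast
qed

lemma signed_central_autos_normal: "signed_central_autos \<lhd> A"
proof -
  interpret A: group A by (rule AutoGroup)
  have "subgroup signed_central_autos A"
  proof (rule A.subgroupI)
    show "signed_central_autos \<subseteq> carrier A" "signed_central_autos \<noteq> {}"
      using central_autosD(1) carrier_AutoGroup central_autos_one by (auto simp: signed_central_autos_def)
    show "inv\<^bsub>A\<^esub> f \<in> signed_central_autos" if "f \<in> signed_central_autos" for f
      using that central_autos_inv by (auto simp: signed_central_autos_def)
    show "f \<star> g \<in> signed_central_autos"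
      if "f \<in> signed_central_autos" "g \<in> signed_central_autos" for f g
      using that central_autos_mult[of f _ g] by (fastforce simp: signed_central_autos_def)
  qed
  then show ?thesis
    unfolding A.normal_inv_iff using central_autos_conj carrier_AutoGroup
    by (auto simp: signed_central_autos_def)
qed

lemma central_autos_commute:
  assumes f: "f \<in> central_autos 1" and g: "g \<in> central_autos 1"
  shows "f \<star> g = g \<star> f"
proof (rule auto_eqI)
  note fa = central_autosD(1)[OF f] and ga = central_autosD(1)[OF g]
  show "f \<star> g \<in> auto G" "g \<star> f \<in> auto G" using fa ga by (simp_all add: AutoGroup_mult_closed)
  fix x assume x: "x \<in> carrier G"
  obtain c where c: "c \<in> Z" "g x = x \<otimes> c" using central_autosD(2)[OF g x] by blast
  obtain d where d: "d \<in> Z" "f x = x \<otimes> d" using central_autosD(2)[OF f x] by blast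
  have "x \<otimes> d \<otimes> c = x \<otimes> c \<otimes> d"
    using x Z_carrier[OF c(1)] Z_carrier[OF d(1)] Z_central[OF c(1), of d] by (simp add: m_assoc)
  then show "(f \<star> g) x = (g \<star> f) x"
    using x c d Z_carrier central_autos_1_fix[OF f c(1)] central_autos_1_fix[OF g d(1)]
    by (simp add: AutoGroup_mult fa ga auto_mult)
qed

text \<open>
From left to right, every violation of the description produces a free group. From right to left,
squares of elements of \<open>N\<close> lie in \<open>central_autos 1\<close>, which is abelian, whereas squares in a free
group of rank two need not commute.
\<close>

theorem nfs_normal_iff: "nfs_normal N A \<longleftrightarrow> N \<lhd> A \<and> N \<subseteq> signed_central_autos"
proof
  assume nfs: "nfs_normal N A"
  then have N: "N \<lhd> A" "\<not> full_sized (A\<lparr>carrier := N\<rparr>)" by (simp_all add: nfs_normal_def)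
  have "f \<in> signed_central_autos" if f: "f \<in> N" for f
  proof -
    have fa: "f \<in> auto G"
      using subgroup.subset[OF normal_imp_subgroup[OF N(1)]] f carrier_AutoGroup by blast
    have "\<exists>c \<in> Z. f x = x \<otimes> c" if x: "x \<in> carrier G" for x
    proof -
      have "f x = x \<otimes> (inv x \<otimes> f x)" using x auto_closed[OF fa x] by (simp add: m_assoc[symmetric])
      then show ?thesis using displacement_in_Z[OF N f x] by blast
    qed
    then show ?thesis
      using fa acts_on_Z_by_sign[OF N f] by (auto simp: signed_central_autos_def central_autos_def)
  qed
  with N(1) show "N \<lhd> A \<and> N \<subseteq> signed_central_autos" by blast
next
  assume N: "N \<lhd> A \<and> N \<subseteq> signed_central_autos"
  have "\<not> full_sized (A\<lparr>carrier := N\<rparr>)"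
  proof
    assume "full_sized (A\<lparr>carrier := N\<rparr>)"
    moreover have "group (A\<lparr>carrier := N\<rparr>)"
      using N normal_imp_subgroup group.subgroup_imp_group[OF AutoGroup] by blast
    ultimately obtain f g where fg: "f \<in> N" "g \<in> N"
      and ne: "(f \<star> f) \<star> (g \<star> g) \<noteq> (g \<star> g) \<star> (f \<star> f)"
      using full_sized_noncommuting_squares by fastforce
    have "h \<star> h \<in> central_autos 1" if "h \<in> N" for h
      using that N central_autos_mult[of h _ h] by (fastforce simp: signed_central_autos_def)
    then show False using central_autos_commute fg ne by blast
  qed
  with N show "nfs_normal N A" by (simp add: nfs_normal_def)
qed

lemma maximal_nfs_normal_iff: "maximal_nfs_normal N A \<longleftrightarrow> N = signed_central_autos"
  using signed_central_autos_normal unfolding maximal_nfs_normal_def nfs_normal_iff by blast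

end

section \<open>The structure of the largest such subgroup\<close>

context raag_graph
begin

lemma central_autosI:
  assumes f: "f \<in> auto G" and gens: "\<And>v. v \<in> V \<Longrightarrow> \<exists>c \<in> Z. f (e v) = e v \<otimes> c"
    and sign: "\<And>z. z \<in> Z \<Longrightarrow> f z = z [^] s"
  shows "f \<in> central_autos s"
proof -
  have "subgroup {x \<in> carrier G. \<exists>c \<in> Z. f x = x \<otimes> c} G"
  proof (rule subgroupI)
    have "f \<one> = \<one> \<otimes> \<one>" using hom_one[OF auto_hom[OF f] is_group is_group] by simp
    then have "\<one> \<in> {x \<in> carrier G. \<exists>c \<in> Z. f x = x \<otimes> c}"
      using subgroup.one_closed[OF Z_subgroup] by blast
    then show "{x \<in> carrier G. \<exists>c \<in> Z. f x = x \<otimes> c} \<noteq> {}" by blast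
    show "inv x \<in> {x \<in> carrier G. \<exists>c \<in> Z. f x = x \<otimes> c}"
      if x: "x \<in> {x \<in> carrier G. \<exists>c \<in> Z. f x = x \<otimes> c}" for x
    proof -
      obtain c where c: "c \<in> Z" "f x = x \<otimes> c" and xc: "x \<in> carrier G" using x by blast
      have "f (inv x) = inv x \<otimes> inv c"
        using xc c Z_carrier[OF c(1)] Z_central[OF Z_inv_closed[OF c(1)], of "inv x"]
        by (simp add: auto_inv[OF f] inv_mult_group)
      then show ?thesis using Z_inv_closed[OF c(1)] xc by blast
    qed
    show "x \<otimes> y \<in> {x \<in> carrier G. \<exists>c \<in> Z. f x = x \<otimes> c}"
      if x: "x \<in> {x \<in> carrier G. \<exists>c \<in> Z. f x = x \<otimes> c}"
        and y: "y \<in> {x \<in> carrier G. \<exists>c \<in> Z. f x = x \<otimes> c}" for x y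
    proof -
      obtain c where c: "c \<in> Z" "f x = x \<otimes> c" and xc: "x \<in> carrier G" using x by blast
      obtain d where d: "d \<in> Z" "f y = y \<otimes> d" and yc: "y \<in> carrier G" using y by blast
      have "x \<otimes> (c \<otimes> y) \<otimes> d = x \<otimes> (y \<otimes> c) \<otimes> d"
        using Z_central[OF c(1) yc] by simp
      then have "f (x \<otimes> y) = x \<otimes> y \<otimes> (c \<otimes> d)"
        using xc yc c d Z_carrier by (simp add: auto_mult[OF f] m_assoc)
      then show ?thesis using Z_m_closed[OF c(1) d(1)] xc yc by blast
    qed
  qed blast
  moreover have "e ` V \<subseteq> {x \<in> carrier G. \<exists>c \<in> Z. f x = x \<otimes> c}"
    using gens by (simp add: image_subset_iff)
  ultimately have "carrier G \<subseteq> {x \<in> carrier G. \<exists>c \<in> Z. f x = x \<otimes> c}"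
    by (rule generated)
  then show ?thesis
    using f sign unfolding central_autos_def by blast
qed

lemma T_cone_eq: "T_cone V E = central_autos 1"
proof (intro equalityI subsetI)
  fix f assume "f \<in> T_cone V E"
  then have f: "f \<in> auto G" and w: "\<And>w. w \<in> V - D \<Longrightarrow> inv (e w) \<otimes> f (e w) \<in> Z"
    and v: "\<And>v. v \<in> D \<Longrightarrow> f (e v) = e v"
    by (simp_all add: T_cone_def G_eq[symmetric] carrier_AutoGroup)
  show "f \<in> central_autos 1"
  proof (rule central_autosI[OF f])
    fix u assume u: "u \<in> V"
    show "\<exists>c \<in> Z. f (e u) = e u \<otimes> c"
    proof (cases "u \<in> D")
      case True
      then show ?thesis using v u subgroup.one_closed[OF Z_subgroup] by (intro bexI[of _ \<one>]) simp_all
    next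
      case False
      then show ?thesis
        using w[of u] u auto_closed[OF f] by (intro bexI[of _ "inv (e u) \<otimes> f (e u)"]) (simp_all add: m_assoc[symmetric])
    qed
  next
    fix z assume z: "z \<in> Z"
    have "f z = z"
      using z[unfolded cone_subgroup_def G_eq[symmetric]]
    proof (induction rule: generate.induct)
      case one
      then show ?case using hom_one[OF auto_hom[OF f] is_group is_group] by simp
    next
      case (incl h)
      then obtain u where "u \<in> D" "h = e u" by auto
      then show ?case using v by simp
    next
      case (inv h)
      then obtain u where "u \<in> D" "h = e u" by auto
      then show ?case using v D_subset auto_inv[OF f] by (simp add: subset_iff)
    next
      case (eng h k)
      then have "h \<in> carrier G" "k \<in> carrier G"
        using Z_carrier by (simp_all add: cone_subgroup_def G_eq[symmetric])
      then show ?case using eng.IH by (simp add: auto_mult[OF f])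
    qed
    then show "f z = z [^] (1 :: int)" using Z_carrier[OF z] by simp
  qed
next
  fix f assume f: "f \<in> central_autos 1"
  have "inv (e w) \<otimes> f (e w) \<in> Z" if w: "w \<in> V" for w
  proof -
    obtain c where "c \<in> Z" "f (e w) = e w \<otimes> c" using central_autosD(2)[OF f e_closed[OF w]] by blast
    then show ?thesis using w Z_carrier by (simp add: m_assoc[symmetric])
  qed
  then show "f \<in> T_cone V E"
    using central_autosD(1)[OF f] central_autos_1_fix[OF f e_in_Z] carrier_AutoGroup
    by (simp add: T_cone_def G_eq[symmetric])
qed

definition cone_inversion :: "'v gword set \<Rightarrow> 'v gword set" where
  "cone_inversion = shear (\<lambda>x. zprod (\<lambda>v. - 2 * deg v x))"

lemma zprod_hom:
  assumes "\<And>v. k v \<in> hom G integer_group"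
  shows "(\<lambda>x. zprod (\<lambda>v. k v x)) \<in> hom G G"
  by (rule homI) (simp_all add: int_hom_simps[OF assms] zprod_add)

lemma zprod_shear_auto:
  assumes k: "\<And>v. k v \<in> hom G integer_group" and l: "\<And>v. l v \<in> hom G integer_group"
    and "\<And>v x. v \<in> D \<Longrightarrow> x \<in> carrier G \<Longrightarrow> l v (x \<otimes> zprod (\<lambda>v. k v x)) = - k v x"
    and "\<And>v x. v \<in> D \<Longrightarrow> x \<in> carrier G \<Longrightarrow> k v (x \<otimes> zprod (\<lambda>v. l v x)) = - l v x"
  shows "shear (\<lambda>x. zprod (\<lambda>v. k v x)) \<in> auto G"
proof (rule shear_auto[where \<zeta>' = "\<lambda>x. zprod (\<lambda>v. l v x)"])
  show "(\<lambda>x. zprod (\<lambda>v. k v x)) \<in> hom G G" by (rule zprod_hom[OF k])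
  fix x assume x: "x \<in> carrier G"
  show "zprod (\<lambda>v. k v x) \<otimes> y = y \<otimes> zprod (\<lambda>v. k v x)" if "y \<in> carrier G" for y
    using Z_central[OF zprod_Z that] by simp
  show "zprod (\<lambda>v. l v (x \<otimes> zprod (\<lambda>v. k v x))) = inv (zprod (\<lambda>v. k v x))"
    "zprod (\<lambda>v. k v (x \<otimes> zprod (\<lambda>v. l v x))) = inv (zprod (\<lambda>v. l v x))"
    using x assms(3,4) by (auto simp: zprod_uminus[symmetric] intro!: zprod_cong)
qed simp

lemma cone_inversion_auto: "cone_inversion \<in> auto G"
  unfolding cone_inversion_def
  by (rule zprod_shear_auto[where k = "\<lambda>v x. - 2 * deg v x" and l = "\<lambda>v x. - 2 * deg v x"])
    (rule int_hom_scale[OF deg_hom] | simp add: deg_simps deg_zprod)+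

lemma cone_inversion_apply: "x \<in> carrier G \<Longrightarrow> cone_inversion x = x \<otimes> zprod (\<lambda>v. - 2 * deg v x)"
  by (simp add: cone_inversion_def shear_apply)

lemma cone_inversion_Z: "z \<in> Z \<Longrightarrow> cone_inversion z = inv z"
proof -
  assume z: "z \<in> Z"
  have "cone_inversion z = zprod (\<lambda>v. deg v z) \<otimes> zprod (\<lambda>v. - 2 * deg v z)"
    using cone_inversion_apply[OF Z_carrier[OF z]] zprod_deg[OF z] by simp
  also have "\<dots> = zprod (\<lambda>v. - deg v z)" by (simp add: zprod_add[symmetric])
  also have "\<dots> = inv z" by (simp add: zprod_uminus zprod_deg[OF z])
  finally show ?thesis .
qed

lemma cone_inversion_central: "cone_inversion \<in> central_autos (-1)"
  using cone_inversion_auto cone_inversion_Z cone_inversion_apply zprod_Z Z_carrier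
  by (auto simp: central_autos_def int_pow_neg)

lemma cone_inversion_involution: "cone_inversion \<star> cone_inversion = \<one>\<^bsub>A\<^esub>"
proof (rule auto_eqI)
  show "cone_inversion \<star> cone_inversion \<in> auto G" "\<one>\<^bsub>A\<^esub> \<in> auto G"
    using cone_inversion_auto AutoGroup_mult_closed central_autosD(1)[OF central_autos_one] by auto
  fix x assume x: "x \<in> carrier G"
  let ?c = "zprod (\<lambda>v. - 2 * deg v x)"
  have "(cone_inversion \<star> cone_inversion) x = cone_inversion (x \<otimes> ?c)"
    using x by (simp add: AutoGroup_mult[OF cone_inversion_auto cone_inversion_auto] cone_inversion_apply)
  also have "\<dots> = x \<otimes> ?c \<otimes> inv ?c"
    using x cone_inversion_Z[OF zprod_Z] cone_inversion_apply[OF x]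
    by (simp only: auto_mult[OF cone_inversion_auto x zprod_carrier])
  also have "\<dots> = x" using x by (simp add: m_assoc)
  finally show "(cone_inversion \<star> cone_inversion) x = \<one>\<^bsub>A\<^esub> x"
    using x by (simp add: AutoGroup_one)
qed

lemma cone_inversion_gen:
  "v \<in> D \<Longrightarrow> cone_inversion (e v) = inv (e v)"
  "w \<in> V - D \<Longrightarrow> cone_inversion (e w) = e w"
proof -
  show "v \<in> D \<Longrightarrow> cone_inversion (e v) = inv (e v)"
    by (rule cone_inversion_Z[OF e_in_Z])
  assume w: "w \<in> V - D"
  then have "zprod (\<lambda>v. - 2 * deg v (e w)) = zprod (\<lambda>v. 0)"
    by (intro zprod_cong) (auto simp: deg_e)
  then show "cone_inversion (e w) = e w"
    using w by (simp add: cone_inversion_apply zprod_zero)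
qed

lemma signed_central_autos_eq:
  "signed_central_autos = central_autos 1 \<union> (\<lambda>f. f \<star> cone_inversion) ` central_autos 1"
proof -
  interpret A: group A by (rule AutoGroup)
  have inv: "cone_inversion \<in> carrier A" using cone_inversion_auto carrier_AutoGroup by simp
  have "f \<in> (\<lambda>f. f \<star> cone_inversion) ` central_autos 1" if f: "f \<in> central_autos (-1)" for f
  proof
    show "f \<star> cone_inversion \<in> central_autos 1"
      using central_autos_mult[OF f cone_inversion_central] by simp
    have "f \<in> carrier A" using central_autosD(1)[OF f] carrier_AutoGroup by simp
    then show "f = f \<star> cone_inversion \<star> cone_inversion"
      using inv cone_inversion_involution by (simp add: A.m_assoc)
  qed
  moreover have "f \<star> cone_inversion \<in> central_autos (-1)" if "f \<in> central_autos 1" for f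
    using central_autos_mult[OF that cone_inversion_central] by simp
  ultimately show ?thesis unfolding signed_central_autos_def by blast
qed

text \<open>
If \<open>f(x) = x d\<close> with \<open>d \<in> Z\<close>, then \<open>g\<close> turns \<open>d\<close> into \<open>d\<inverse>\<close>: conjugation by \<open>g\<close> inverts \<open>f\<close>.
\<close>

lemma central_autos_twisted_commute:
  assumes f: "f \<in> central_autos 1" and g: "g \<in> central_autos (-1)"
  shows "f \<star> g = g \<star> inv\<^bsub>A\<^esub> f"
proof (rule auto_eqI)
  note fa = central_autosD(1)[OF f] and ga = central_autosD(1)[OF g]
  have fi: "inv\<^bsub>A\<^esub> f \<in> central_autos 1" by (rule central_autos_inv[OF f]) simp
  note fia = central_autosD(1)[OF fi]
  show "f \<star> g \<in> auto G" "g \<star> inv\<^bsub>A\<^esub> f \<in> auto G"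
    using fa ga fia by (simp_all add: AutoGroup_mult_closed)
  fix x assume x: "x \<in> carrier G"
  obtain c where c: "c \<in> Z" "g x = x \<otimes> c" using central_autosD(2)[OF g x] by blast
  obtain d where d: "d \<in> Z" "f x = x \<otimes> d" using central_autosD(2)[OF f x] by blast
  have cd: "c \<in> carrier G" "d \<in> carrier G" "inv d \<in> Z" using c d Z_carrier Z_inv_closed by auto
  have "(inv\<^bsub>A\<^esub> f) x = x \<otimes> inv d"
  proof -
    have "f (x \<otimes> inv d) = x"
      using x cd d central_autos_1_fix[OF f cd(3)] by (simp add: auto_mult[OF fa] m_assoc)
    then show ?thesis using AutoGroup_inv_cancel(1)[OF fa, of "x \<otimes> inv d"] x cd by simp
  qed
  then have "(g \<star> inv\<^bsub>A\<^esub> f) x = x \<otimes> c \<otimes> d"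
    using x cd c central_autos_m1_inv[OF g cd(3)]
    by (simp add: AutoGroup_mult[OF ga fia] auto_mult[OF ga])
  moreover have "x \<otimes> c \<otimes> d = x \<otimes> d \<otimes> c"
    using x cd Z_central[OF d(1), of c] by (simp add: m_assoc)
  ultimately show "(f \<star> g) x = (g \<star> inv\<^bsub>A\<^esub> f) x"
    using x cd c d central_autos_1_fix[OF f c(1)] by (simp add: AutoGroup_mult[OF fa ga] auto_mult[OF fa])
qed

lemma deg_Z:
  assumes "z \<in> Z" "w \<in> V - D"
  shows "deg w z = 0"
  using assms(1)[unfolded cone_subgroup_def G_eq[symmetric]]
proof (induction rule: generate.induct)
  case one
  then show ?case using deg_simps(2)[OF one_closed] by simp
next
  case (incl h)
  then show ?case using assms(2) D_subset by (auto simp: deg_e)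
next
  case (inv h)
  then show ?case using assms(2) D_subset by (auto simp: deg_simps deg_e)
next
  case (eng h k)
  then have "h \<in> carrier G" "k \<in> carrier G"
    using Z_carrier by (simp_all add: cone_subgroup_def G_eq[symmetric])
  then show ?case using eng.IH by (simp add: deg_simps)
qed

text \<open>
The element of \<open>T_cone\<close> with matrix \<open>\<kappa>\<close>: it multiplies each non-cone vertex \<open>w\<close> by \<open>zprod (\<lambda>v. \<kappa> (w, v))\<close>.
\<close>

definition central_shear :: "('v \<times> 'v \<Rightarrow> int) \<Rightarrow> 'v gword set \<Rightarrow> 'v gword set" where
  "central_shear \<kappa> = shear (\<lambda>x. zprod (\<lambda>v. \<Sum>w\<in>V - D. \<kappa> (w, v) * deg w x))"

lemma central_shear_apply:
  "x \<in> carrier G \<Longrightarrow> central_shear \<kappa> x = x \<otimes> zprod (\<lambda>v. \<Sum>w\<in>V - D. \<kappa> (w, v) * deg w x)"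
  by (simp add: central_shear_def shear_apply)

lemma central_shear_hom: "(\<lambda>x. \<Sum>w\<in>V - D. \<kappa> (w, v) * deg w x) \<in> hom G integer_group"
  by (rule homI) (simp_all add: deg_simps distrib_left sum.distrib)

lemma central_shear_central: "central_shear \<kappa> \<in> central_autos 1"
proof -
  have "central_shear \<kappa> \<in> auto G"
    unfolding central_shear_def
    by (rule zprod_shear_auto[where l = "\<lambda>v x. \<Sum>w\<in>V - D. (\<lambda>p. - \<kappa> p) (w, v) * deg w x"])
      (rule central_shear_hom | simp add: deg_simps deg_Z[OF zprod_Z] sum_negf)+
  moreover have "central_shear \<kappa> z = z" if "z \<in> Z" for z
    using that Z_carrier[OF that] deg_Z[OF that] by (simp add: central_shear_apply zprod_zero)
  moreover have "\<exists>c \<in> Z. central_shear \<kappa> x = x \<otimes> c" if "x \<in> carrier G" for x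
    using central_shear_apply[OF that] zprod_Z by blast
  ultimately show ?thesis
    using Z_carrier by (auto simp: central_autos_def)
qed

lemma deg_central_shear:
  assumes "v \<in> D" "w \<in> V - D"
  shows "deg v (central_shear \<kappa> (e w)) = \<kappa> (w, v)"
proof -
  have "(\<Sum>u\<in>V - D. \<kappa> (u, v) * deg u (e w)) = (\<Sum>u\<in>V - D. if u = w then \<kappa> (u, v) else 0)" for v
    using assms(2) by (intro sum.cong) (auto simp: deg_e)
  then have "(\<Sum>u\<in>V - D. \<kappa> (u, v) * deg u (e w)) = \<kappa> (w, v)" for v
    using assms(2) finite_V by simp
  then show ?thesis
    using assms by (auto simp: central_shear_apply deg_simps deg_zprod deg_e)
qed

text \<open>
The coordinates \<open>deg v (f w)\<close> are additive in \<open>f\<close>, because \<open>deg v w = 0\<close>.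
\<close>

lemma deg_central_autos_mult:
  assumes f: "f \<in> central_autos 1" and g: "g \<in> central_autos 1" and vw: "v \<in> D" "w \<in> V - D"
  shows "deg v ((f \<star> g) (e w)) = deg v (f (e w)) + deg v (g (e w))"
proof -
  note fa = central_autosD(1)[OF f] and ga = central_autosD(1)[OF g]
  have w: "e w \<in> carrier G" using vw by simp
  obtain c where c: "c \<in> Z" "g (e w) = e w \<otimes> c" using central_autosD(2)[OF g w] by blast
  have fw: "f (e w) \<in> carrier G" by (rule auto_closed[OF fa w])
  have "deg v (e w) = 0" using vw by (auto simp: deg_e)
  then show ?thesis
    using w c Z_carrier[OF c(1)] fw central_autos_1_fix[OF f c(1)]
    by (simp add: AutoGroup_mult[OF fa ga] auto_mult[OF fa] deg_simps)
qed

lemma central_autos_eqI: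
  assumes f: "f \<in> central_autos 1" and g: "g \<in> central_autos 1"
    and eq: "\<And>v w. v \<in> D \<Longrightarrow> w \<in> V - D \<Longrightarrow> deg v (f (e w)) = deg v (g (e w))"
  shows "f = g"
proof (rule auto_eqI)
  note fa = central_autosD(1)[OF f] and ga = central_autosD(1)[OF g]
  show "f \<in> auto G" "g \<in> auto G" by fact+
  have gens: "f (e w) = g (e w)" if w: "w \<in> V" for w
  proof (cases "w \<in> D")
    case True
    then show ?thesis using central_autos_1_fix[OF f e_in_Z] central_autos_1_fix[OF g e_in_Z] by simp
  next
    case False
    obtain c where c: "c \<in> Z" "f (e w) = e w \<otimes> c" using central_autosD(2)[OF f e_closed[OF w]] by blast
    obtain d where d: "d \<in> Z" "g (e w) = e w \<otimes> d" using central_autosD(2)[OF g e_closed[OF w]] by blast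
    have "c = d"
      using eq[of _ w] False w c d Z_carrier by (intro Z_eqI[OF c(1) d(1)]) (simp add: deg_simps)
    then show ?thesis using c(2) d(2) by simp
  qed
  fix x assume "x \<in> carrier G"
  from hom_eqI[OF is_group auto_hom[OF fa] auto_hom[OF ga] gens this] show "f x = g x" .
qed

end

section \<open>Semidirect decomposition and absence of minimal subgroups\<close>

lemma int_power_group_simps:
  "carrier (int_power_group N) = {..<N} \<rightarrow>\<^sub>E UNIV"
  "\<one>\<^bsub>int_power_group N\<^esub> = (\<lambda>i\<in>{..<N}. 0)"
  "x \<otimes>\<^bsub>int_power_group N\<^esub> y = (\<lambda>i\<in>{..<N}. x i + y i)"
  "x \<in> {..<N} \<rightarrow>\<^sub>E UNIV \<Longrightarrow> inv\<^bsub>int_power_group N\<^esub> x = (\<lambda>i\<in>{..<N}. - x i)"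
  by (simp_all add: int_power_group_def)

lemma comm_group_int_power_group: "comm_group (int_power_group N)"
proof (rule group.group_comm_groupI)
  show "group (int_power_group N)" by (simp add: int_power_group_def)
qed (simp add: int_power_group_simps add.commute)

definition inversion_action :: "('a, 'b) monoid_scheme \<Rightarrow> int \<Rightarrow> 'a \<Rightarrow> 'a" where
  "inversion_action K b = (\<lambda>x \<in> carrier K. if b = 0 then x else inv\<^bsub>K\<^esub> x)"

lemma inversion_action_hom:
  assumes "comm_group K"
  shows "inversion_action K \<in> hom (integer_mod_group 2) (AutoGroup K)"
proof -
  interpret comm_group K by fact
  have auto: "inversion_action K b \<in> auto K" for b
    unfolding auto_def Bij_def
  proof (intro IntI CollectI homI)
    show "bij_betw (inversion_action K b) (carrier K) (carrier K)"
      by (rule bij_betw_byWitness[where f' = "inversion_action K b"])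
        (auto simp: inversion_action_def)
  qed (auto simp: inversion_action_def inv_mult)
  show ?thesis
  proof (rule homI)
    fix b c assume "b \<in> carrier (integer_mod_group 2)" "c \<in> carrier (integer_mod_group 2)"
    then have bc: "b \<in> {0, 1}" "c \<in> {0, 1}" by (auto simp: carrier_integer_mod_group)
    show "inversion_action K (b \<otimes>\<^bsub>integer_mod_group 2\<^esub> c) =
        inversion_action K b \<otimes>\<^bsub>AutoGroup K\<^esub> inversion_action K c"
      using bc auto
      by (intro auto_eqI AutoGroup_mult_closed) (auto simp: AutoGroup_mult inversion_action_def)
  qed (use auto carrier_AutoGroup in simp)
qed

context raag_graph
begin

lemma signed_central_autos_subgroup: "subgroup signed_central_autos A"
  by (rule normal_imp_subgroup[OF signed_central_autos_normal])

lemma cone_inversion_not_central_auto: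
  assumes "D \<noteq> {}"
  shows "cone_inversion \<notin> central_autos 1"
proof
  assume c: "cone_inversion \<in> central_autos 1"
  obtain v where v: "v \<in> D" "v \<in> V" using assms D_subset by blast
  have "inv (e v) = e v"
    using central_autos_1_fix[OF c e_in_Z[OF v(1)]] cone_inversion_gen(1)[OF v(1)] by simp
  then have "- deg v (e v) = deg v (e v)"
    using deg_simps(3)[OF e_closed[OF v(2)], of v] by simp
  then show False using v(2) by (simp add: deg_e)
qed

lemma central_autos_trivial:
  assumes "D = {} \<or> V - D = {}"
  shows "central_autos 1 = {\<one>\<^bsub>A\<^esub>}"
proof -
  have "f = \<one>\<^bsub>A\<^esub>" if f: "f \<in> central_autos 1" for f
    using assms by (intro central_autos_eqI[OF f central_autos_one]) blast
  then show ?thesis using central_autos_one by blast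
qed

lemma signed_central_autos_trivial:
  assumes "D = {}"
  shows "signed_central_autos = {\<one>\<^bsub>A\<^esub>}"
proof -
  have "z [^] (-1 :: int) = z [^] (1 :: int)" if "z \<in> Z" for z
  proof -
    have "z = \<one>"
      using assms that subgroup.one_closed[OF Z_subgroup] by (intro Z_eqI) auto
    then show ?thesis by (simp only: int_pow_one)
  qed
  then have "central_autos (-1) = central_autos 1"
    by (simp add: central_autos_def)
  then show ?thesis
    using assms central_autos_trivial by (simp add: signed_central_autos_def)
qed

lemma internal_semidirect:
  assumes "D \<noteq> {}"
  shows "internal_semidirect_product A signed_central_autos (central_autos 1) {\<one>\<^bsub>A\<^esub>, cone_inversion}"
  unfolding internal_semidirect_product_def
proof (intro conjI)
  interpret A: group A by (rule AutoGroup)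
  let ?M = "signed_central_autos"
  interpret M: group "A\<lparr>carrier := ?M\<rparr>"
    by (rule A.subgroup_imp_group[OF signed_central_autos_subgroup])
  have inv: "cone_inversion \<in> carrier A" using cone_inversion_auto carrier_AutoGroup by simp
  have invM: "cone_inversion \<in> ?M" using cone_inversion_central by (simp add: signed_central_autos_def)
  have oneM: "\<one>\<^bsub>A\<^esub> \<in> ?M" using central_autos_one by (simp add: signed_central_autos_def)
  have MA: "?M \<subseteq> carrier A" by (rule subgroup.subset[OF signed_central_autos_subgroup])
  show "subgroup ?M A" by (rule signed_central_autos_subgroup)
  show "central_autos 1 \<lhd> A\<lparr>carrier := ?M\<rparr>"
    unfolding M.normal_inv_iff
  proof (intro conjI ballI)
    show "subgroup (central_autos 1) (A\<lparr>carrier := ?M\<rparr>)"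
      using A.subgroup_incl[OF normal_imp_subgroup[OF central_autos_normal] signed_central_autos_subgroup]
      by (simp add: signed_central_autos_def)
    fix g f assume g: "g \<in> carrier (A\<lparr>carrier := ?M\<rparr>)" and f: "f \<in> central_autos 1"
    then show "g \<otimes>\<^bsub>A\<lparr>carrier := ?M\<rparr>\<^esub> f \<otimes>\<^bsub>A\<lparr>carrier := ?M\<rparr>\<^esub> inv\<^bsub>A\<lparr>carrier := ?M\<rparr>\<^esub> g \<in> central_autos 1"
      using MA normal.inv_op_closed2[OF central_autos_normal, of g f]
        A.m_inv_consistent[OF signed_central_autos_subgroup, of g] by auto
  qed
  have sub: "subgroup {\<one>\<^bsub>A\<^esub>, cone_inversion} A"
    using inv cone_inversion_involution A.inv_equality[OF cone_inversion_involution inv inv]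
    by (intro A.subgroupI) auto
  show "subgroup {\<one>\<^bsub>A\<^esub>, cone_inversion} (A\<lparr>carrier := ?M\<rparr>)"
    using A.subgroup_incl[OF sub signed_central_autos_subgroup] invM oneM by simp
  show "central_autos 1 \<inter> {\<one>\<^bsub>A\<^esub>, cone_inversion} = {\<one>\<^bsub>A\<^esub>}"
    using cone_inversion_not_central_auto[OF assms] central_autos_one by blast
  have "f \<star> \<one>\<^bsub>A\<^esub> = f" if "f \<in> central_autos 1" for f
    using central_autosD(1)[OF that] carrier_AutoGroup by simp
  then show "central_autos 1 <#>\<^bsub>A\<^esub> {\<one>\<^bsub>A\<^esub>, cone_inversion} = ?M"
    unfolding signed_central_autos_eq set_mult_def by auto
qed

text \<open>
A bijection \<open>\<gamma>\<close> from the matrix positions to \<open>{..<n * m}\<close> turns \<open>central_shear\<close> into an isomorphism \<open>\<sigma>\<close> from the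
integer vectors onto \<open>T_cone\<close>. The relation \<open>\<epsilon>_comm\<close> between \<open>\<sigma>\<close> and the inversion of the cone vertices
is the multiplication rule of the semidirect product.
\<close>

lemma semidirect_iso:
  assumes D: "D \<noteq> {}" and nm: "n = card D" "m = card (V - D)"
  shows "\<exists>\<phi> \<in> hom (integer_mod_group 2) (AutoGroup (int_power_group (n * m))).
    \<exists>h \<in> iso (semidirect_product (int_power_group (n * m)) (integer_mod_group 2) \<phi>)
      (A\<lparr>carrier := signed_central_autos\<rparr>).
      h ` (carrier (int_power_group (n * m)) \<times> {\<one>\<^bsub>integer_mod_group 2\<^esub>}) = central_autos 1 \<and>
      h ` ({\<one>\<^bsub>int_power_group (n * m)\<^esub>} \<times> carrier (integer_mod_group 2)) = {\<one>\<^bsub>A\<^esub>, cone_inversion}"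
proof -
  interpret A: group A by (rule AutoGroup)
  let ?P = "int_power_group (n * m)" and ?Z2 = "integer_mod_group 2" and ?M = "signed_central_autos"
  let ?\<iota> = cone_inversion
  interpret P: comm_group ?P by (rule comm_group_int_power_group)
  let ?\<phi> = "inversion_action ?P"
  have Z2: "carrier ?Z2 = {0, 1}" by (auto simp: carrier_integer_mod_group)
  have "finite ((V - D) \<times> D)" using finite_V finite_subset[OF D_subset] by simp
  moreover have "card ((V - D) \<times> D) = n * m" by (simp add: nm card_cartesian_product)
  ultimately obtain \<gamma> where \<gamma>: "bij_betw \<gamma> ((V - D) \<times> D) {..<n * m}"
    using ex_bij_betw_finite_nat[of "(V - D) \<times> D"] by (auto simp: atLeast0LessThan)
  define \<sigma> where "\<sigma> k = central_shear (\<lambda>p. k (\<gamma> p))" for k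
  have \<gamma>lt: "\<gamma> (w, v) < n * m" if "v \<in> D" "w \<in> V - D" for v w
    using bij_betwE[OF \<gamma>] that by auto
  have \<sigma>c: "\<sigma> k \<in> central_autos 1" "\<sigma> k \<in> carrier A" for k
    unfolding \<sigma>_def using central_shear_central central_autosD(1)[OF central_shear_central] carrier_AutoGroup
    by simp_all
  have \<sigma>_deg: "deg v (\<sigma> k (e w)) = k (\<gamma> (w, v))" if "v \<in> D" "w \<in> V - D" for k v w
    using that by (simp add: \<sigma>_def deg_central_shear)
  have \<sigma>_mult: "\<sigma> (k \<otimes>\<^bsub>?P\<^esub> l) = \<sigma> k \<star> \<sigma> l" for k l
    using central_autos_mult[OF \<sigma>c(1) \<sigma>c(1), of k l]
    by (intro central_autos_eqI \<sigma>c)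
      (simp_all add: \<sigma>_deg deg_central_autos_mult[OF \<sigma>c(1) \<sigma>c(1)] int_power_group_simps(3) \<gamma>lt)
  have \<sigma>_one: "\<sigma> \<one>\<^bsub>?P\<^esub> = \<one>\<^bsub>A\<^esub>"
    using \<sigma>_mult[of "\<one>\<^bsub>?P\<^esub>" "\<one>\<^bsub>?P\<^esub>"] \<sigma>c(2) by simp
  have \<sigma>_inv: "\<sigma> (inv\<^bsub>?P\<^esub> k) = inv\<^bsub>A\<^esub> (\<sigma> k)" if "k \<in> carrier ?P" for k
    using \<sigma>_mult[of "inv\<^bsub>?P\<^esub> k" k] \<sigma>c(2) that \<sigma>_one by (intro A.inv_equality[symmetric]) simp_all
  have \<sigma>_inj: "k = l" if "k \<in> carrier ?P" "l \<in> carrier ?P" "\<sigma> k = \<sigma> l" for k l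
  proof (rule extensionalityI[of _ "{..<n * m}"])
    show "k \<in> extensional {..<n * m}" "l \<in> extensional {..<n * m}"
      using that(1,2) by (auto simp: int_power_group_simps PiE_def)
    fix i assume "i \<in> {..<n * m}"
    then have "i \<in> \<gamma> ` ((V - D) \<times> D)" unfolding bij_betw_imp_surj_on[OF \<gamma>] .
    then obtain w v where "w \<in> V - D" "v \<in> D" "i = \<gamma> (w, v)" by blast
    then show "k i = l i" using \<sigma>_deg that(3) by metis
  qed
  have \<sigma>_surj: "\<sigma> ` carrier ?P = central_autos 1"
  proof (intro equalityI subsetI)
    fix f assume f: "f \<in> central_autos 1"
    let ?k = "\<lambda>i\<in>{..<n * m}. case inv_into ((V - D) \<times> D) \<gamma> i of (w, v) \<Rightarrow> deg v (f (e w))"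
    have "?k (\<gamma> (w, v)) = deg v (f (e w))" if "v \<in> D" "w \<in> V - D" for v w
      using \<gamma>lt[OF that] that \<gamma> by (simp add: bij_betw_inv_into_left[OF \<gamma>])
    then have "f = \<sigma> ?k"
      by (intro central_autos_eqI f \<sigma>c) (simp add: \<sigma>_deg)
    moreover have "?k \<in> carrier ?P" by (simp add: int_power_group_simps)
    ultimately show "f \<in> \<sigma> ` carrier ?P" by blast
  qed (use \<sigma>c in auto)
  define \<epsilon> where "\<epsilon> b = (if b = 0 then \<one>\<^bsub>A\<^esub> else ?\<iota>)" for b :: int
  have \<iota>A: "?\<iota> \<in> carrier A" using cone_inversion_auto carrier_AutoGroup by simp
  have \<epsilon>A: "\<epsilon> b \<in> carrier A" for b using \<iota>A by (simp add: \<epsilon>_def)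
  have \<epsilon>_mult: "\<epsilon> ((b + c) mod 2) = \<epsilon> b \<star> \<epsilon> c" if "b \<in> {0, 1}" "c \<in> {0, 1}" for b c
    using that \<iota>A cone_inversion_involution by (auto simp: \<epsilon>_def)
  have \<epsilon>_comm: "\<epsilon> b \<star> \<sigma> k = \<sigma> (?\<phi> b k) \<star> \<epsilon> b" if "k \<in> carrier ?P" for b k
  proof (cases "b = 0")
    case False
    have "\<sigma> (inv\<^bsub>?P\<^esub> k) \<star> ?\<iota> = ?\<iota> \<star> inv\<^bsub>A\<^esub> (\<sigma> (inv\<^bsub>?P\<^esub> k))"
      by (rule central_autos_twisted_commute[OF \<sigma>c(1) cone_inversion_central])
    then show ?thesis
      using False that \<sigma>c(2) by (simp add: \<epsilon>_def inversion_action_def \<sigma>_inv)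
  qed (use \<sigma>c(2) that in \<open>simp add: \<epsilon>_def inversion_action_def\<close>)
  define h where "h = (\<lambda>(k, b). \<sigma> k \<star> \<epsilon> b)"
  let ?S = "semidirect_product ?P ?Z2 ?\<phi>"
  have S: "carrier ?S = carrier ?P \<times> {0, 1}" by (simp add: semidirect_product_def Z2)
  have "h \<in> iso ?S (A\<lparr>carrier := ?M\<rparr>)"
  proof (rule isoI)
    show "h \<in> hom ?S (A\<lparr>carrier := ?M\<rparr>)"
    proof (rule homI)
      fix x assume "x \<in> carrier ?S"
      then show "h x \<in> carrier (A\<lparr>carrier := ?M\<rparr>)"
        using \<sigma>c unfolding signed_central_autos_eq by (auto simp: S h_def \<epsilon>_def)
    next
      fix x y assume xy: "x \<in> carrier ?S" "y \<in> carrier ?S"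
      obtain k b l c where kb: "x = (k, b)" "y = (l, c)" by (cases x, cases y)
      have kl: "k \<in> carrier ?P" "l \<in> carrier ?P" "b \<in> {0, 1}" "c \<in> {0, 1}" using xy by (auto simp: S kb)
      have "h (x \<otimes>\<^bsub>?S\<^esub> y) = \<sigma> k \<star> \<sigma> (?\<phi> b l) \<star> (\<epsilon> b \<star> \<epsilon> c)"
        using \<epsilon>_mult[OF kl(3,4)] by (simp add: h_def kb semidirect_product_def \<sigma>_mult)
      also have "\<dots> = \<sigma> k \<star> (\<sigma> (?\<phi> b l) \<star> \<epsilon> b) \<star> \<epsilon> c"
        using \<sigma>c(2) \<epsilon>A by (simp add: A.m_assoc)
      also have "\<dots> = (\<sigma> k \<star> \<epsilon> b) \<star> (\<sigma> l \<star> \<epsilon> c)"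
        unfolding \<epsilon>_comm[OF kl(2), symmetric] using \<sigma>c(2) \<epsilon>A by (simp add: A.m_assoc)
      finally show "h (x \<otimes>\<^bsub>?S\<^esub> y) = h x \<otimes>\<^bsub>A\<lparr>carrier := ?M\<rparr>\<^esub> h y"
        by (simp add: h_def kb)
    qed
    have "inj_on h (carrier ?S)"
    proof (rule inj_onI)
      fix x y assume xy: "x \<in> carrier ?S" "y \<in> carrier ?S" "h x = h y"
      obtain k b l c where kb: "x = (k, b)" "y = (l, c)" by (cases x, cases y)
      have kl: "k \<in> carrier ?P" "l \<in> carrier ?P" "b \<in> {0, 1}" "c \<in> {0, 1}" using xy by (auto simp: S kb)
      have eq: "\<sigma> k \<star> \<epsilon> b = \<sigma> l \<star> \<epsilon> c" using xy(3) by (simp add: h_def kb)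
      have no: "\<sigma> k' \<noteq> \<sigma> l' \<star> ?\<iota>" for k' l'
      proof
        assume "\<sigma> k' = \<sigma> l' \<star> ?\<iota>"
        then have "?\<iota> = inv\<^bsub>A\<^esub> (\<sigma> l') \<star> \<sigma> k'"
          using \<sigma>c(2) \<iota>A by (simp add: A.m_assoc[symmetric])
        also have "\<dots> \<in> central_autos 1"
          using central_autos_mult[OF central_autos_inv[OF \<sigma>c(1), of l'] \<sigma>c(1), of k'] by simp
        finally show False using cone_inversion_not_central_auto[OF D] by simp
      qed
      have bc: "b = c"
        using kl(3,4) eq no[of k l] no[of l k] \<sigma>c(2) by (auto simp: \<epsilon>_def)
      then have "\<sigma> k = \<sigma> l" using eq \<sigma>c(2) \<epsilon>A by simp
      then show "x = y" using \<sigma>_inj kl bc by (simp add: kb)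
    qed
    moreover have "h ` carrier ?S = ?M"
    proof -
      have "h ` carrier ?S = \<sigma> ` carrier ?P \<union> (\<lambda>f. f \<star> ?\<iota>) ` \<sigma> ` carrier ?P"
        using \<sigma>c(2) by (auto simp: S h_def \<epsilon>_def image_iff)
      then show ?thesis by (simp only: \<sigma>_surj signed_central_autos_eq)
    qed
    ultimately show "bij_betw h (carrier ?S) (carrier (A\<lparr>carrier := ?M\<rparr>))"
      by (simp add: bij_betw_def)
  qed
  moreover have "h ` (carrier ?P \<times> {\<one>\<^bsub>?Z2\<^esub>}) = central_autos 1"
  proof -
    have "carrier ?P \<times> {\<one>\<^bsub>?Z2\<^esub>} = (\<lambda>k. (k, 0)) ` carrier ?P" by auto
    then show ?thesis
      using \<sigma>c(2) by (simp add: \<sigma>_surj[symmetric] image_image h_def \<epsilon>_def)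
  qed
  moreover have "h ` ({\<one>\<^bsub>?P\<^esub>} \<times> carrier ?Z2) = {\<one>\<^bsub>A\<^esub>, ?\<iota>}"
  proof -
    have "{\<one>\<^bsub>?P\<^esub>} \<times> carrier ?Z2 = {(\<one>\<^bsub>?P\<^esub>, 0), (\<one>\<^bsub>?P\<^esub>, 1)}" unfolding Z2 by auto
    then show ?thesis
      using \<sigma>_one \<iota>A by (simp add: h_def \<epsilon>_def)
  qed
  ultimately show ?thesis
    using inversion_action_hom[OF P.comm_group_axioms] by blast
qed

text \<open>
If \<open>N\<close> contains an automorphism \<open>f\<close> inverting \<open>Z\<close>, then \<open>[s, f] = s\<^sup>2\<close> for \<open>s\<close> in \<open>T_cone\<close>, so \<open>N\<close> always meets
\<open>T_cone\<close> nontrivially and is contained in it by minimality. The subgroup of squares of \<open>N\<close> is again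
normal and nontrivial, hence equal to \<open>N\<close>; but an element of \<open>N\<close> with a nonzero coordinate of least
absolute value cannot be a square.
\<close>

lemma no_minimal_nfs_normal:
  assumes D: "D \<noteq> {}" and W: "V - D \<noteq> {}"
  shows "\<not> minimal_nontrivial_nfs_normal N A"
proof
  interpret A: group A by (rule AutoGroup)
  let ?T = "central_autos 1"
  assume "minimal_nontrivial_nfs_normal N A"
  then have N: "N \<lhd> A" "N \<subseteq> signed_central_autos" "N \<noteq> {\<one>\<^bsub>A\<^esub>}"
    and min: "\<And>M. M \<lhd> A \<Longrightarrow> M \<subseteq> N \<Longrightarrow> M \<noteq> {\<one>\<^bsub>A\<^esub>} \<Longrightarrow> M = N"
    unfolding minimal_nontrivial_nfs_normal_def nfs_normal_iff by (blast, blast, blast, blast)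
  have TA: "f \<in> carrier A" if "f \<in> central_autos s" for f s
    using central_autosD(1)[OF that] carrier_AutoGroup by simp
  note Nsub = normal_imp_subgroup[OF N(1)]
  have one: "\<one>\<^bsub>A\<^esub> \<in> N" by (rule subgroup.one_closed[OF Nsub])
  have coord: "\<exists>v \<in> D. \<exists>w \<in> V - D. deg v (f (e w)) \<noteq> 0" if "f \<in> ?T" "f \<noteq> \<one>\<^bsub>A\<^esub>" for f
  proof (rule ccontr)
    assume "\<not> ?thesis"
    then have "f = \<one>\<^bsub>A\<^esub>"
      by (intro central_autos_eqI that(1) central_autos_one) (auto simp: AutoGroup_one deg_e)
    then show False using that(2) by blast
  qed
  have sq: "deg v ((f \<star> f) (e w)) = 2 * deg v (f (e w))" if "f \<in> ?T" "v \<in> D" "w \<in> V - D" for f v w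
    using deg_central_autos_mult[OF that(1,1,2,3)] by simp
  have sq_one: "f \<star> f \<noteq> \<one>\<^bsub>A\<^esub>" if f: "f \<in> ?T" "f \<noteq> \<one>\<^bsub>A\<^esub>" for f
  proof
    assume eq: "f \<star> f = \<one>\<^bsub>A\<^esub>"
    obtain v w where vw: "v \<in> D" "w \<in> V - D" "deg v (f (e w)) \<noteq> 0" using coord[OF f] by blast
    have "deg v (e w) = 0" using vw by (auto simp: deg_e)
    then show False using sq[OF f(1) vw(1,2)] vw eq by (simp add: AutoGroup_one)
  qed
  have "\<exists>f \<in> N \<inter> ?T. f \<noteq> \<one>\<^bsub>A\<^esub>"
  proof (cases "N \<subseteq> ?T")
    case True
    then show ?thesis using N(3) one by blast
  next
    case False
    then obtain f where f: "f \<in> N" "f \<in> central_autos (-1)" using N(2) by (auto simp: signed_central_autos_def)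
    obtain v w where vw: "v \<in> D" "w \<in> V - D" using D W by blast
    let ?s = "central_shear (\<lambda>p. 1)"
    have s: "?s \<in> ?T" by (rule central_shear_central)
    have "?s \<noteq> \<one>\<^bsub>A\<^esub>"
    proof
      assume "?s = \<one>\<^bsub>A\<^esub>"
      moreover have "deg v (e w) = 0" using vw by (auto simp: deg_e)
      ultimately show False using deg_central_shear[OF vw, of "\<lambda>p. 1"] vw by (simp add: AutoGroup_one)
    qed
    then have ne: "?s \<star> ?s \<noteq> \<one>\<^bsub>A\<^esub>" by (rule sq_one[OF s])
    have sA: "?s \<in> carrier A" and fA: "f \<in> carrier A" using TA s f(2) by auto
    have "?s \<star> f \<star> inv\<^bsub>A\<^esub> ?s \<star> inv\<^bsub>A\<^esub> f = ?s \<star> (f \<star> inv\<^bsub>A\<^esub> ?s) \<star> inv\<^bsub>A\<^esub> f"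
      using sA fA by (simp add: A.m_assoc)
    also have "\<dots> = ?s \<star> ?s"
      unfolding central_autos_twisted_commute[OF s f(2), symmetric] using sA fA by (simp add: A.m_assoc)
    finally have "?s \<star> ?s = ?s \<star> f \<star> inv\<^bsub>A\<^esub> ?s \<star> inv\<^bsub>A\<^esub> f" by simp
    also have "\<dots> \<in> N"
      using normal.inv_op_closed2[OF N(1) sA f(1)] subgroup.m_inv_closed[OF Nsub f(1)]
        subgroup.m_closed[OF Nsub] by blast
    finally have "?s \<star> ?s \<in> N \<inter> ?T" using central_autos_mult[OF s s] by simp
    with ne show ?thesis by blast
  qed
  moreover have "N \<inter> ?T \<lhd> A"
    using N(1) central_autos_normal A.normal_subgroup_intersect by blast
  ultimately have "N \<inter> ?T = N" by (intro min) auto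
  then have NT: "N \<subseteq> ?T" by blast
  let ?Q = "(\<lambda>f. f \<star> f) ` N"
  have "subgroup ?Q A"
  proof (rule A.subgroupI)
    show "?Q \<subseteq> carrier A" using TA NT by auto
    show "?Q \<noteq> {}" using one by blast
    fix x assume "x \<in> ?Q"
    then obtain f where f: "f \<in> N" "x = f \<star> f" by blast
    have fA: "f \<in> carrier A" using TA NT f(1) by blast
    have "inv\<^bsub>A\<^esub> x = inv\<^bsub>A\<^esub> f \<star> inv\<^bsub>A\<^esub> f" unfolding f(2) by (rule A.inv_mult_group[OF fA fA])
    then show "inv\<^bsub>A\<^esub> x \<in> ?Q" using subgroup.m_inv_closed[OF Nsub f(1)] by blast
    fix y assume "y \<in> ?Q"
    then obtain g where g: "g \<in> N" "y = g \<star> g" by blast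
    have gA: "g \<in> carrier A" using TA NT g(1) by blast
    have "x \<star> y = f \<star> (f \<star> g) \<star> g"
      using f(2) g(2) fA gA by (simp add: A.m_assoc)
    also have "f \<star> g = g \<star> f" using central_autos_commute NT f(1) g(1) by blast
    finally have "x \<star> y = (f \<star> g) \<star> (f \<star> g)" using fA gA by (simp add: A.m_assoc)
    then show "x \<star> y \<in> ?Q" using subgroup.m_closed[OF Nsub f(1) g(1)] by blast
  qed
  moreover have "g \<star> x \<star> inv\<^bsub>A\<^esub> g \<in> ?Q" if g: "g \<in> carrier A" and x: "x \<in> ?Q" for g x
  proof -
    obtain f where f: "f \<in> N" "x = f \<star> f" using x by blast
    have fA: "f \<in> carrier A" using TA NT f(1) by blast
    have "inv\<^bsub>A\<^esub> g \<star> (g \<star> (f \<star> inv\<^bsub>A\<^esub> g)) = f \<star> inv\<^bsub>A\<^esub> g"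
      using g fA by (simp add: A.m_assoc[symmetric])
    then have "g \<star> x \<star> inv\<^bsub>A\<^esub> g = (g \<star> f \<star> inv\<^bsub>A\<^esub> g) \<star> (g \<star> f \<star> inv\<^bsub>A\<^esub> g)"
      using g fA by (simp add: f(2) A.m_assoc)
    then show ?thesis using normal.inv_op_closed2[OF N(1) g f(1)] by blast
  qed
  ultimately have "?Q \<lhd> A" unfolding A.normal_inv_iff by blast
  moreover have "?Q \<subseteq> N" using subgroup.m_closed[OF Nsub] by blast
  moreover obtain f where f: "f \<in> N" "f \<noteq> \<one>\<^bsub>A\<^esub>" using N(3) one by blast
  then have "?Q \<noteq> {\<one>\<^bsub>A\<^esub>}" using sq_one NT by blast
  ultimately have Q: "?Q = N" by (rule min)
  obtain v w where vw: "v \<in> D" "w \<in> V - D" and nz: "deg v (f (e w)) \<noteq> 0" using coord f NT by blast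
  have "\<exists>r. r \<in> N \<and> deg v (r (e w)) \<noteq> 0" using f(1) nz by blast
  then obtain r where r: "r \<in> N" "deg v (r (e w)) \<noteq> 0"
    and least: "\<And>r'. r' \<in> N \<Longrightarrow> deg v (r' (e w)) \<noteq> 0 \<Longrightarrow> nat \<bar>deg v (r (e w))\<bar> \<le> nat \<bar>deg v (r' (e w))\<bar>"
    using ex_has_least_nat[of "\<lambda>r. r \<in> N \<and> deg v (r (e w)) \<noteq> 0" _ "\<lambda>r. nat \<bar>deg v (r (e w))\<bar>"] by blast
  obtain t where t: "t \<in> N" "r = t \<star> t" using r(1) Q by blast
  have "deg v (r (e w)) = 2 * deg v (t (e w))"
    unfolding t(2) using sq[OF _ vw] NT t(1) by blast
  then show False using least[OF t(1)] r(2) by auto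
qed

end

theorem theoremB:
  fixes V :: "'v set" and E :: "'v set set" and n m :: nat
  assumes "finite V" and "simplicial_graph V E"
    and "n = card (cone_vertices V E)" and "m = card (V - cone_vertices V E)"
  shows
    "(\<forall>N. maximal_nfs_normal N (AutoGroup (raag V E)) \<and> N \<noteq> {\<one>\<^bsub>AutoGroup (raag V E)\<^esub>} \<longrightarrow>
        (V - cone_vertices V E = {} \<and>
         (\<exists>\<iota> \<in> carrier (AutoGroup (raag V E)).
            (\<forall>v \<in> cone_vertices V E. \<iota> (raag_gen V E v) = inv\<^bsub>raag V E\<^esub> (raag_gen V E v)) \<and>
            N = {\<one>\<^bsub>AutoGroup (raag V E)\<^esub>, \<iota>}))
      \<or> (n \<ge> 1 \<and> m \<ge> 1 \<and>
         (\<exists>\<iota> \<in> carrier (AutoGroup (raag V E)).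
            (\<forall>v \<in> cone_vertices V E. \<iota> (raag_gen V E v) = inv\<^bsub>raag V E\<^esub> (raag_gen V E v)) \<and>
            (\<forall>w \<in> V - cone_vertices V E. \<iota> (raag_gen V E w) = raag_gen V E w) \<and>
            internal_semidirect_product (AutoGroup (raag V E)) N
              (T_cone V E) {\<one>\<^bsub>AutoGroup (raag V E)\<^esub>, \<iota>} \<and>
            (\<exists>\<phi> \<in> hom (integer_mod_group 2) (AutoGroup (int_power_group (n * m))).
             \<exists>h \<in> iso (semidirect_product (int_power_group (n * m)) (integer_mod_group 2) \<phi>)
                      ((AutoGroup (raag V E))\<lparr>carrier := N\<rparr>).
               h ` (carrier (int_power_group (n * m)) \<times> {\<one>\<^bsub>integer_mod_group 2\<^esub>}) = T_cone V E \<and>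
               h ` ({\<one>\<^bsub>int_power_group (n * m)\<^esub>} \<times> carrier (integer_mod_group 2))
                 = {\<one>\<^bsub>AutoGroup (raag V E)\<^esub>, \<iota>}))))
     \<and>
     (\<forall>N. minimal_nontrivial_nfs_normal N (AutoGroup (raag V E)) \<and> n \<ge> 1 \<and> m \<ge> 1 \<longrightarrow>
        (\<exists>l. n \<le> l \<and> l \<le> n * m \<and> (AutoGroup (raag V E))\<lparr>carrier := N\<rparr> \<cong> int_power_group l))"
proof -
  interpret raag_graph V E "raag V E"
    using assms(1,2) by unfold_locales auto
  have fin: "finite D" "finite (V - D)"
    using finite_V finite_subset[OF D_subset] by auto
  have card: "n \<ge> 1 \<longleftrightarrow> D \<noteq> {}" "m \<ge> 1 \<longleftrightarrow> V - D \<noteq> {}"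
    using fin assms(3,4) by (auto simp: Suc_le_eq card_gt_0_iff)
  have \<iota>: "cone_inversion \<in> carrier A" using cone_inversion_auto carrier_AutoGroup by simp
  show ?thesis
  proof (intro conjI allI impI)
    fix N
    assume "maximal_nfs_normal N A \<and> N \<noteq> {\<one>\<^bsub>A\<^esub>}"
    then have N: "N = signed_central_autos" and D: "D \<noteq> {}"
      using maximal_nfs_normal_iff signed_central_autos_trivial by auto
    show "(V - D = {} \<and> (\<exists>\<iota>\<in>carrier A. (\<forall>v\<in>D. \<iota> (e v) = inv\<^bsub>raag V E\<^esub> e v) \<and> N = {\<one>\<^bsub>A\<^esub>, \<iota>})) \<or>
        (n \<ge> 1 \<and> m \<ge> 1 \<and> (\<exists>\<iota>\<in>carrier A. (\<forall>v\<in>D. \<iota> (e v) = inv\<^bsub>raag V E\<^esub> e v) \<and>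
          (\<forall>w\<in>V - D. \<iota> (e w) = e w) \<and> internal_semidirect_product A N (T_cone V E) {\<one>\<^bsub>A\<^esub>, \<iota>} \<and>
          (\<exists>\<phi> \<in> hom (integer_mod_group 2) (AutoGroup (int_power_group (n * m))).
           \<exists>h \<in> iso (semidirect_product (int_power_group (n * m)) (integer_mod_group 2) \<phi>) (A\<lparr>carrier := N\<rparr>).
             h ` (carrier (int_power_group (n * m)) \<times> {\<one>\<^bsub>integer_mod_group 2\<^esub>}) = T_cone V E \<and>
             h ` ({\<one>\<^bsub>int_power_group (n * m)\<^esub>} \<times> carrier (integer_mod_group 2)) = {\<one>\<^bsub>A\<^esub>, \<iota>})))"
    proof (cases "V - D = {}")
      case True
      interpret A: group A by (rule AutoGroup)
      have "N = {\<one>\<^bsub>A\<^esub>, cone_inversion}"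
        unfolding N signed_central_autos_eq central_autos_trivial[OF disjI2[OF True]] using \<iota> by auto
      then show ?thesis
        using True cone_inversion_gen(1) by (intro disjI1 conjI bexI[OF _ \<iota>] ballI) simp_all
    next
      case False
      then have "n \<ge> 1" "m \<ge> 1" using D card by blast+
      then show ?thesis
        unfolding N T_cone_eq
        by (intro disjI2 conjI bexI[OF _ \<iota>] ballI cone_inversion_gen internal_semidirect[OF D]
            semidirect_iso[OF D assms(3,4)])
    qed
  next
    fix N
    assume "minimal_nontrivial_nfs_normal N A \<and> n \<ge> 1 \<and> m \<ge> 1"
    then show "\<exists>l. n \<le> l \<and> l \<le> n * m \<and> A\<lparr>carrier := N\<rparr> \<cong> int_power_group l"
      using no_minimal_nfs_normal card by blast
  qed
qed

end
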